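(* Let $q$ be complex with $|q|<1$ and let $z,\rho,\rho_1,\rho_2$ be complex parameters for which all series below converge absolutely and no denominator vanishes. Define \begin{align*} F(\rho_1,\rho_2,z;q)&=\frac{(q;q)_\infty}{(z,z^{-1},\rho_1,\rho_2;q)_\infty}\sum_{n=1}^\infty\frac{(z,z^{-1},\rho_1,\rho_2;q)_n(\tfrac{q}{\rho_1\rho_2})^n}{(q;q)_{2n}},\\ G(\rho_1,\rho_2,z;q)&=\frac{(q;q)_\infty}{(z,z^{-1},\rho_1,\rho_2;q)_\infty}\sum_{n=1}^\infty\frac{(z,z^{-1},\rho_1,\rho_2;q)_n(\tfrac{q^2}{\rho_1\rho_2})^n}{(q;q)_{2n}},\\ F(\rho,z;q)&=\frac{(q;q)_\infty}{(\rho,z,z^{-1};q)_\infty}\sum_{n=1}^\infty\frac{(z,z^{-1},\rho;q)_n(-1)^nq^{n(n+1)/2}\rho^{-n}}{(q;q)_{2n}},\\ G(\rho,z;q)&=\frac{(q;q)_\infty}{(\rho,z,z^{-1};q)_\infty}\sum_{n=1}^\infty\frac{(z,z^{-1},\rho;q)_n(-1)^nq^{n(n+3)/2}\rho^{-n}}{(q;q)_{2n}}, \end{align*} and define $S_{G1}(z,q)=G(q,q^2,z;q^2)$, $S_{G2}(z,q)=G(iq^{1/2},-iq^{1/2},z;q)$, $S_{F1}(z,q)=F(-q,z;q)$, $S_{G3}(z,q)=G(q,z;q)$, and \begin{align*} S_{L7}(z;q)&=\frac{(-q;q)_\infty}{(z,z^{-1};q^2)_\infty}\sum_{n=1}^\infty\frac{(z,z^{-1};q^2)_n\,q^{2n}}{(-q;q)_{2n}},\quad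 S_{L9}(z;q)=\frac{(q;q^2)_\infty}{(z,z^{-1};q)_\infty}\sum_{n=1}^\infty\frac{(z,z^{-1};q)_n\,q^{n}}{(q;q^2)_{n}},\\ S_{L12}(z;q)&=\frac{(-q;q^2)_\infty^2}{(z,z^{-1};q^2)_\infty}\sum_{n=1}^\infty\frac{(z,z^{-1};q^2)_n\,q^{2n}}{(-q;q^2)_{n}(-q;q^2)_{n+1}}. \end{align*} Writing $W_j(z)=(1-z^j)(1-z^{j-1})z^{1-j}$, the following identities hold: \begin{align*} S_{L7}(z;q)&=\frac{1}{(1+z)(q^2,z,z^{-1};q^2)_\infty}\sum_{j=1}^\infty\sum_{n=0}^\infty W_j(z)(-1)^{j+1}(1+q^{2j-1})q^{j(j-1)+\frac{n(n-1)}{2}+2jn},\\ S_{L9}(z;q)&=\frac{1}{(1+z)(q,z,z^{-1};q)_\infty}\sum_{j=1}^\infty\sum_{n=0}^\infty W_j(z)(-1)^{j+n+1}(1-q^{2j-1})q^{\frac{j(j-1)}{2}+n^2+2jn},\\ S_{L12}(z;q)&=\frac{1}{(1+z)(q^2,z,z^{-1};q^2)_\infty}\sum_{j=1}^\infty\sum_{n=0}^\infty W_j(z)(-1)^{j+1}(1+q^{2j-1})q^{j(j-1)+n^2+2jn},\\ F(\rho_1,\rho_2,z;q)&=\sum_{j=1}^\infty\frac{W_j(z)(-1)^{j+1}q^{j(j-1)/2}(\rho_1,\rho_2;q)_{j-1}(\tfrac{q^{j+1}}{\rho_1},\tfrac{q^{j+1}}{\rho_2};q)_\infty}{(1+z)\rho_1^{j-1}\rho_2^{j-1}(z,z^{-1},\rho_1,\rho_2,\tfrac{q}{\rho_1\rho_2};q)_\infty}\Big(1-\tfrac{q^j}{\rho_1}-\tfrac{q^j}{\rho_2}+\tfrac{q^{3j-1}}{\rho_1}+\tfrac{q^{3j-1}}{\rho_2}-q^{4j-2}\Big),\\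 G(\rho_1,\rho_2,z;q)&=\sum_{j=1}^\infty\frac{W_j(z)(-1)^{j+1}(1-q^{2j-1})q^{\frac{j(j+1)}{2}-1}(\rho_1,\rho_2;q)_{j-1}(\tfrac{q^{j+1}}{\rho_1},\tfrac{q^{j+1}}{\rho_2};q)_\infty}{(1+z)\rho_1^{j-1}\rho_2^{j-1}(z,z^{-1},\rho_1,\rho_2,\tfrac{q^2}{\rho_1\rho_2};q)_\infty},\\ F(\rho,z;q)&=\sum_{j=1}^\infty\frac{W_j(z)q^{(j-1)^2}(\rho;q)_{j-1}(\tfrac{q^{j+1}}{\rho};q)_\infty}{(1+z)\rho^{j-1}(z,z^{-1},\rho;q)_\infty}\Big(1-\tfrac{q^j}{\rho}+\tfrac{q^{3j-1}}{\rho}-q^{4j-2}\Big),\\ G(\rho,z;q)&=\sum_{j=1}^\infty\frac{W_j(z)(1-q^{2j-1})q^{j(j-1)}(\rho;q)_{j-1}(\tfrac{q^{j+1}}{\rho};q)_\infty}{(1+z)\rho^{j-1}(z,z^{-1},\rho;q)_\infty},\\ S_{G1}(z,q)&=\frac{1}{(1+z)(z,z^{-1},q;q^2)_\infty}\sum_{j=1}^\infty W_j(z)(-1)^{j+1}(1+q^{2j-1})q^{(j-1)^2},\\ S_{G2}(z,q)&=\frac{1}{(1+z)(z,z^{-1},q;q)_\infty}\sum_{j=-\infty}^\infty\frac{W_j(z)(-1)^{j+1}q^{j(j-1)/2}}{1+q^{2j-1}},\\ S_{F1}(z,q)&=\frac{1}{(1+z)(z,z^{-1};q)_\infty}\sum_{j=-\infty}^\infty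 W_j(z)(-1)^{j+1}q^{j^2-3j+2}(1+q^{j-1})\\ &=\frac{(z^{-1}q^2,zq^2,q^2;q^2)_\infty}{(zq,z^{-1}q;q)_\infty}+\frac{(z^{-1}q,zq,q^2;q^2)_\infty}{(z,z^{-1};q)_\infty}-\frac{(q,q,q^2;q^2)_\infty}{(z,z^{-1};q)_\infty},\\ S_{G3}(z,q)&=\frac{1}{(1+z)(z,z^{-1};q)_\infty}\sum_{j=1}^\infty W_j(z)(1-q^{2j-1})q^{(j-1)^2}. \end{align*}
   Context: Standard $q$-Pochhammer notation: $(a;q)_n=\prod_{j=0}^{n-1}(1-aq^j)$, $(a;q)_\infty=\prod_{j=0}^{\infty}(1-aq^j)$, and $(a_1,\dots,a_k;q)_n=(a_1;q)_n\cdots(a_k;q)_n$. Here $i=\sqrt{-1}$. The functions $F(\rho,z;q)$ and $G(\rho,z;q)$ equal $\lim_{\rho_2\to\infty}(\rho_2;q)_\infty F(\rho,\rho_2,z;q)$ and $\lim_{\rho_2\to\infty}(\rho_2;q)_\infty G(\rho,\rho_2,z;q)$ respectively. *)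

theory Defs
  imports "HOL-Analysis.Analysis"
begin

definition qpoch :: "complex \<Rightarrow> complex \<Rightarrow> nat \<Rightarrow> complex" where
  "qpoch a q n = (\<Prod>j<n. 1 - a * q ^ j)"

definition qpoch_inf :: "complex \<Rightarrow> complex \<Rightarrow> complex" where
  "qpoch_inf a q = (\<Prod>j. 1 - a * q ^ j)"

definition qpochs :: "complex list \<Rightarrow> complex \<Rightarrow> nat \<Rightarrow> complex" where
  "qpochs as q n = (\<Prod>a\<leftarrow>as. qpoch a q n)"

definition qpochs_inf :: "complex list \<Rightarrow> complex \<Rightarrow> complex" where
  "qpochs_inf as q = (\<Prod>a\<leftarrow>as. qpoch_inf a q)"

text \<open>
  The functions \<open>F\<close> and \<open>G\<close> of the source are overloaded by arity: \<open>F2\<close>, \<open>G2\<close> are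
  \<open>F(\<rho>\<^sub>1, \<rho>\<^sub>2, z; q)\<close>, \<open>G(\<rho>\<^sub>1, \<rho>\<^sub>2, z; q)\<close>, and \<open>F1\<close>, \<open>G1\<close> are \<open>F(\<rho>, z; q)\<close>, \<open>G(\<rho>, z; q)\<close>.
\<close>

definition F2_term :: "complex \<Rightarrow> complex \<Rightarrow> complex \<Rightarrow> complex \<Rightarrow> nat \<Rightarrow> complex" where
  "F2_term \<rho>1 \<rho>2 z q n =
     qpochs [z, inverse z, \<rho>1, \<rho>2] q n * (q / (\<rho>1 * \<rho>2)) ^ n / qpoch q q (2 * n)"

definition F2 :: "complex \<Rightarrow> complex \<Rightarrow> complex \<Rightarrow> complex \<Rightarrow> complex" where
  "F2 \<rho>1 \<rho>2 z q =
     qpoch_inf q q / qpochs_inf [z, inverse z, \<rho>1, \<rho>2] q *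
     (\<Sum>\<^sub>\<infinity>n\<in>{1..}. F2_term \<rho>1 \<rho>2 z q n)"

definition G2_term :: "complex \<Rightarrow> complex \<Rightarrow> complex \<Rightarrow> complex \<Rightarrow> nat \<Rightarrow> complex" where
  "G2_term \<rho>1 \<rho>2 z q n =
     qpochs [z, inverse z, \<rho>1, \<rho>2] q n * (q ^ 2 / (\<rho>1 * \<rho>2)) ^ n / qpoch q q (2 * n)"

definition G2 :: "complex \<Rightarrow> complex \<Rightarrow> complex \<Rightarrow> complex \<Rightarrow> complex" where
  "G2 \<rho>1 \<rho>2 z q =
     qpoch_inf q q / qpochs_inf [z, inverse z, \<rho>1, \<rho>2] q *
     (\<Sum>\<^sub>\<infinity>n\<in>{1..}. G2_term \<rho>1 \<rho>2 z q n)"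

definition F1 :: "complex \<Rightarrow> complex \<Rightarrow> complex \<Rightarrow> complex" where
  "F1 \<rho> z q =
     qpoch_inf q q / qpochs_inf [\<rho>, z, inverse z] q *
     (\<Sum>\<^sub>\<infinity>n\<in>{1::nat..}. qpochs [z, inverse z, \<rho>] q n * (-1) ^ n *
        q ^ (n * (n + 1) div 2) * inverse \<rho> ^ n / qpoch q q (2 * n))"

definition G1 :: "complex \<Rightarrow> complex \<Rightarrow> complex \<Rightarrow> complex" where
  "G1 \<rho> z q =
     qpoch_inf q q / qpochs_inf [\<rho>, z, inverse z] q *
     (\<Sum>\<^sub>\<infinity>n\<in>{1::nat..}. qpochs [z, inverse z, \<rho>] q n * (-1) ^ n *
        q ^ (n * (n + 3) div 2) * inverse \<rho> ^ n / qpoch q q (2 * n))"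

definition S_G1 :: "complex \<Rightarrow> complex \<Rightarrow> complex" where
  "S_G1 z q = G2 q (q ^ 2) z (q ^ 2)"

text \<open>
  Since \<open>G2\<close> is symmetric in its first two arguments, the choice of the square root of \<open>q\<close>
  does not matter here.
\<close>

definition S_G2 :: "complex \<Rightarrow> complex \<Rightarrow> complex" where
  "S_G2 z q = G2 (\<i> * csqrt q) (- \<i> * csqrt q) z q"

definition S_F1 :: "complex \<Rightarrow> complex \<Rightarrow> complex" where
  "S_F1 z q = F1 (- q) z q"

definition S_G3 :: "complex \<Rightarrow> complex \<Rightarrow> complex" where
  "S_G3 z q = G1 q z q"

definition S_L7 :: "complex \<Rightarrow> complex \<Rightarrow> complex" where
  "S_L7 z q =
     qpoch_inf (- q) q / qpochs_inf [z, inverse z] (q ^ 2) *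
     (\<Sum>\<^sub>\<infinity>n\<in>{1::nat..}. qpochs [z, inverse z] (q ^ 2) n * q ^ (2 * n) / qpoch (- q) q (2 * n))"

definition S_L9 :: "complex \<Rightarrow> complex \<Rightarrow> complex" where
  "S_L9 z q =
     qpoch_inf q (q ^ 2) / qpochs_inf [z, inverse z] q *
     (\<Sum>\<^sub>\<infinity>n\<in>{1::nat..}. qpochs [z, inverse z] q n * q ^ n / qpoch q (q ^ 2) n)"

definition S_L12 :: "complex \<Rightarrow> complex \<Rightarrow> complex" where
  "S_L12 z q =
     (qpoch_inf (- q) (q ^ 2)) ^ 2 / qpochs_inf [z, inverse z] (q ^ 2) *
     (\<Sum>\<^sub>\<infinity>n\<in>{1::nat..}. qpochs [z, inverse z] (q ^ 2) n * q ^ (2 * n) /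
        (qpoch (- q) (q ^ 2) n * qpoch (- q) (q ^ 2) (n + 1)))"

definition W :: "int \<Rightarrow> complex \<Rightarrow> complex" where
  "W j z = (1 - z powi j) * (1 - z powi (j - 1)) * z powi (1 - j)"

end

theory Submission
  imports Defs
begin

text \<open>
  Put \<open>w\<^sub>j = W\<^sub>j(z) / (1 + z)\<close>. For \<open>n \<ge> 1\<close>, induction on \<open>n\<close> gives the Bailey pair relative to \<open>q\<close>
  \[ \frac{(z,z^{-1};q)_n}{(q;q)_{2n}} = \sum_{r=0}^n
     \frac{w_{r+1} (-1)^r q^{r(r-1)/2} (1-q^{2r+1})}{(q;q)_{n-r} (q;q)_{n+r+1}}. \]
  (At \<open>n = 0\<close> the right-hand side vanishes, which is why all series start at \<open>n = 1\<close>.)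
  Multiplying by weights \<open>\<delta>\<^sub>n\<close> and summing over \<open>n\<close> reduces each identity to the evaluation of
  \<open>\<gamma>\<^sub>r = \<Sum>\<^sub>n \<delta>\<^sub>n / ((q;q)\<^sub>n\<^sub>-\<^sub>r (q;q)\<^sub>n\<^sub>+\<^sub>r\<^sub>+\<^sub>1)\<close>. For \<open>F\<close> and \<open>G\<close> this is the q-Gauss sum. For the
  three double series, a suitable combination of \<open>\<gamma>\<^sub>r\<close> and \<open>\<gamma>\<^sub>r\<^sub>+\<^sub>1\<close> telescopes, and the resulting
  recurrence is the one satisfied by a partial theta function. The product form of \<open>S\<^sub>F\<^sub>1\<close> is the
  Jacobi triple product, obtained as the limit of its finite form.
\<close>

section \<open>q-Pochhammer symbols\<close>

text \<open>With \<open>u_j = (z^j + z^(1-j)) / (1 + z)\<close> one has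
  \<open>w_j = u_j - 1\<close>. Both \<open>u\<close> and the product depend on \<open>z\<close>
  only through \<open>s = z + 1/z\<close>: the sequence obeys
  \<open>u_(j+2) = s u_(j+1) - u_j\<close>, and
  \<open>(1 - z q^k)(1 - q^k/z) = 1 + q^(2k) - s q^k\<close>. So the induction on \<open>n\<close>
  works for an arbitrary scalar \<open>s\<close>, and the subtracted constant 1 is the solution for
  \<open>s = 2\<close>, whose product is 0 as soon as \<open>n \<ge> 1\<close>. The weights of G fit
  the Bailey kernel relative to \<open>q\<close>, those of F fit the kernel relative to 1. The
  former kernel is a difference of two neighbours of the latter, which is the origin of the long
  bracket in F. The recurrences for the three double series lead from \<open>r\<close> to
  \<open>r + 1\<close> and give no starting value. Boundedness in \<open>r\<close> selects the
  solution, since the coefficient of the next term has norm at most \<open>|q| < 1\<close>. For the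
  exchange of sums all decay in \<open>r\<close> sits in \<open>bailey_alpha\<close> and all decay
  in \<open>n\<close> in the weights, so the kernel only has to be bounded. Convergence for F and G
  with two parameters is assumed as summability, from which the bound on the ratio must be
  recovered. Many steps divide by \<open>q\<close>, so \<open>q = 0\<close> is treated
  apart.\<close>

lemma qpoch_0 [simp]: "qpoch a q 0 = 1"
  by (simp add: qpoch_def)

lemma qpoch_Suc: "qpoch a q (Suc n) = qpoch a q n * (1 - a * q ^ n)"
  by (simp add: qpoch_def)

lemma qpoch_add: "qpoch a q (m + n) = qpoch a q m * qpoch (a * q ^ m) q n"
  by (induction n) (simp_all add: qpoch_Suc power_add mult_ac)

lemma qpoch_Suc_left: "qpoch a q (Suc n) = (1 - a) * qpoch (a * q) q n"
  using qpoch_add[of a q 1 n] by (simp add: qpoch_Suc)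

lemma convergent_prod_qpoch:
  fixes a q :: complex
  assumes "norm q < 1"
  shows "convergent_prod (\<lambda>j. 1 - a * q ^ j)"
proof -
  have "summable (\<lambda>j. norm (- (a * q ^ j)))"
    using assms by (simp add: norm_mult norm_power summable_mult summable_geometric)
  then have "abs_convergent_prod (\<lambda>j. 1 + - (a * q ^ j))"
    by (intro summable_imp_abs_convergent_prod) simp
  then show ?thesis
    using abs_convergent_prod_imp_convergent_prod by fastforce
qed

lemma qpoch_tendsto:
  assumes "norm q < 1"
  shows "(\<lambda>n. qpoch a q n) \<longlonglongrightarrow> qpoch_inf a q"
proof -
  have "(\<lambda>n. qpoch a q (Suc n)) \<longlonglongrightarrow> qpoch_inf a q"
    using convergent_prod_LIMSEQ[OF convergent_prod_qpoch[OF assms, of a]]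
    by (simp add: qpoch_def qpoch_inf_def lessThan_Suc_atMost)
  then show ?thesis
    by (rule LIMSEQ_imp_Suc)
qed

lemma qpoch_inf_split:
  assumes "norm q < 1"
  shows "qpoch_inf a q = qpoch a q n * qpoch_inf (a * q ^ n) q"
proof -
  have "(\<lambda>m. qpoch a q n * qpoch (a * q ^ n) q m) \<longlonglongrightarrow> qpoch a q n * qpoch_inf (a * q ^ n) q"
    by (intro tendsto_intros qpoch_tendsto assms)
  moreover have "(\<lambda>m. qpoch a q (m + n)) \<longlonglongrightarrow> qpoch_inf a q"
    using qpoch_tendsto[OF assms] by (rule LIMSEQ_ignore_initial_segment)
  ultimately show ?thesis
    by (metis (no_types, lifting) LIMSEQ_unique ext add.commute qpoch_add)
qed

lemma qpoch_inf_rec: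
  assumes "norm q < 1"
  shows "qpoch_inf a q = (1 - a) * qpoch_inf (a * q) q"
  using qpoch_inf_split[OF assms, of a 1] by (simp add: qpoch_Suc)

lemma qpoch_nonzero_if_inf:
  assumes "norm q < 1" "qpoch_inf a q \<noteq> 0"
  shows "qpoch a q n \<noteq> 0"
  using qpoch_inf_split[OF assms(1), of a n] assms(2) by auto

text \<open>The product converges in the strict sense, so only a zero factor can make it vanish;
  conversely a zero factor kills a finite product, which divides the infinite one.\<close>

lemma qpoch_inf_nonzero_iff:
  assumes "norm q < 1"
  shows "qpoch_inf a q \<noteq> 0 \<longleftrightarrow> (\<forall>j. a * q ^ j \<noteq> 1)"
proof
  assume "qpoch_inf a q \<noteq> 0"
  then show "\<forall>j. a * q ^ j \<noteq> 1"
    using qpoch_nonzero_if_inf[OF assms] by (metis diff_self mult_zero_right qpoch_Suc)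
next
  assume "\<forall>j. a * q ^ j \<noteq> 1"
  then have "\<And>j. 1 - a * q ^ j \<noteq> 0" by (metis right_minus_eq)
  then show "qpoch_inf a q \<noteq> 0"
    unfolding qpoch_inf_def by (intro prodinf_nonzero convergent_prod_qpoch assms)
qed

lemma qpoch_inf_nonzero:
  assumes "norm q < 1" "norm a < 1"
  shows "qpoch_inf a q \<noteq> 0"
proof -
  have "norm (a * q ^ j) < 1" for j
  proof -
    have "norm q ^ j \<le> 1" using assms by (simp add: power_le_one)
    then have "norm a * norm q ^ j \<le> norm a" by (simp add: mult_left_le)
    then show ?thesis using assms by (simp add: norm_mult norm_power)
  qed
  then show ?thesis
    using qpoch_inf_nonzero_iff[OF assms(1)] by (metis less_irrefl norm_one)
qed

lemma qpoch_nonzero: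
  assumes "norm q < 1" "norm a < 1"
  shows "qpoch a q n \<noteq> 0"
  using assms qpoch_inf_nonzero qpoch_nonzero_if_inf by blast

lemma qpoch_inf_0 [simp]: "qpoch_inf 0 q = 1"
  by (simp add: qpoch_inf_def)

lemma qpoch_even_odd: "qpoch a q (2 * n) = qpoch a (q ^ 2) n * qpoch (a * q) (q ^ 2) n"
  by (induction n) (simp_all add: qpoch_Suc mult_ac flip: power_mult)

lemma qpoch_pm: "qpoch a q n * qpoch (- a) q n = qpoch (a ^ 2) (q ^ 2) n"
  by (induction n) (simp_all add: qpoch_Suc algebra_simps power2_eq_square power_mult_distrib)

lemma norm_square_less_1: "norm (q::complex) < 1 \<Longrightarrow> norm (q ^ 2) < 1"
  by (simp add: norm_power power_less_one_iff)

lemma qpoch_inf_even_odd: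
  assumes "norm q < 1"
  shows "qpoch_inf a q = qpoch_inf a (q ^ 2) * qpoch_inf (a * q) (q ^ 2)"
proof (rule LIMSEQ_unique)
  show "(\<lambda>n. qpoch a q (2 * n)) \<longlonglongrightarrow> qpoch_inf a q"
    using LIMSEQ_subseq_LIMSEQ[OF qpoch_tendsto[OF assms], of "\<lambda>n. 2 * n" a]
    by (simp add: strict_mono_def o_def)
  show "(\<lambda>n. qpoch a q (2 * n)) \<longlonglongrightarrow> qpoch_inf a (q ^ 2) * qpoch_inf (a * q) (q ^ 2)"
    unfolding qpoch_even_odd
    by (intro tendsto_intros qpoch_tendsto norm_square_less_1 assms)
qed

lemma qpoch_inf_pm:
  assumes "norm q < 1"
  shows "qpoch_inf a q * qpoch_inf (- a) q = qpoch_inf (a ^ 2) (q ^ 2)"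
proof (rule LIMSEQ_unique)
  show "(\<lambda>n. qpoch a q n * qpoch (- a) q n) \<longlonglongrightarrow> qpoch_inf a q * qpoch_inf (- a) q"
    by (intro tendsto_intros qpoch_tendsto assms)
  show "(\<lambda>n. qpoch a q n * qpoch (- a) q n) \<longlonglongrightarrow> qpoch_inf (a ^ 2) (q ^ 2)"
    unfolding qpoch_pm by (intro qpoch_tendsto norm_square_less_1 assms)
qed

lemma qpoch_bounded:
  assumes "norm q < 1"
  obtains C where "C > 0" "\<And>n. norm (qpoch a q n) \<le> C"
  using convergent_imp_Bseq[OF convergentI[OF qpoch_tendsto[OF assms]]] unfolding Bseq_def by blast

lemma inverse_qpoch_bounded:
  assumes "norm q < 1" "qpoch_inf a q \<noteq> 0"
  obtains C where "C > 0" "\<And>n. norm (1 / qpoch a q n) \<le> C"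
proof -
  have "(\<lambda>n. 1 / qpoch a q n) \<longlonglongrightarrow> 1 / qpoch_inf a q"
    by (intro tendsto_intros qpoch_tendsto assms)
  then have "Bseq (\<lambda>n. 1 / qpoch a q n)"
    by (intro convergent_imp_Bseq convergentI)
  then show ?thesis
    using that unfolding Bseq_def by blast
qed

text \<open>
  The value \<open>0\<close> at negative arguments makes the recurrence \<open>inv_qfact_rec\<close> valid for all integers, so the
  inductions below need no boundary cases.
\<close>

definition inv_qfact :: "complex \<Rightarrow> int \<Rightarrow> complex" where
  "inv_qfact q m = (if m < 0 then 0 else 1 / qpoch q q (nat m))"

lemma inv_qfact_nat [simp]: "inv_qfact q (int n) = 1 / qpoch q q n"
  by (simp add: inv_qfact_def)

lemma inv_qfact_neg [simp]: "m < 0 \<Longrightarrow> inv_qfact q m = 0"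
  by (simp add: inv_qfact_def)

text \<open>At \<open>m = 0\<close> the factor \<open>1 - q powi 0\<close> is 0, in agreement with
  the value 0 at -1; below that both sides are 0.\<close>

lemma inv_qfact_rec:
  assumes "norm q < 1"
  shows "inv_qfact q (m - 1) = (1 - q powi m) * inv_qfact q m"
proof (cases m rule: int_cases)
  case (nonneg n)
  show ?thesis
  proof (cases n)
    case (Suc k)
    have "qpoch q q (Suc k) \<noteq> 0" using assms by (intro qpoch_nonzero)
    then show ?thesis
      using nonneg Suc by (simp add: inv_qfact_def nat_add_distrib qpoch_Suc power_int_def)
  qed (use nonneg in auto)
qed auto

text \<open>The recurrence with the index relation as a premise, so that arguments such as
  \<open>int n - int s - 2\<close> can be instantiated in the shape in which they occur.\<close>

lemma inv_qfact_eq: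
  assumes "norm q < 1" "m = k + 1"
  shows "inv_qfact q k = (1 - q powi m) * inv_qfact q m"
  using inv_qfact_rec[OF assms(1), of m] assms(2) by simp

lemma inv_qfact_bounded:
  assumes "norm q < 1"
  obtains C where "C > 0" "\<And>m. norm (inv_qfact q m) \<le> C"
proof -
  obtain C where "C > 0" "\<And>n. norm (1 / qpoch q q n) \<le> C"
    using inverse_qpoch_bounded qpoch_inf_nonzero assms by metis
  then show ?thesis
    using that[of C] by (auto simp: inv_qfact_def intro: less_imp_le)
qed

lemma inv_qfact_tendsto:
  assumes "norm q < 1"
  shows "(\<lambda>n. inv_qfact q (int n + k)) \<longlonglongrightarrow> 1 / qpoch_inf q q"
proof -
  have "filterlim (\<lambda>n. nat (int n + k)) at_top sequentially"
    unfolding filterlim_at_top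
  proof
    fix Z
    show "\<forall>\<^sub>F n in sequentially. Z \<le> nat (int n + k)"
      using eventually_ge_at_top[of "Z + nat \<bar>k\<bar>"] by eventually_elim linarith
  qed
  then have "(\<lambda>n. 1 / qpoch q q (nat (int n + k))) \<longlonglongrightarrow> 1 / qpoch_inf q q"
    by (intro tendsto_intros filterlim_compose[OF qpoch_tendsto[OF assms]] qpoch_inf_nonzero assms)
  moreover have "\<forall>\<^sub>F n in sequentially. 1 / qpoch q q (nat (int n + k)) = inv_qfact q (int n + k)"
    using eventually_ge_at_top[of "nat \<bar>k\<bar>"] by eventually_elim (auto simp: inv_qfact_def)
  ultimately show ?thesis
    by (rule Lim_transform_eventually)
qed

section \<open>The Bailey pair\<close>

lemma half_mult_Suc: "Suc n * n div 2 = n * (n - 1) div 2 + n"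
proof -
  have A: "Suc n * n = n * (n - 1) + n * 2" by (cases n) (simp_all add: algebra_simps)
  show ?thesis unfolding A by (subst div_mult_self1) simp_all
qed

text \<open>The quotient of consecutive terms is \<open>\<bar>c\<bar> * norm q ^ n\<close> in
  absolute value and tends to 0: the quadratic exponent beats any geometric growth
  \<open>c ^ n\<close>.\<close>

lemma summable_power_triangle:
  fixes c :: real and q :: complex
  assumes "norm q < 1"
  shows "summable (\<lambda>n. c ^ n * norm q ^ (n * (n - 1) div 2))"
proof -
  have "(\<lambda>n. \<bar>c\<bar> * norm q ^ n) \<longlonglongrightarrow> \<bar>c\<bar> * 0"
    using assms by (intro tendsto_intros) auto
  then have "\<forall>\<^sub>F n in sequentially. \<bar>c\<bar> * norm q ^ n < 1 / 2"
    by (rule order_tendstoD) simp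
  then obtain N where N: "\<And>n. n \<ge> N \<Longrightarrow> \<bar>c\<bar> * norm q ^ n < 1 / 2"
    unfolding eventually_sequentially by blast
  show ?thesis
  proof (rule summable_ratio_test[of "1/2" N])
    fix n assume "n \<ge> N"
    have "norm (c ^ Suc n * norm q ^ (Suc n * (Suc n - 1) div 2)) =
          (\<bar>c\<bar> * norm q ^ n) * norm (c ^ n * norm q ^ (n * (n - 1) div 2))"
      unfolding diff_Suc_1 half_mult_Suc by (simp add: power_add abs_mult power_abs)
    also have "\<dots> \<le> 1 / 2 * norm (c ^ n * norm q ^ (n * (n - 1) div 2))"
      using N[OF \<open>n \<ge> N\<close>] by (intro mult_right_mono) auto
    finally show "norm (c ^ Suc n * norm q ^ (Suc n * (Suc n - 1) div 2))
        \<le> 1 / 2 * norm (c ^ n * norm q ^ (n * (n - 1) div 2))" .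
  qed simp
qed

text \<open>Sign and quadratic power of \<open>q\<close> are left out, so that the kernel is bounded
  uniformly in \<open>r\<close> and \<open>n\<close>; this is what the exchange of sums
  requires.\<close>

definition bailey_kernel :: "complex \<Rightarrow> nat \<Rightarrow> nat \<Rightarrow> complex" where
  "bailey_kernel q r n =
     (1 - q ^ (2 * r + 1)) * inv_qfact q (int n - int r) * inv_qfact q (int n + int r + 1)"

lemma bailey_kernel_eq_0: "n < r \<Longrightarrow> bailey_kernel q r n = 0"
  by (simp add: bailey_kernel_def)

lemma bailey_kernel_bounded:
  assumes "norm q < 1"
  obtains C where "C > 0" "\<And>r n. norm (bailey_kernel q r n) \<le> C"
proof -
  obtain C where C: "C > 0" "\<And>m. norm (inv_qfact q m) \<le> C"
    using inv_qfact_bounded assms by metis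
  show ?thesis
  proof (rule that[of "2 * C * C"])
    fix r n
    have "norm q ^ (2 * r + 1) \<le> 1" using assms by (intro power_le_one) auto
    then have "norm (1 - q ^ (2 * r + 1)) \<le> 2"
      using norm_triangle_ineq4[of 1 "q ^ (2 * r + 1)"] by (simp only: norm_power norm_one)
    then show "norm (bailey_kernel q r n) \<le> 2 * C * C"
      unfolding bailey_kernel_def norm_mult using C by (intro mult_mono) auto
  qed (use C in auto)
qed

definition bailey_coeff :: "complex \<Rightarrow> nat \<Rightarrow> nat \<Rightarrow> complex" where
  "bailey_coeff q n r = (-1) ^ r * q ^ (r * (r - 1) div 2) * bailey_kernel q r n"

lemma bailey_coeff_eq_0: "n < r \<Longrightarrow> bailey_coeff q n r = 0"
  by (simp add: bailey_coeff_def bailey_kernel_eq_0)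

text \<open>Boundary case of the three-term recurrence below. The closed form of the coefficient is
  invariant under \<open>r -> -1 - r\<close>, so the neighbour at -1 becomes the one at 0. This fits
  \<open>u 0 = u 1\<close> in the induction.\<close>

lemma bailey_coeff_rec_0:
  assumes "norm q < 1" "q \<noteq> 0"
  shows "(1 - q ^ (2 * n + 1)) * (1 - q ^ (2 * n + 2)) * bailey_coeff q (Suc n) 0 =
    (1 + q ^ (2 * n)) * bailey_coeff q n 0 - q ^ n * (bailey_coeff q n 0 + bailey_coeff q n 1)"
proof -
  define X Y N where "X = inv_qfact q (int n + 1)" and "Y = inv_qfact q (int n + 2)" and "N = q ^ n"
  have e: "inv_qfact q (int n + 1) = (1 - N * q ^ 2) * Y"
    "inv_qfact q (int n) = (1 - N * q) * X" "inv_qfact q (int n - 1) = (1 - N) * ((1 - N * q) * X)"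
    using inv_qfact_eq[OF assms(1), of "int n + 2" "int n + 1"]
      inv_qfact_eq[OF assms(1), of "int n + 1" "int n"] inv_qfact_eq[OF assms(1), of "int n" "int n - 1"] assms(2)
    by (simp_all add: X_def Y_def N_def power_int_add del: inv_qfact_nat)
  have N': "q ^ (2 * n + 1) = N ^ 2 * q" "q ^ (2 * n + 2) = N ^ 2 * q ^ 2" "q ^ (2 * n) = N ^ 2" "q ^ n = N"
    by (simp_all add: N_def power_add power_even_eq power2_eq_square)
  have i: "int (Suc n) - int 0 = int n + 1" "int (Suc n) + int 0 + 1 = int n + 2"
    "int n - int 0 = int n" "int n + int 0 + 1 = int n + 1"
    "int n - int 1 = int n - 1" "int n + int 1 + 1 = int n + 2" "2 * 0 + 1 = (1::nat)" "2 * 1 + 1 = (3::nat)"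
    by simp_all
  have c: "bailey_coeff q (Suc n) 0 = (1 - q) * X * Y"
    "bailey_coeff q n 0 = (1 - q) * ((1 - N * q) * X) * ((1 - N * q ^ 2) * Y)"
    "bailey_coeff q n 1 = - (1 - q ^ 3) * ((1 - N) * ((1 - N * q) * X)) * Y"
    unfolding bailey_coeff_def bailey_kernel_def i
      apply (simp add: X_def Y_def)
     apply (simp only: e) apply simp
    apply (simp only: e flip: Y_def) apply (simp add: algebra_simps)
    done
  show ?thesis unfolding c N' by algebra
qed

text \<open>All four coefficients are multiples of \<open>X * Y\<close>, where \<open>X\<close> and
  \<open>Y\<close> are the reciprocal factorials of largest index; what remains is an identity in
  \<open>q ^ n\<close>, \<open>q ^ s\<close> and \<open>q\<close>.\<close>

lemma bailey_coeff_rec_Suc: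
  assumes "norm q < 1" "q \<noteq> 0"
  shows "(1 - q ^ (2 * n + 1)) * (1 - q ^ (2 * n + 2)) * bailey_coeff q (Suc n) (Suc s) =
    (1 + q ^ (2 * n)) * bailey_coeff q n (Suc s)
    - q ^ n * (bailey_coeff q n s + bailey_coeff q n (Suc (Suc s)))"
proof -
  define X Y N S E where "X = inv_qfact q (int n - int s)" and "Y = inv_qfact q (int n + int s + 3)"
    and "N = q ^ n" and "S = q ^ s" and "E = (-1) ^ s * q ^ (s * (s - 1) div 2)"
  have S0: "S \<noteq> 0" using assms by (simp add: S_def)
  have e: "inv_qfact q (int n - int s - 1) = (1 - N / S) * X"
    "inv_qfact q (int n - int s - 2) = (1 - N / S / q) * ((1 - N / S) * X)"
    "inv_qfact q (int n + int s + 2) = (1 - N * S * q ^ 3) * Y"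
    "inv_qfact q (int n + int s + 1) = (1 - N * S * q ^ 2) * ((1 - N * S * q ^ 3) * Y)"
    using inv_qfact_eq[OF assms(1), of "int n - int s" "int n - int s - 1"]
      inv_qfact_eq[OF assms(1), of "int n - int s - 1" "int n - int s - 2"]
      inv_qfact_eq[OF assms(1), of "int n + int s + 3" "int n + int s + 2"]
      inv_qfact_eq[OF assms(1), of "int n + int s + 2" "int n + int s + 1"] assms(2)
    by (simp_all add: X_def Y_def N_def S_def power_int_add power_int_diff)
  have N': "q ^ (2 * n + 1) = N ^ 2 * q" "q ^ (2 * n + 2) = N ^ 2 * q ^ 2" "q ^ (2 * n) = N ^ 2" "q ^ n = N"
    "q ^ (2 * s + 1) = S ^ 2 * q" "q ^ (2 * s + 3) = S ^ 2 * q ^ 3" "q ^ (2 * s + 5) = S ^ 2 * q ^ 5"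
    by (simp_all add: N_def S_def power_add power_even_eq power2_eq_square)
  have t: "q ^ (Suc s * (Suc s - 1) div 2) = q ^ (s * (s - 1) div 2) * S"
    "q ^ (Suc (Suc s) * (Suc (Suc s) - 1) div 2) = q ^ (s * (s - 1) div 2) * S ^ 2 * q"
    unfolding diff_Suc_1 half_mult_Suc
    by (simp_all only: power_add diff_Suc_1 half_mult_Suc) (simp_all add: S_def power2_eq_square)
  have i: "int (Suc n) - int (Suc s) = int n - int s" "int (Suc n) + int (Suc s) + 1 = int n + int s + 3"
    "int n - int (Suc s) = int n - int s - 1" "int n + int (Suc s) + 1 = int n + int s + 2"
    "int n - int (Suc (Suc s)) = int n - int s - 2" "int n + int (Suc (Suc s)) + 1 = int n + int s + 3"
    "2 * Suc s + 1 = 2 * s + 3" "2 * Suc (Suc s) + 1 = 2 * s + 5"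
    by simp_all
  have c: "bailey_coeff q (Suc n) (Suc s) = - E * S * (1 - S ^ 2 * q ^ 3) * X * Y"
    "bailey_coeff q n (Suc s) =
       - E * S * (1 - S ^ 2 * q ^ 3) * ((1 - N / S) * X) * ((1 - N * S * q ^ 3) * Y)"
    "bailey_coeff q n s =
       E * (1 - S ^ 2 * q) * X * ((1 - N * S * q ^ 2) * ((1 - N * S * q ^ 3) * Y))"
    "bailey_coeff q n (Suc (Suc s)) =
       E * S ^ 2 * q * (1 - S ^ 2 * q ^ 5) * ((1 - N / S / q) * ((1 - N / S) * X)) * Y"
    unfolding bailey_coeff_def bailey_kernel_def t i N' e X_def[symmetric] Y_def[symmetric]
    by (simp_all add: E_def)
  \<comment> \<open>With \<open>M = q^(n-s)\<close> in place of the quotient, and the free factor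
    \<open>q\<close> absorbed into \<open>1 - M / q\<close>, no division is left and the identity is
    polynomial.\<close>
  define M where "M = N / S"
  have NM: "N = M * S" "N / S / q = M / q" using S0 by (simp_all add: M_def)
  have M: "q * (1 - M / q) = q - M" using assms by (simp add: field_simps)
  have "E * S ^ 2 * q * (1 - S ^ 2 * q ^ 5) * ((1 - M / q) * ((1 - M) * X)) * Y =
        E * S ^ 2 * (1 - S ^ 2 * q ^ 5) * (q * (1 - M / q) * ((1 - M) * X)) * Y"
    by (simp only: mult_ac)
  also have "\<dots> = E * S ^ 2 * (1 - S ^ 2 * q ^ 5) * ((q - M) * ((1 - M) * X)) * Y"
    by (simp only: M)
  finally have c4: "E * S ^ 2 * q * (1 - S ^ 2 * q ^ 5) * ((1 - M / q) * ((1 - M) * X)) * Y = \<dots>" .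
  show ?thesis unfolding c N' NM(2) M_def[symmetric] c4 unfolding NM(1) by algebra
qed

text \<open>The coefficient recurrence in \<open>n\<close> is adjoint to the recurrence of
  \<open>u\<close> in \<open>j\<close>: shifting indices turns the neighbours \<open>r - 1\<close>
  and \<open>r + 1\<close> of the coefficients into multiplication by \<open>s\<close>. Hence
  passing to \<open>n + 1\<close> multiplies the sum by the next factor of the product. Stating it
  for general \<open>u\<close> allows the two uses with \<open>s = z + 1/z\<close> and
  \<open>s = 2\<close>.\<close>

lemma bailey_pair_aux:
  fixes s :: complex and u :: "nat \<Rightarrow> complex"
  assumes q: "norm q < 1" "q \<noteq> 0"
    and u: "u 0 = 1" "u 1 = 1" "\<And>j. u (Suc (Suc j)) = s * u (Suc j) - u j"
  shows "(\<Prod>k<n. 1 + q ^ (2 * k) - s * q ^ k) / qpoch q q (2 * n) =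
         (\<Sum>r\<le>n. bailey_coeff q n r * u (Suc r))"
proof (induction n)
  case 0
  have "1 - q \<noteq> 0" using q by auto
  then show ?case
    using u inv_qfact_nat[of q 1] inv_qfact_nat[of q 0]
    by (simp add: bailey_coeff_def bailey_kernel_def qpoch_Suc)
next
  case (Suc n)
  let ?b = "bailey_coeff q"
  define D where "D = (1 - q ^ (2 * n + 1)) * (1 - q ^ (2 * n + 2))"
  have pD: "qpoch q q (2 * Suc n) = qpoch q q (2 * n) * D"
    by (simp add: qpoch_Suc D_def)
  have D0: "D \<noteq> 0"
    using qpoch_nonzero[OF q(1) q(1), of "2 * Suc n"] pD by auto
  \<comment> \<open>Uses the recurrence as \<open>s * u (Suc r) = u r + u (Suc (Suc r))\<close>; the
    term \<open>u 0\<close> equals \<open>u 1\<close> and becomes the boundary contribution.\<close>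
  have 1: "s * (\<Sum>r\<le>n. ?b n r * u (Suc r)) =
      ?b n 0 * u 0 + (\<Sum>r<n. ?b n (Suc r) * u (Suc r)) + (\<Sum>r\<le>n. ?b n r * u (Suc (Suc r)))"
  proof -
    have "s * (\<Sum>r\<le>n. ?b n r * u (Suc r)) = (\<Sum>r\<le>n. ?b n r * u r) + (\<Sum>r\<le>n. ?b n r * u (Suc (Suc r)))"
      by (simp add: u(3) sum_distrib_left algebra_simps sum.distrib sum_subtractf)
    also have "(\<Sum>r\<le>n. ?b n r * u r) = ?b n 0 * u 0 + (\<Sum>r<n. ?b n (Suc r) * u (Suc r))"
      by (subst sum.atMost_shift) simp
    finally show ?thesis .
  qed
  have "D * (\<Sum>r\<le>Suc n. ?b (Suc n) r * u (Suc r)) =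
      D * ?b (Suc n) 0 * u 1 + (\<Sum>r\<le>n. D * ?b (Suc n) (Suc r) * u (Suc (Suc r)))"
    by (subst sum.atMost_Suc_shift) (simp add: algebra_simps sum_distrib_left)
  also have "\<dots> = (1 + q ^ (2 * n)) * (?b n 0 * u 1 + (\<Sum>r\<le>n. ?b n (Suc r) * u (Suc (Suc r))))
      - q ^ n * (?b n 0 * u 1 + ?b n 1 * u 1 + (\<Sum>r\<le>n. ?b n r * u (Suc (Suc r)))
         + (\<Sum>r\<le>n. ?b n (Suc (Suc r)) * u (Suc (Suc r))))"
    unfolding D_def bailey_coeff_rec_0[OF q] bailey_coeff_rec_Suc[OF q]
    by (simp add: algebra_simps sum_distrib_left sum.distrib sum_subtractf)
  finally have 2: "D * (\<Sum>r\<le>Suc n. ?b (Suc n) r * u (Suc r)) = \<dots>" .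
  \<comment> \<open>The shifted sum may be cut off because coefficients with \<open>r > n\<close>
    are 0; the same holds for the next equation.\<close>
  have 3: "?b n 1 * u 1 + (\<Sum>r\<le>n. ?b n (Suc (Suc r)) * u (Suc (Suc r))) =
      (\<Sum>r<n. ?b n (Suc r) * u (Suc r))"
  proof -
    have "?b n 1 * u 1 + (\<Sum>r\<le>n. ?b n (Suc (Suc r)) * u (Suc (Suc r))) =
        (\<Sum>r\<le>Suc n. ?b n (Suc r) * u (Suc r))"
      by (subst sum.atMost_Suc_shift) simp
    also have "\<dots> = (\<Sum>r<n. ?b n (Suc r) * u (Suc r))"
      by (intro sum.mono_neutral_right) (auto simp: bailey_coeff_eq_0)
    finally show ?thesis .
  qed
  have 4: "?b n 0 * u 1 + (\<Sum>r\<le>n. ?b n (Suc r) * u (Suc (Suc r))) = (\<Sum>r\<le>n. ?b n r * u (Suc r))"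
  proof -
    have "?b n 0 * u 1 + (\<Sum>r\<le>n. ?b n (Suc r) * u (Suc (Suc r))) = (\<Sum>r\<le>Suc n. ?b n r * u (Suc r))"
      by (subst sum.atMost_Suc_shift) simp
    also have "\<dots> = (\<Sum>r\<le>n. ?b n r * u (Suc r))"
      by (intro sum.mono_neutral_right) (auto simp: bailey_coeff_eq_0)
    finally show ?thesis .
  qed
  have 5: "?b n 0 * u 1 + ?b n 1 * u 1 + (\<Sum>r\<le>n. ?b n r * u (Suc (Suc r)))
         + (\<Sum>r\<le>n. ?b n (Suc (Suc r)) * u (Suc (Suc r))) = s * (\<Sum>r\<le>n. ?b n r * u (Suc r))"
    unfolding 1 3[symmetric] u(1,2) by (simp add: algebra_simps)
  have "D * (\<Sum>r\<le>Suc n. ?b (Suc n) r * u (Suc r)) =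
      (1 + q ^ (2 * n) - s * q ^ n) * (\<Sum>r\<le>n. ?b n r * u (Suc r))"
    unfolding 2 4 5 by (simp add: algebra_simps)
  then show ?case
    unfolding Suc.IH[symmetric] pD prod.lessThan_Suc
    using D0 qpoch_nonzero[OF q(1) q(1), of "2 * n"] by (simp add: divide_simps mult_ac)
qed

lemma W_Suc: "z \<noteq> 0 \<Longrightarrow> W (int (Suc r)) z = z ^ Suc r + inverse z ^ r - (1 + z)"
  unfolding W_def by (simp add: power_int_minus power_int_add field_simps)

lemma bailey_pair:
  assumes q: "norm q < 1" "q \<noteq> 0" and z: "z \<noteq> 0" "1 + z \<noteq> 0" and n: "n \<ge> 1"
  shows "qpoch z q n * qpoch (inverse z) q n / qpoch q q (2 * n) =
         (\<Sum>r\<le>n. W (int (Suc r)) z / (1 + z) * bailey_coeff q n r)"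
proof -
  define u where "u = (\<lambda>j. (z ^ j + z * inverse z ^ j) / (1 + z))"
  have "qpoch z q n * qpoch (inverse z) q n = (\<Prod>k<n. 1 + q ^ (2 * k) - (z + inverse z) * q ^ k)"
    unfolding qpoch_def prod.distrib[symmetric]
    using z by (intro prod.cong) (auto simp: algebra_simps power_mult power2_eq_square power_mult_distrib)
  also have "\<dots> / qpoch q q (2 * n) = (\<Sum>r\<le>n. bailey_coeff q n r * u (Suc r))"
  proof (rule bailey_pair_aux[OF q])
    fix j
    have "z ^ Suc (Suc j) + z * inverse z ^ Suc (Suc j) =
        (z + inverse z) * (z ^ Suc j + z * inverse z ^ Suc j) - (z ^ j + z * inverse z ^ j)"
      using z by (simp add: ring_distribs) (simp add: mult.assoc[symmetric])
    then show "u (Suc (Suc j)) = (z + inverse z) * u (Suc j) - u j"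
      unfolding u_def by (simp only: times_divide_eq_right diff_divide_distrib)
  qed (use z in \<open>auto simp: u_def add.commute\<close>)
  \<comment> \<open>The subtracted sum is 0: it is the case \<open>s = 2\<close>,
    \<open>u = 1\<close>, where the factor \<open>k = 0\<close> of the product is
    \<open>1 + 1 - 2\<close>. This is where \<open>n \<ge> 1\<close> enters.\<close>
  also have "\<dots> = (\<Sum>r\<le>n. bailey_coeff q n r * u (Suc r)) - (\<Sum>r\<le>n. bailey_coeff q n r * 1)"
  proof -
    have "(\<Prod>k<n. 1 + q ^ (2 * k) - 2 * q ^ k) = 0"
      using n by (intro prod_zero bexI[of _ 0]) auto
    then show ?thesis
      using bailey_pair_aux[OF q, of "\<lambda>_. 1" 2 n] by (simp del: prod_zero_iff)
  qed
  also have "\<dots> = (\<Sum>r\<le>n. W (int (Suc r)) z / (1 + z) * bailey_coeff q n r)"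
    unfolding sum_subtractf[symmetric] W_Suc[OF z(1)]
    using z by (intro sum.cong refl) (simp add: u_def diff_divide_distrib algebra_simps)
  finally show ?thesis .
qed

section \<open>Absolute convergence and the exchange of the two summations\<close>

definition bailey_alpha :: "complex \<Rightarrow> complex \<Rightarrow> nat \<Rightarrow> complex" where
  "bailey_alpha z q r = W (int (Suc r)) z / (1 + z) * (-1) ^ r * q ^ (r * (r - 1) div 2)"

lemma bailey_alpha_0 [simp]: "bailey_alpha z q 0 = 0"
  by (simp add: bailey_alpha_def W_def)

lemma summable_norm_bailey_alpha:
  assumes "norm q < 1" "z \<noteq> 0"
  shows "summable (\<lambda>r. norm (bailey_alpha z q r))"
proof (rule summable_comparison_test')
  \<comment> \<open>One majorant for each of the three summands \<open>z^(r+1)\<close>,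
    \<open>z^(-r)\<close> and \<open>1 + z\<close> of \<open>W\<close>.\<close>
  let ?T = "\<lambda>c r. c ^ r * norm q ^ (r * (r - 1) div 2)" and ?K = "norm (1 + z)"
  show "summable (\<lambda>r. norm z / ?K * ?T (norm z) r + 1 / ?K * ?T (norm (inverse z)) r + ?K / ?K * ?T 1 r)"
    by (intro summable_add summable_mult summable_power_triangle assms)
  fix r :: nat
  have "norm (W (int (Suc r)) z) \<le> norm z ^ Suc r + norm (inverse z) ^ r + ?K"
    unfolding W_Suc[OF assms(2)] using norm_triangle_ineq4 norm_triangle_ineq
    by (metis (no_types, opaque_lifting) add_right_mono dual_order.trans norm_power)
  then have "norm (W (int (Suc r)) z) * (1 / ?K * norm q ^ (r * (r - 1) div 2)) \<le>
      (norm z ^ Suc r + norm (inverse z) ^ r + ?K) * (1 / ?K * norm q ^ (r * (r - 1) div 2))"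
    by (intro mult_right_mono) auto
  then show "norm (norm (bailey_alpha z q r)) \<le>
      norm z / ?K * ?T (norm z) r + 1 / ?K * ?T (norm (inverse z)) r + ?K / ?K * ?T 1 r"
    by (simp add: bailey_alpha_def norm_mult norm_divide norm_power ring_distribs add_divide_distrib mult_ac split: if_splits)
qed

lemma infsum_from_1: "infsum f {1::nat..} = infsum (\<lambda>r. f (Suc r)) UNIV"
  by (rule infsum_reindex_bij_witness[of _ Suc "\<lambda>n. n - 1"]) auto

text \<open>A product of two absolutely summable families stays absolutely summable on the pairs
  after multiplication by a bounded kernel, so Fubini applies.\<close>

lemma infsum_swap_bounded_kernel:
  fixes a d :: "nat \<Rightarrow> complex"
  assumes a: "summable (\<lambda>r. norm (a r))" and d: "summable (\<lambda>n. norm (d n))"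
    and k: "\<And>r n. norm (k r n) \<le> C"
  shows "(\<Sum>\<^sub>\<infinity>n. \<Sum>\<^sub>\<infinity>r. a r * (d n * k r n)) = (\<Sum>\<^sub>\<infinity>r. a r * (\<Sum>\<^sub>\<infinity>n. d n * k r n))"
proof -
  have "(\<lambda>(n, r). norm (d n) * norm (a r)) summable_on UNIV \<times> UNIV"
    using a d by (intro summable_on_SigmaI[where g = "\<lambda>n. norm (d n) * (\<Sum>\<^sub>\<infinity>r. norm (a r))"])
      (auto simp: summable_on_UNIV_nonneg_real_iff intro!: has_sum_cmult_right summable_on_cmult_left)
  then have "(\<lambda>p. C * (norm (d (fst p)) * norm (a (snd p)))) summable_on UNIV \<times> UNIV"
    by (intro summable_on_cmult_right) (simp add: case_prod_unfold)
  then have "(\<lambda>p. norm (a (snd p) * (d (fst p) * k (snd p) (fst p)))) summable_on UNIV \<times> UNIV"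
  proof (rule Infinite_Sum.abs_summable_on_comparison_test')
    fix p
    show "norm (a (snd p) * (d (fst p) * k (snd p) (fst p))) \<le> C * (norm (d (fst p)) * norm (a (snd p)))"
      using mult_left_mono[OF k[of "snd p" "fst p"], of "norm (d (fst p)) * norm (a (snd p))"]
      by (simp add: norm_mult mult_ac)
  qed
  then have "(\<lambda>(n, r). a r * (d n * k r n)) summable_on UNIV \<times> UNIV"
    unfolding case_prod_unfold by (rule Infinite_Sum.abs_summable_summable)
  then have "(\<Sum>\<^sub>\<infinity>n. \<Sum>\<^sub>\<infinity>r. a r * (d n * k r n)) = (\<Sum>\<^sub>\<infinity>r. \<Sum>\<^sub>\<infinity>n. a r * (d n * k r n))"
    by (rule infsum_swap_banach)
  then show ?thesis by (simp add: infsum_cmult_right')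
qed

lemma bailey_transform:
  assumes q: "norm q < 1" "q \<noteq> 0" and z: "z \<noteq> 0" "1 + z \<noteq> 0"
    and d: "summable (\<lambda>n. norm (d n))"
  shows "(\<Sum>\<^sub>\<infinity>n\<in>{1..}. qpoch z q n * qpoch (inverse z) q n / qpoch q q (2 * n) * d n) =
         (\<Sum>\<^sub>\<infinity>r. bailey_alpha z q r * (\<Sum>\<^sub>\<infinity>n. d n * bailey_kernel q r n))"
proof -
  obtain C where C: "\<And>r n. norm (bailey_kernel q r n) \<le> C"
    using bailey_kernel_bounded[OF q(1)] by metis
  have "(\<Sum>\<^sub>\<infinity>n\<in>{1..}. qpoch z q n * qpoch (inverse z) q n / qpoch q q (2 * n) * d n) =
        (\<Sum>\<^sub>\<infinity>n. \<Sum>\<^sub>\<infinity>r. bailey_alpha z q r * (d n * bailey_kernel q r n))"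
  proof (rule infsum_cong_neutral)
    fix n :: nat assume "n \<in> {1..} \<inter> UNIV"
    then have "qpoch z q n * qpoch (inverse z) q n / qpoch q q (2 * n) * d n =
        (\<Sum>r\<le>n. bailey_alpha z q r * (d n * bailey_kernel q r n))"
      by (subst bailey_pair[OF q z])
         (auto simp: sum_distrib_left bailey_alpha_def bailey_coeff_def mult_ac intro!: sum.cong)
    also have "\<dots> = (\<Sum>\<^sub>\<infinity>r\<in>{..n}. bailey_alpha z q r * (d n * bailey_kernel q r n))"
      by simp
    also have "\<dots> = (\<Sum>\<^sub>\<infinity>r. bailey_alpha z q r * (d n * bailey_kernel q r n))"
      by (rule infsum_cong_neutral) (auto simp: bailey_kernel_eq_0)
    finally show "qpoch z q n * qpoch (inverse z) q n / qpoch q q (2 * n) * d n =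
      (\<Sum>\<^sub>\<infinity>r. bailey_alpha z q r * (d n * bailey_kernel q r n))" .
  \<comment> \<open>The index \<open>n = 0\<close> lies outside the left-hand range but may be added
    on the right: the kernel leaves only \<open>r = 0\<close>, and there \<open>bailey_alpha\<close>
    is 0 because \<open>W 1 z = 0\<close>.\<close>
  next
    fix n :: nat assume "n \<in> UNIV - {1..}"
    then have "n = 0" by auto
    have "bailey_alpha z q r * (d 0 * bailey_kernel q r 0) = 0" for r
      by (cases r) (auto simp: bailey_kernel_eq_0)
    then show "(\<Sum>\<^sub>\<infinity>r. bailey_alpha z q r * (d n * bailey_kernel q r n)) = 0"
      unfolding \<open>n = 0\<close> by (intro infsum_0) blast
  qed auto
  also have "\<dots> = (\<Sum>\<^sub>\<infinity>r. bailey_alpha z q r * (\<Sum>\<^sub>\<infinity>n. d n * bailey_kernel q r n))"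
    by (rule infsum_swap_bounded_kernel[OF summable_norm_bailey_alpha[OF q(1) z(1)] d C])
  finally show ?thesis .
qed

section \<open>The q-Gauss sum\<close>

text \<open>
  \<open>qrev (1 / \<rho>) q n = (\<rho>;q)\<^sub>n \<rho>\<^sup>-\<^sup>n\<close>, and \<open>qrev 0 q n\<close> is the limit of this for \<open>\<rho> \<rightarrow> \<infinity>\<close>. With this
  parametrisation one q-Gauss sum covers the two-parameter and the one-parameter series.
\<close>

definition qrev :: "complex \<Rightarrow> complex \<Rightarrow> nat \<Rightarrow> complex" where
  "qrev a q n = (\<Prod>j<n. a - q ^ j)"

lemma qrev_0 [simp]: "qrev a q 0 = 1"
  by (simp add: qrev_def)

lemma qrev_Suc: "qrev a q (Suc n) = qrev a q n * (a - q ^ n)"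
  by (simp add: qrev_def)

lemma qrev_inverse:
  assumes "\<rho> \<noteq> 0"
  shows "qrev (1 / \<rho>) q n = qpoch \<rho> q n / \<rho> ^ n"
  using assms by (induction n) (simp_all add: qrev_Suc qpoch_Suc field_simps)

lemma qrev_zero: "qrev 0 q n = (-1) ^ n * q ^ (n * (n - 1) div 2)"
proof (induction n)
  case (Suc n)
  show ?case
    unfolding qrev_Suc Suc.IH diff_Suc_1 half_mult_Suc by (simp add: power_add)
qed simp

text \<open>Each of the last \<open>m\<close> factors is
  \<open>a - q^(r+j) = q^r (a / q^r - q^j)\<close>, so a shift by \<open>r\<close> rescales the
  parameter.\<close>

lemma qrev_add:
  assumes "q \<noteq> 0"
  shows "qrev a q (m + r) = qrev a q r * (q ^ r) ^ m * qrev (a / q ^ r) q m"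
  using assms by (induction m) (simp_all add: qrev_Suc power_add field_simps)

text \<open>The ratio of consecutive terms tends to \<open>norm (c * a * b)\<close>; a number
  \<open>x\<close> strictly between this limit and 1 feeds the ratio test.\<close>

lemma summable_qrev:
  assumes "norm q < 1" "norm (c * a * b) < 1"
  shows "summable (\<lambda>n. norm (qrev a q n * qrev b q n * c ^ n))"
proof -
  obtain x where x: "norm (c * a * b) < x" "x < 1" using assms(2) dense by blast
  have "(\<lambda>n. norm ((a - q ^ n) * (b - q ^ n) * c)) \<longlonglongrightarrow> norm ((a - 0) * (b - 0) * c)"
    using assms by (intro tendsto_intros LIMSEQ_power_zero)
  then have "\<forall>\<^sub>F n in sequentially. norm ((a - q ^ n) * (b - q ^ n) * c) < x"
    using x by (intro order_tendstoD) (auto simp: mult_ac)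
  then obtain N where N: "\<And>n. n \<ge> N \<Longrightarrow> norm ((a - q ^ n) * (b - q ^ n) * c) < x"
    unfolding eventually_sequentially by blast
  show ?thesis
  proof (rule summable_ratio_test[of x N])
    fix n assume "n \<ge> N"
    have "norm (norm (qrev a q (Suc n) * qrev b q (Suc n) * c ^ Suc n)) =
        norm ((a - q ^ n) * (b - q ^ n) * c) * norm (norm (qrev a q n * qrev b q n * c ^ n))"
      by (simp add: qrev_Suc norm_mult)
    also have "\<dots> \<le> x * norm (norm (qrev a q n * qrev b q n * c ^ n))"
      using N[OF \<open>n \<ge> N\<close>] by (intro mult_right_mono) auto
    finally show "norm (norm (qrev a q (Suc n) * qrev b q (Suc n) * c ^ Suc n))
        \<le> x * norm (norm (qrev a q n * qrev b q n * c ^ n))" .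
  qed (use x in auto)
qed

text \<open>Term of the basic hypergeometric series 2phi1 with numerator parameters
  \<open>1/a\<close>, \<open>1/b\<close>, denominator parameter \<open>c\<close> and argument
  \<open>c a b\<close>, the argument at which q-Gauss summation holds. It is polynomial in
  \<open>a\<close> and \<open>b\<close>, so 0 is an admissible value.\<close>

definition gauss_term :: "complex \<Rightarrow> complex \<Rightarrow> complex \<Rightarrow> complex \<Rightarrow> nat \<Rightarrow> complex" where
  "gauss_term a b q c n = qrev a q n * qrev b q n * c ^ n / (qpoch q q n * qpoch c q n)"

text \<open>The denominator is bounded uniformly in \<open>N\<close> through
  \<open>1 / (c q^N; q)_n = (c; q)_N / (c; q)_(N+n)\<close>. The surviving factor
  \<open>norm q ^ (N * n)\<close> makes every term with \<open>n \<ge> 1\<close> disappear as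
  \<open>N\<close> grows.\<close>

lemma gauss_term_bound:
  assumes "norm q < 1" "norm c < 1"
  obtains K where "K > 0"
    "\<And>N n. norm (gauss_term a b q (c * q ^ N) n) \<le>
       K * norm (qrev a q n * qrev b q n * c ^ n) * norm q ^ (N * n)"
proof -
  obtain A where A: "A > 0" "\<And>n. norm (1 / qpoch q q n) \<le> A"
    using inverse_qpoch_bounded qpoch_inf_nonzero assms by metis
  obtain B where B: "B > 0" "\<And>n. norm (1 / qpoch c q n) \<le> B"
    using inverse_qpoch_bounded qpoch_inf_nonzero assms by metis
  obtain D where D: "D > 0" "\<And>n. norm (qpoch c q n) \<le> D"
    using qpoch_bounded assms by metis
  show ?thesis
  proof (rule that[of "A * (D * B)"])
    fix N n
    have "1 / qpoch (c * q ^ N) q n = qpoch c q N * (1 / qpoch c q (N + n))"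
      using qpoch_nonzero[OF assms, of N] by (simp add: qpoch_add)
    then have 1: "norm (1 / qpoch (c * q ^ N) q n) \<le> D * B"
      using B D by (simp only: norm_mult) (intro mult_mono, auto)
    have "norm (gauss_term a b q (c * q ^ N) n) =
        norm (1 / qpoch q q n) * norm (1 / qpoch (c * q ^ N) q n) *
        (norm (qrev a q n * qrev b q n * c ^ n) * norm q ^ (N * n))"
      by (simp add: gauss_term_def norm_mult norm_divide norm_power power_mult_distrib power_mult)
    also have "\<dots> \<le> A * (D * B) * (norm (qrev a q n * qrev b q n * c ^ n) * norm q ^ (N * n))"
      using A(2)[of n] 1 A(1) by (intro mult_right_mono mult_mono) auto
    finally show "norm (gauss_term a b q (c * q ^ N) n) \<le>
       A * (D * B) * norm (qrev a q n * qrev b q n * c ^ n) * norm q ^ (N * n)"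
      by (simp add: mult.assoc)
  qed (use A B D in auto)
qed

lemma summable_gauss_term:
  assumes "norm q < 1" "norm c < 1" "norm (c * a * b) < 1"
  shows "summable (\<lambda>n. norm (gauss_term a b q c n))"
proof -
  obtain K where K: "\<And>N n. norm (gauss_term a b q (c * q ^ N) n) \<le>
       K * norm (qrev a q n * qrev b q n * c ^ n) * norm q ^ (N * n)"
    using gauss_term_bound assms by metis
  show ?thesis
    by (rule summable_comparison_test'[OF summable_mult[OF summable_qrev[OF assms(1,3)], of K]])
       (use K[of 0] in simp)
qed

lemma norm_mult_power_less_1:
  fixes x q :: complex
  assumes "norm q < 1" "norm x < 1"
  shows "norm (x * q ^ N) < 1"
proof -
  have "norm q ^ N \<le> 1" using assms by (intro power_le_one) auto
  then have "norm x * norm q ^ N \<le> norm x" by (simp add: mult_left_le)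
  then show ?thesis using assms by (simp add: norm_mult norm_power)
qed

text \<open>Contiguous relation \<open>c -> c q\<close>, proved by telescoping: the termwise
  difference of the two sides is \<open>G (Suc n) - G n\<close>, with \<open>G 0 = 0\<close> and
  \<open>G\<close> tending to 0.\<close>

lemma gauss_contiguous:
  assumes q: "norm q < 1" and c: "norm c < 1" "norm (c * a * b) < 1"
  shows "(1 - c) * (1 - c * a * b) * (\<Sum>n. gauss_term a b q c n) =
         (1 - c * a) * (1 - c * b) * (\<Sum>n. gauss_term a b q (c * q) n)"
proof -
  have cq: "norm (c * q) < 1" "norm (c * q * a * b) < 1"
    using norm_mult_power_less_1[OF q c(1), of 1] norm_mult_power_less_1[OF q c(2), of 1]
    by (simp_all add: mult_ac)
  \<comment> \<open>\<open>K\<close> is common to both series: the term for \<open>c\<close> times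
    \<open>1 - c\<close> is \<open>K n * (1 - c * q ^ n)\<close>, the term for \<open>c * q\<close>
    is \<open>K n * q ^ n\<close>.\<close>
  define K where "K = (\<lambda>n. qrev a q n * qrev b q n * c ^ n / (qpoch q q n * qpoch (c * q) q n))"
  define G where "G = (\<lambda>n. - (K n * (1 - q ^ n) * (1 - c * q ^ n)))"
  have nz: "qpoch q q n \<noteq> 0" "qpoch c q n \<noteq> 0" "qpoch (c * q) q n \<noteq> 0" for n
    using qpoch_nonzero q c cq by auto
  have step: "(1 - c) * (1 - c * a * b) * gauss_term a b q c n
      - (1 - c * a) * (1 - c * b) * gauss_term a b q (c * q) n = G (Suc n) - G n" for n
  proof -
    have "qpoch c q n * (1 - c * q ^ n) = (1 - c) * qpoch (c * q) q n"
      by (metis qpoch_Suc qpoch_Suc_left)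
    then have 1: "(1 - c) * gauss_term a b q c n = K n * (1 - c * q ^ n)"
      using nz[of n] by (simp add: gauss_term_def K_def divide_simps) (simp add: mult_ac)
    have 2: "gauss_term a b q (c * q) n = K n * q ^ n"
      by (simp add: gauss_term_def K_def power_mult_distrib)
    have "q ^ Suc n * c \<noteq> 1" "q ^ Suc n \<noteq> 1"
      using nz(1,3)[of "Suc n"] by (auto simp: qpoch_Suc mult_ac)
    then have "K (Suc n) * ((1 - q ^ Suc n) * (1 - c * q ^ Suc n)) = K n * c * (a - q ^ n) * (b - q ^ n)"
      using nz[of n] by (simp add: K_def qrev_Suc qpoch_Suc divide_simps) (simp add: mult_ac)
    then have 3: "G (Suc n) = - (K n * c * (a - q ^ n) * (b - q ^ n))"
      unfolding G_def by (simp only: mult.assoc)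
    have 4: "(1 - c) * (1 - c * a * b) * gauss_term a b q c n = (1 - c * a * b) * (K n * (1 - c * q ^ n))"
      unfolding 1[symmetric] by simp
    show ?thesis unfolding 2 3 4 unfolding G_def by algebra
  qed
  have "summable (\<lambda>n. norm (gauss_term a b q c n))" "summable (\<lambda>n. norm (gauss_term a b q (c * q) n))"
    using summable_gauss_term q c cq by auto
  then have sm: "summable (gauss_term a b q c)" "summable (gauss_term a b q (c * q))"
    by (auto intro: summable_norm_cancel)
  \<comment> \<open>Up to sign, \<open>G n\<close> is \<open>(1 - c) * (1 - q ^ n)\<close> times the
    term of a convergent series.\<close>
  have "G \<longlonglongrightarrow> 0"
  proof -
    have "(\<lambda>n. (1 - c) * gauss_term a b q c n * (1 - q ^ n)) \<longlonglongrightarrow> (1 - c) * 0 * (1 - 0)"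
      using q by (intro tendsto_intros summable_LIMSEQ_zero sm LIMSEQ_power_zero)
    moreover have "(1 - c) * gauss_term a b q c n * (1 - q ^ n) = - G n" for n
    proof -
      have "qpoch c q n * (1 - c * q ^ n) = (1 - c) * qpoch (c * q) q n"
        by (metis qpoch_Suc qpoch_Suc_left)
      then have "(1 - c) * gauss_term a b q c n = K n * (1 - c * q ^ n)"
        using nz[of n] by (simp add: gauss_term_def K_def divide_simps) (simp add: mult_ac)
      then show ?thesis by (simp add: G_def)
    qed
    ultimately show ?thesis using tendsto_minus_cancel[of G 0 sequentially] by simp
  qed
  from telescope_sums[OF this]
  have "(\<lambda>n. G (Suc n) - G n) sums 0" by (simp add: G_def)
  moreover have "(\<lambda>n. G (Suc n) - G n) sums
      ((1 - c) * (1 - c * a * b) * (\<Sum>n. gauss_term a b q c n) -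
       (1 - c * a) * (1 - c * b) * (\<Sum>n. gauss_term a b q (c * q) n))"
    unfolding step[symmetric] by (intro sums_diff sums_mult summable_sums sm)
  ultimately show ?thesis using sums_unique2 by fastforce
qed

text \<open>Iterating the contiguous relation \<open>N\<close> times produces the finite products
  and moves the parameter to \<open>c * q ^ N\<close>; in the limit that series reduces to its first
  term 1.\<close>

lemma q_gauss_sum:
  assumes q: "norm q < 1" and c: "norm c < 1" "norm (c * a * b) < 1"
  shows "(\<Sum>n. gauss_term a b q c n) =
         qpoch_inf (c * a) q * qpoch_inf (c * b) q / (qpoch_inf c q * qpoch_inf (c * a * b) q)"
proof -
  let ?f = "\<lambda>c. \<Sum>n. gauss_term a b q c n"
  obtain K where K: "K > 0" "\<And>N n. norm (gauss_term a b q (c * q ^ N) n) \<le>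
       K * norm (qrev a q n * qrev b q n * c ^ n) * norm q ^ (N * n)"
    using gauss_term_bound q c by metis
  have less: "norm (c * q ^ N) < 1" "norm (c * q ^ N * a * b) < 1" for N
    using norm_mult_power_less_1[OF q c(1), of N] norm_mult_power_less_1[OF q c(2), of N]
    by (simp_all add: mult_ac)
  define M where "M = (\<Sum>n. K * norm (qrev a q (Suc n) * qrev b q (Suc n) * c ^ Suc n))"
  have sM: "summable (\<lambda>n. K * norm (qrev a q (Suc n) * qrev b q (Suc n) * c ^ Suc n))"
    using summable_qrev[OF q c(2)]
    by (intro summable_mult) (subst summable_Suc_iff[of "\<lambda>n. norm (qrev a q n * qrev b q n * c ^ n)"])
  have "norm (?f (c * q ^ N) - 1) \<le> norm q ^ N * M" for N
  proof -
    have sf: "summable (\<lambda>n. norm (gauss_term a b q (c * q ^ N) n))"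
      using summable_gauss_term q less by blast
    then have sf': "summable (\<lambda>n. norm (gauss_term a b q (c * q ^ N) (Suc n)))"
      by (subst summable_Suc_iff)
    have "?f (c * q ^ N) - 1 = (\<Sum>n. gauss_term a b q (c * q ^ N) (Suc n))"
      using suminf_split_head[OF summable_norm_cancel[OF sf]] by (simp add: gauss_term_def)
    then have "norm (?f (c * q ^ N) - 1) \<le> (\<Sum>n. norm (gauss_term a b q (c * q ^ N) (Suc n)))"
      using summable_norm[OF sf'] by simp
    also have "\<dots> \<le> (\<Sum>n. norm q ^ N * (K * norm (qrev a q (Suc n) * qrev b q (Suc n) * c ^ Suc n)))"
    proof (rule suminf_le[OF _ sf' summable_mult[OF sM]])
      \<comment> \<open>For the index \<open>Suc n\<close> one factor \<open>norm q ^ N\<close> is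
        kept; the rest of the power is at most 1.\<close>
      fix n
      have "norm q ^ (N * Suc n) \<le> norm q ^ N"
        using q by (intro power_decreasing) auto
      then have "K * norm (qrev a q (Suc n) * qrev b q (Suc n) * c ^ Suc n) * norm q ^ (N * Suc n) \<le>
          K * norm (qrev a q (Suc n) * qrev b q (Suc n) * c ^ Suc n) * norm q ^ N"
        using K by (intro mult_left_mono) auto
      then show "norm (gauss_term a b q (c * q ^ N) (Suc n)) \<le>
          norm q ^ N * (K * norm (qrev a q (Suc n) * qrev b q (Suc n) * c ^ Suc n))"
        using K(2)[of N "Suc n"] by (simp only: mult.commute[of "norm q ^ N"])
    qed
    also have "\<dots> = norm q ^ N * M"
      unfolding M_def by (rule suminf_mult[OF sM])
    finally show ?thesis .
  qed
  moreover have "(\<lambda>N. norm q ^ N * M) \<longlonglongrightarrow> 0 * M"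
    using q by (intro tendsto_intros LIMSEQ_power_zero) simp
  ultimately have "(\<lambda>N. ?f (c * q ^ N) - 1) \<longlonglongrightarrow> 0"
    by (intro Lim_null_comparison[of "\<lambda>N. ?f (c * q ^ N) - 1" "\<lambda>N. norm q ^ N * M"]) auto
  then have lim: "(\<lambda>N. ?f (c * q ^ N)) \<longlonglongrightarrow> 1"
    by (rule LIM_zero_cancel)
  have ind: "qpoch c q N * qpoch (c * a * b) q N * ?f c =
      qpoch (c * a) q N * qpoch (c * b) q N * ?f (c * q ^ N)" for N
  proof (induction N)
    case (Suc N)
    have "qpoch c q (Suc N) * qpoch (c * a * b) q (Suc N) * ?f c =
        (1 - c * q ^ N) * (1 - c * a * b * q ^ N) * (qpoch c q N * qpoch (c * a * b) q N * ?f c)"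
      by (simp add: qpoch_Suc mult_ac)
    also have "\<dots> = qpoch (c * a) q N * qpoch (c * b) q N *
        ((1 - c * q ^ N) * (1 - c * q ^ N * a * b) * ?f (c * q ^ N))"
      unfolding Suc.IH by (simp only: mult_ac)
    also have "\<dots> = qpoch (c * a) q (Suc N) * qpoch (c * b) q (Suc N) * ?f (c * q ^ Suc N)"
      unfolding gauss_contiguous[OF q less] by (simp add: qpoch_Suc mult_ac)
    finally show ?case .
  qed simp
  have "qpoch_inf c q * qpoch_inf (c * a * b) q * ?f c = qpoch_inf (c * a) q * qpoch_inf (c * b) q * 1"
  proof (rule LIMSEQ_unique)
    show "(\<lambda>N. qpoch c q N * qpoch (c * a * b) q N * ?f c) \<longlonglongrightarrow>
        qpoch_inf c q * qpoch_inf (c * a * b) q * ?f c"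
      by (intro tendsto_intros qpoch_tendsto q)
    show "(\<lambda>N. qpoch c q N * qpoch (c * a * b) q N * ?f c) \<longlonglongrightarrow>
        qpoch_inf (c * a) q * qpoch_inf (c * b) q * 1"
      unfolding ind by (intro tendsto_intros qpoch_tendsto q lim)
  qed
  then show ?thesis
    using qpoch_inf_nonzero q c by (simp add: field_simps)
qed

section \<open>Summing against the q-Gauss conjugate pair\<close>

lemma infsum_nat_shift:
  assumes "\<And>n. n < r \<Longrightarrow> f n = 0"
  shows "infsum f (UNIV :: nat set) = (\<Sum>\<^sub>\<infinity>m. f (m + r))"
proof -
  have "infsum f UNIV = infsum f {r..}"
    by (rule infsum_cong_neutral) (use assms in auto)
  also have "\<dots> = (\<Sum>\<^sub>\<infinity>m. f (m + r))"
    by (rule infsum_reindex_bij_witness[of _ "\<lambda>m. m + r" "\<lambda>n. n - r"]) auto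
  finally show ?thesis .
qed

lemma infsum_eq_suminf_if_norm_summable:
  fixes f :: "nat \<Rightarrow> complex"
  assumes "summable (\<lambda>n. norm (f n))"
  shows "infsum f UNIV = suminf f"
  using norm_summable_imp_has_sum[OF assms summable_sums[OF summable_norm_cancel[OF assms]]]
  by (rule infsumI)

text \<open>Shifting \<open>n = m + r\<close> gives a q-Gauss series with parameters
  \<open>A = a / q^r\<close>, \<open>B = b / q^r\<close>, \<open>c = q^(2r+1+e)\<close>, so that
  \<open>c * A * B\<close> does not depend on \<open>r\<close>. The value \<open>e = 0\<close> is
  the kernel relative to 1 (for F), \<open>e = 1\<close> the one relative to \<open>q\<close> (for
  G).\<close>

lemma gauss_kernel_sum:
  assumes q: "norm q < 1" "q \<noteq> 0" and ab: "norm (q ^ Suc e * a * b) < 1"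
  shows "(\<Sum>\<^sub>\<infinity>n. qrev a q n * qrev b q n * (q ^ Suc e) ^ n *
            (inv_qfact q (int n - int r) * inv_qfact q (int n + int r + int e))) =
    qrev a q r * qrev b q r * (q ^ Suc e) ^ r * qpoch_inf (q ^ (r + Suc e) * a) q *
    qpoch_inf (q ^ (r + Suc e) * b) q / (qpoch_inf q q * qpoch_inf (q ^ Suc e * a * b) q)"
    (is "infsum ?F UNIV = _")
proof -
  define c A B x where "c = q ^ (2 * r + Suc e)" and "A = a / q ^ r" and "B = b / q ^ r" and "x = q ^ Suc e"
  have c1: "norm c < 1"
    using q unfolding c_def norm_power by (intro power_less_one_iff[THEN iffD2]) auto
  have cAB: "c * A = q ^ (r + Suc e) * a" "c * B = q ^ (r + Suc e) * b" "c * A * B = x * a * b"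
    and cx: "c = q ^ r * q ^ r * x"
    using q by (simp_all add: c_def A_def B_def x_def power_add mult_2)
  have nz: "qpoch q q n \<noteq> 0" for n using qpoch_nonzero q by blast
  have split: "qpoch_inf q q = qpoch q q (2 * r + e) * qpoch_inf c q"
    using qpoch_inf_split[OF q(1), of q "2 * r + e"] by (simp add: c_def)
  have shifted: "?F (m + r) = qrev a q r * qrev b q r * x ^ r / qpoch q q (2 * r + e) * gauss_term A B q c m" for m
  proof -
    have 1: "int (m + r) - int r = int m" "int (m + r) + int r + int e = int (2 * r + e + m)" by simp_all
    have "qpoch q q (2 * r + e + m) = qpoch q q (2 * r + e) * qpoch c q m"
      using qpoch_add[of q q "2 * r + e" m] by (simp add: c_def)
    then show ?thesis
      unfolding 1 inv_qfact_nat qrev_add[OF q(2)] gauss_term_def x_def[symmetric] A_def[symmetric] B_def[symmetric] cx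
      by (simp add: power_add power_mult_distrib mult_ac)
  qed
  have s: "summable (\<lambda>m. norm (gauss_term A B q c m))"
    using summable_gauss_term[OF q(1) c1] ab cAB(3) x_def by simp
  have "infsum ?F UNIV = (\<Sum>\<^sub>\<infinity>m. ?F (m + r))"
    by (rule infsum_nat_shift) simp
  also have "\<dots> = qrev a q r * qrev b q r * x ^ r / qpoch q q (2 * r + e) * (\<Sum>m. gauss_term A B q c m)"
    unfolding shifted infsum_cmult_right' infsum_eq_suminf_if_norm_summable[OF s] ..
  also have "(\<Sum>m. gauss_term A B q c m) = qpoch_inf (q ^ (r + Suc e) * a) q *
    qpoch_inf (q ^ (r + Suc e) * b) q / (qpoch_inf c q * qpoch_inf (x * a * b) q)"
    using q_gauss_sum[OF q(1) c1, of A B, unfolded cAB(3), unfolded cAB(1,2)] ab by (simp only: x_def)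
  finally show ?thesis
    unfolding split x_def by (simp add: mult_ac)
qed

lemma summable_gauss_kernel:
  assumes q: "norm q < 1" and ab: "norm (x * a * b) < 1"
  shows "(\<lambda>n. qrev a q n * qrev b q n * x ^ n * (inv_qfact q (k n) * inv_qfact q (l n))) summable_on UNIV"
proof -
  obtain C where C: "C > 0" "\<And>m. norm (inv_qfact q m) \<le> C"
    using inv_qfact_bounded q by metis
  have "norm (qrev a q n * qrev b q n * x ^ n * (inv_qfact q (k n) * inv_qfact q (l n))) \<le>
        norm (qrev a q n * qrev b q n * x ^ n) * (C * C)" for n
    unfolding norm_mult[of _ "inv_qfact q (k n) * inv_qfact q (l n)"] norm_mult[of "inv_qfact q (k n)"]
    using C by (intro mult_left_mono mult_mono) auto
  then have "summable (\<lambda>n. norm (qrev a q n * qrev b q n * x ^ n * (inv_qfact q (k n) * inv_qfact q (l n))))"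
    by (intro summable_comparison_test'[OF summable_mult2[OF summable_qrev[OF q ab], of "C * C"]]) auto
  then show ?thesis by (rule norm_summable_imp_summable_on)
qed

text \<open>Rests on \<open>(1 - q^(n+r+1)) - q^(2r+1) (1 - q^(n-r)) = 1 - q^(2r+1)\<close>. The
  weights \<open>q ^ n\<close> of F can be summed only against the kernel relative to 1, so the
  kernel relative to \<open>q\<close> is rewritten by two of those.\<close>

lemma bailey_kernel_split:
  assumes "norm q < 1" "q \<noteq> 0"
  shows "bailey_kernel q r n =
    inv_qfact q (int n - int r) * inv_qfact q (int n + int r) -
    q ^ (2 * r + 1) * (inv_qfact q (int n - int (Suc r)) * inv_qfact q (int n + int (Suc r)))"
proof -
  define X Y N R where "X = inv_qfact q (int n - int r)" and "Y = inv_qfact q (int n + int r + 1)"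
    and "N = q ^ n" and "R = q ^ r"
  have e: "inv_qfact q (int n + int r) = (1 - N * R * q) * Y"
    "inv_qfact q (int n - int (Suc r)) = (1 - N / R) * X" "inv_qfact q (int n + int (Suc r)) = Y"
    using inv_qfact_eq[OF assms(1), of "int n + int r + 1" "int n + int r"]
      inv_qfact_eq[OF assms(1), of "int n - int r" "int n - int (Suc r)"] assms(2)
    by (simp_all add: X_def Y_def N_def R_def power_int_add power_int_diff add_ac)
  have R: "R \<noteq> 0" "q ^ (2 * r + 1) = R * R * q" using assms(2) by (simp_all add: R_def mult_2 power_add)
  show ?thesis
    unfolding bailey_kernel_def e R(2) X_def[symmetric] Y_def[symmetric]
    using R(1) by (simp add: field_simps)
qed

lemma bailey_F:
  assumes q: "norm q < 1" "q \<noteq> 0" and z: "z \<noteq> 0" "1 + z \<noteq> 0" and ab: "norm (q * a * b) < 1"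
  shows "(\<Sum>\<^sub>\<infinity>n\<in>{1..}. qpoch z q n * qpoch (inverse z) q n / qpoch q q (2 * n) *
            (qrev a q n * qrev b q n * q ^ n)) =
    (\<Sum>\<^sub>\<infinity>r. bailey_alpha z q r * (qrev a q r * qrev b q r * q ^ r *
        qpoch_inf (q ^ (r + 2) * a) q * qpoch_inf (q ^ (r + 2) * b) q /
        (qpoch_inf q q * qpoch_inf (q * a * b) q) *
        (1 - q ^ (r + 1) * a - q ^ (r + 1) * b + q ^ (3 * r + 2) * a + q ^ (3 * r + 2) * b - q ^ (4 * r + 2))))"
proof -
  let ?d = "\<lambda>n. qrev a q n * qrev b q n * q ^ n"
  let ?T = "\<lambda>r n. ?d n * (inv_qfact q (int n - int r) * inv_qfact q (int n + int r))"
  let ?P = "qpoch_inf q q * qpoch_inf (q * a * b) q"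
  have T: "(\<Sum>\<^sub>\<infinity>n. ?T r n) = ?d r * qpoch_inf (q ^ (r + 1) * a) q * qpoch_inf (q ^ (r + 1) * b) q / ?P" for r
    using gauss_kernel_sum[OF q, of 0 a b r] ab by simp
  have Ts: "?T r summable_on UNIV" for r
    using summable_gauss_kernel[OF q(1) ab] by simp
  have "(\<Sum>\<^sub>\<infinity>n. ?d n * bailey_kernel q r n) = ?d r *
        qpoch_inf (q ^ (r + 2) * a) q * qpoch_inf (q ^ (r + 2) * b) q / ?P *
        (1 - q ^ (r + 1) * a - q ^ (r + 1) * b + q ^ (3 * r + 2) * a + q ^ (3 * r + 2) * b - q ^ (4 * r + 2))" for r
  proof -
    define p where "p = - (q ^ (2 * r + 1))"
    have eq: "?d n * bailey_kernel q r n = ?T r n + p * ?T (Suc r) n" for n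
      unfolding bailey_kernel_split[OF q] p_def by algebra
    have "((\<lambda>n. ?T r n + p * ?T (Suc r) n) has_sum (\<Sum>\<^sub>\<infinity>n. ?T r n) + p * (\<Sum>\<^sub>\<infinity>n. ?T (Suc r) n)) UNIV"
      by (intro has_sum_add has_sum_cmult_right has_sum_infsum Ts)
    then have 1: "(\<Sum>\<^sub>\<infinity>n. ?d n * bailey_kernel q r n) = (\<Sum>\<^sub>\<infinity>n. ?T r n) + p * (\<Sum>\<^sub>\<infinity>n. ?T (Suc r) n)"
      unfolding eq by (rule infsumI)
    \<comment> \<open>Brings both q-Gauss values to the products starting at \<open>q^(r+2)\<close>.
      The bracket is then
      \<open>(1 - q^(r+1) a)(1 - q^(r+1) b) - q^(2r+2) (a - q^r)(b - q^r)\<close>, in which the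
      terms with \<open>a b\<close> cancel.\<close>
    have 2: "qpoch_inf (q ^ (r + 1) * x) q = (1 - q ^ (r + 1) * x) * qpoch_inf (q ^ (r + 2) * x) q" for x
      using qpoch_inf_rec[OF q(1), of "q ^ (r + 1) * x"] by (simp add: mult_ac)
    have 3: "(\<Sum>\<^sub>\<infinity>n. ?T (Suc r) n) =
        ?d (Suc r) * qpoch_inf (q ^ (r + 2) * a) q * qpoch_inf (q ^ (r + 2) * b) q / ?P"
      unfolding T by simp
    define R where "R = q ^ r"
    have 4: "q ^ (r + 1) = R * q" "q ^ (3 * r + 2) = R ^ 3 * (q * q)" "q ^ (4 * r + 2) = R ^ 4 * (q * q)"
      "q ^ (2 * r + 1) = R ^ 2 * q" "q ^ r = R"
      by (simp_all add: R_def power_add mult.commute flip: power_mult)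
    show ?thesis
      unfolding 1 3 T unfolding 2 unfolding p_def qrev_Suc power_Suc 4 diff_divide_distrib[symmetric] add_divide_distrib[symmetric]
        times_divide_eq_right times_divide_eq_left
      by (intro arg_cong2[of _ _ _ _ "(/)"] refl) algebra
  qed
  then show ?thesis
    using bailey_transform[OF q z summable_qrev[OF q(1) ab]] by simp
qed

text \<open>Here the kernel is \<open>1 - q^(2r+1)\<close> times the q-Gauss kernel with
  \<open>e = 1\<close>, so a single evaluation suffices.\<close>

lemma bailey_G:
  assumes q: "norm q < 1" "q \<noteq> 0" and z: "z \<noteq> 0" "1 + z \<noteq> 0" and ab: "norm (q ^ 2 * a * b) < 1"
  shows "(\<Sum>\<^sub>\<infinity>n\<in>{1..}. qpoch z q n * qpoch (inverse z) q n / qpoch q q (2 * n) *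
            (qrev a q n * qrev b q n * (q ^ 2) ^ n)) =
    (\<Sum>\<^sub>\<infinity>r. bailey_alpha z q r * ((1 - q ^ (2 * r + 1)) * (qrev a q r * qrev b q r * (q ^ 2) ^ r *
        qpoch_inf (q ^ (r + 2) * a) q * qpoch_inf (q ^ (r + 2) * b) q /
        (qpoch_inf q q * qpoch_inf (q ^ 2 * a * b) q))))"
proof -
  let ?d = "\<lambda>n. qrev a q n * qrev b q n * (q ^ 2) ^ n"
  have "(\<Sum>\<^sub>\<infinity>n. ?d n * bailey_kernel q r n) = (1 - q ^ (2 * r + 1)) * (?d r *
        qpoch_inf (q ^ (r + 2) * a) q * qpoch_inf (q ^ (r + 2) * b) q /
        (qpoch_inf q q * qpoch_inf (q ^ 2 * a * b) q))" for r
  proof -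
    have "(\<Sum>\<^sub>\<infinity>n. ?d n * bailey_kernel q r n) = (1 - q ^ (2 * r + 1)) *
      (\<Sum>\<^sub>\<infinity>n. ?d n * (inv_qfact q (int n - int r) * inv_qfact q (int n + int r + int 1)))"
      unfolding bailey_kernel_def infsum_cmult_right'[symmetric] by (simp add: mult_ac)
    then show ?thesis
      using gauss_kernel_sum[OF q, of 1 a b r] ab by (simp add: numeral_2_eq_2)
  qed
  then show ?thesis
    using bailey_transform[OF q z summable_qrev[OF q(1) ab]] by simp
qed

section \<open>Three conjugate Bailey pairs with partial theta functions\<close>

definition partial_theta :: "complex \<Rightarrow> complex \<Rightarrow> complex" where
  "partial_theta p y = (\<Sum>n. p ^ (n * (n - 1) div 2) * y ^ n)"

lemma summable_partial_theta:
  fixes p y :: complex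
  assumes "norm p < 1"
  shows "summable (\<lambda>n. norm (p ^ (n * (n - 1) div 2) * y ^ n))"
  using summable_power_triangle[OF assms, of "norm y"] by (simp add: norm_mult norm_power mult_ac)

text \<open>Splitting off the term \<open>n = 0\<close> and using that the triangular exponent grows
  by \<open>n\<close> from \<open>n\<close> to \<open>n + 1\<close>.\<close>

lemma partial_theta_rec:
  assumes "norm p < 1"
  shows "partial_theta p y = 1 + y * partial_theta p (y * p)"
proof -
  have s: "summable (\<lambda>n. p ^ (n * (n - 1) div 2) * y ^ n)" for y
    using summable_partial_theta[OF assms] by (rule summable_norm_cancel)
  have "partial_theta p y = 1 + (\<Sum>n. p ^ (Suc n * (Suc n - 1) div 2) * y ^ Suc n)"
    unfolding partial_theta_def using suminf_split_head[OF s[of y]] by simp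
  also have "(\<lambda>n. p ^ (Suc n * (Suc n - 1) div 2) * y ^ Suc n) = (\<lambda>n. y * (p ^ (n * (n - 1) div 2) * (y * p) ^ n))"
    unfolding diff_Suc_1 half_mult_Suc by (simp add: power_add power_mult_distrib mult_ac)
  also have "(\<Sum>n. y * (p ^ (n * (n - 1) div 2) * (y * p) ^ n)) = y * partial_theta p (y * p)"
    unfolding partial_theta_def using suminf_mult[OF s] by simp
  finally show ?thesis .
qed

lemma partial_theta_bounded:
  assumes "norm p < 1"
  obtains C where "\<And>y. norm y \<le> 1 \<Longrightarrow> norm (partial_theta p y) \<le> C"
proof (rule that)
  fix y :: complex assume y: "norm y \<le> 1"
  have "norm (partial_theta p y) \<le> (\<Sum>n. norm (p ^ (n * (n - 1) div 2) * y ^ n))"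
    unfolding partial_theta_def by (rule summable_norm[OF summable_partial_theta[OF assms]])
  also have "\<dots> \<le> (\<Sum>n. 1 ^ n * norm p ^ (n * (n - 1) div 2))"
  proof (rule suminf_le[OF _ summable_partial_theta[OF assms] summable_power_triangle[OF assms]])
    fix n
    have "norm y ^ n \<le> 1" using y by (intro power_le_one) auto
    then show "norm (p ^ (n * (n - 1) div 2) * y ^ n) \<le> 1 ^ n * norm p ^ (n * (n - 1) div 2)"
      by (simp add: norm_mult norm_power mult_left_le)
  qed
  finally show "norm (partial_theta p y) \<le> (\<Sum>n. 1 ^ n * norm p ^ (n * (n - 1) div 2))" .
qed

text \<open>The difference satisfies \<open>D r = c r * D (Suc r)\<close>, hence
  \<open>norm (D r) \<le> t ^ N * norm (D (r + N))\<close>; as it is bounded, it is 0. Boundedness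
  thus replaces an initial value.\<close>

lemma contraction_recurrence_unique:
  fixes f g A c :: "nat \<Rightarrow> complex"
  assumes t: "0 \<le> t" "t < 1" and c: "\<And>r. norm (c r) \<le> t"
    and f: "\<And>r. norm (f r) \<le> B" "\<And>r. f r = A r + c r * f (Suc r)"
    and g: "\<And>r. norm (g r) \<le> B'" "\<And>r. g r = A r + c r * g (Suc r)"
  shows "f r = g r"
proof -
  define D where "D = (\<lambda>r. f r - g r)"
  have "norm (D r) \<le> t ^ N * norm (D (r + N))" for N
  proof (induction N)
    case (Suc N)
    have "D (r + N) = c (r + N) * D (Suc (r + N))"
      unfolding D_def using f(2)[of "r + N"] g(2)[of "r + N"] by algebra
    then have "norm (D (r + N)) \<le> t * norm (D (Suc (r + N)))"
      using mult_right_mono[OF c[of "r + N"]] by (simp add: norm_mult)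
    then have "t ^ N * norm (D (r + N)) \<le> t ^ N * (t * norm (D (Suc (r + N))))"
      using t by (intro mult_left_mono) auto
    with Suc show ?case by (simp add: mult_ac)
  qed simp
  moreover have "norm (D r) \<le> B + B'" for r
    unfolding D_def using norm_triangle_ineq4[of "f r" "g r"] f(1)[of r] g(1)[of r] by linarith
  ultimately have "norm (D r) \<le> t ^ N * (B + B')" for N
    using t by (meson mult_left_mono order_trans zero_le_power)
  moreover have "(\<lambda>N. t ^ N * (B + B')) \<longlonglongrightarrow> 0 * (B + B')"
    using t by (intro tendsto_intros LIMSEQ_power_zero) simp
  ultimately have "norm (D r) \<le> 0 * (B + B')"
    by (intro LIMSEQ_le_const[of "\<lambda>N. t ^ N * (B + B')"]) auto
  then show ?thesis by (simp add: D_def)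
qed

text \<open>
  The sum \<open>\<gamma>\<^sub>r\<close> for the weights \<open>\<delta>\<^sub>n = p\<^sup>n \<Delta>\<^sub>n\<close>, reindexed by \<open>n = m + r\<close> and with the factor \<open>p\<^sup>r\<close> removed;
  in this normalisation it stays bounded as \<open>r \<rightarrow> \<infinity>\<close>.
\<close>

definition conj_sum :: "complex \<Rightarrow> (nat \<Rightarrow> complex) \<Rightarrow> nat \<Rightarrow> complex" where
  "conj_sum p \<Delta> r = (\<Sum>m. p ^ m * \<Delta> (m + r) * (inv_qfact p (int m) * inv_qfact p (int (m + 2 * r + 1))))"

lemma conj_term_bound:
  assumes p: "norm p < 1" and \<Delta>: "\<And>n. norm (\<Delta> n) \<le> B"
  obtains C where "\<And>m n k l. norm (p ^ m * \<Delta> n * (inv_qfact p k * inv_qfact p l)) \<le> C * norm p ^ m"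
proof -
  obtain A where A: "A > 0" "\<And>m. norm (inv_qfact p m) \<le> A"
    using inv_qfact_bounded p by metis
  show ?thesis
  proof (rule that[of "B * (A * A)"])
    fix m n k l
    have "norm (\<Delta> n) * (norm (inv_qfact p k) * norm (inv_qfact p l)) \<le> B * (A * A)"
      using A \<Delta>[of n] by (intro mult_mono) (auto intro: order_trans[OF norm_ge_zero])
    from mult_right_mono[OF this, of "norm p ^ m"]
    show "norm (p ^ m * \<Delta> n * (inv_qfact p k * inv_qfact p l)) \<le> B * (A * A) * norm p ^ m"
      by (simp add: norm_mult norm_power mult_ac)
  qed
qed

lemma summable_conj_term:
  assumes p: "norm p < 1" and \<Delta>: "\<And>n. norm (\<Delta> n) \<le> B"
  shows "summable (\<lambda>m. norm (p ^ m * \<Delta> (f m) * (inv_qfact p (k m) * inv_qfact p (l m))))"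
proof -
  obtain C where "\<And>m n k l. norm (p ^ m * \<Delta> n * (inv_qfact p k * inv_qfact p l)) \<le> C * norm p ^ m"
    using conj_term_bound[of p \<Delta> B] p \<Delta> by metis
  then show ?thesis
    using p by (intro summable_comparison_test'[OF summable_mult[OF summable_geometric], of "norm p" 0 _ C]) auto
qed

lemma conj_sum_bounded:
  assumes p: "norm p < 1" and \<Delta>: "\<And>n. norm (\<Delta> n) \<le> B"
  obtains C where "\<And>r. norm (conj_sum p \<Delta> r) \<le> C"
proof -
  obtain C where C: "\<And>m n k l. norm (p ^ m * \<Delta> n * (inv_qfact p k * inv_qfact p l)) \<le> C * norm p ^ m"
    using conj_term_bound[of p \<Delta> B] p \<Delta> by metis
  show ?thesis
  proof (rule that)
    fix r
    have "norm (conj_sum p \<Delta> r) \<le>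
        (\<Sum>m. norm (p ^ m * \<Delta> (m + r) * (inv_qfact p (int m) * inv_qfact p (int (m + 2 * r + 1)))))"
      unfolding conj_sum_def by (rule summable_norm[OF summable_conj_term[OF p \<Delta>]])
    also have "\<dots> \<le> (\<Sum>m. C * norm p ^ m)"
      using p by (intro suminf_le[OF C summable_conj_term[OF p \<Delta>]] summable_mult summable_geometric) simp
    finally show "norm (conj_sum p \<Delta> r) \<le> (\<Sum>m. C * norm p ^ m)" .
  qed
qed

lemma infsum_bailey_kernel_eq_conj_sum:
  assumes p: "norm p < 1" and \<Delta>: "\<And>n. norm (\<Delta> n) \<le> B"
  shows "(\<Sum>\<^sub>\<infinity>n. p ^ n * \<Delta> n * bailey_kernel p r n) = (1 - p ^ (2 * r + 1)) * p ^ r * conj_sum p \<Delta> r"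
proof -
  have "(\<Sum>\<^sub>\<infinity>n. p ^ n * \<Delta> n * bailey_kernel p r n) =
        (\<Sum>\<^sub>\<infinity>m. p ^ (m + r) * \<Delta> (m + r) * bailey_kernel p r (m + r))"
    by (rule infsum_nat_shift) (simp add: bailey_kernel_eq_0)
  also have "\<dots> = (\<Sum>\<^sub>\<infinity>m. (1 - p ^ (2 * r + 1)) * p ^ r *
      (p ^ m * \<Delta> (m + r) * (inv_qfact p (int m) * inv_qfact p (int (m + 2 * r + 1)))))"
  proof (rule infsum_cong)
    fix m
    have "int (m + r) - int r = int m" "int (m + r) + int r + 1 = int (m + 2 * r + 1)" by simp_all
    then show "p ^ (m + r) * \<Delta> (m + r) * bailey_kernel p r (m + r) = (1 - p ^ (2 * r + 1)) * p ^ r *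
      (p ^ m * \<Delta> (m + r) * (inv_qfact p (int m) * inv_qfact p (int (m + 2 * r + 1))))"
      by (simp only: bailey_kernel_def power_add mult_ac)
  qed
  also have "\<dots> = (1 - p ^ (2 * r + 1)) * p ^ r * conj_sum p \<Delta> r"
    unfolding infsum_cmult_right' conj_sum_def
    by (subst infsum_eq_suminf_if_norm_summable, rule summable_conj_term[OF p], rule \<Delta>) (rule refl)
  finally show ?thesis .
qed

text \<open>Reduces a linear relation between two consecutive sums to the identity
  \<open>step\<close>, which is the telescoping relation with the common factor
  \<open>1 / ((p;p)_m (p;p)_(m+2r+2))\<close> removed. The constants \<open>a\<close>,
  \<open>b\<close> and the sequence \<open>V\<close> are free and are chosen separately for each
  weight.\<close>

lemma conj_sum_telescope:
  assumes p: "norm p < 1" and \<Delta>: "\<And>n. norm (\<Delta> n) \<le> B"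
    and step: "\<And>m. p ^ m * \<Delta> (m + r) * (a * (1 - p ^ (m + 2 * r + 2)) + b * (1 - p ^ m)) =
       V (Suc (m + r)) - V (m + r) * (1 - p ^ m) * (1 - p ^ (m + 2 * r + 2))"
    and V: "V \<longlonglongrightarrow> L"
  shows "a * conj_sum p \<Delta> r + b * p * conj_sum p \<Delta> (Suc r) = L / qpoch_inf p p ^ 2"
proof -
  let ?i = "inv_qfact p"
  let ?f = "\<lambda>m. p ^ m * \<Delta> (m + r) * (?i (int m) * ?i (int (m + 2 * r + 1)))"
  let ?g = "\<lambda>m. p ^ m * \<Delta> (m + r) * (?i (int m - 1) * ?i (int (m + 2 * r + 2)))"
  \<comment> \<open>The telescoping sequence; the reciprocal factorial of index -1 makes
    \<open>U 0 = 0\<close>.\<close>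
  define U where "U = (\<lambda>m. V (m + r) * (?i (int m - 1) * ?i (int (m + 2 * r + 1))))"
  have s: "summable ?f" "summable ?g"
    by (rule summable_norm_cancel, rule summable_conj_term[OF p], rule \<Delta>)+
  have "?f sums conj_sum p \<Delta> r"
    unfolding conj_sum_def using s(1) by (rule summable_sums)
  moreover have "?g sums (p * conj_sum p \<Delta> (Suc r))"
  proof -
    \<comment> \<open>The term \<open>m = 0\<close> of \<open>?g\<close> vanishes through
      \<open>inv_qfact\<close> at -1, and the shift by one turns \<open>r\<close> into
      \<open>Suc r\<close> at the cost of a factor \<open>p\<close>.\<close>
    have "(\<Sum>m. ?g m) = (\<Sum>m. ?g (Suc m))"
      using suminf_split_head[OF s(2)] by simp
    also have "(\<lambda>m. ?g (Suc m)) = (\<lambda>m. p * (p ^ m * \<Delta> (m + Suc r) * (?i (int m) * ?i (int (m + 2 * Suc r + 1)))))"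
      by (simp add: mult_ac del: inv_qfact_nat)
    also have "suminf \<dots> = p * conj_sum p \<Delta> (Suc r)"
      unfolding conj_sum_def by (rule suminf_mult[OF summable_norm_cancel[OF summable_conj_term[OF p \<Delta>]]])
    finally show ?thesis using summable_sums[OF s(2)] by simp
  qed
  ultimately have "(\<lambda>m. a * ?f m + b * ?g m) sums
      (a * conj_sum p \<Delta> r + b * (p * conj_sum p \<Delta> (Suc r)))"
    by (intro sums_add sums_mult)
  moreover have "a * ?f m + b * ?g m = U (Suc m) - U m" for m
  proof -
    define X Y where "X = ?i (int m)" and "Y = ?i (int (m + 2 * r + 2))"
    have 1: "?i (int m - 1) = (1 - p ^ m) * X" "?i (int (m + 2 * r + 1)) = (1 - p ^ (m + 2 * r + 2)) * Y"
      using inv_qfact_eq[OF p, of "int m" "int m - 1"]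
        inv_qfact_eq[OF p, of "int (m + 2 * r + 2)" "int (m + 2 * r + 1)"]
      unfolding power_int_of_nat X_def Y_def by (simp_all del: inv_qfact_nat)
    have 2: "U (Suc m) = V (Suc (m + r)) * (X * Y)"
      unfolding U_def X_def Y_def by (simp del: inv_qfact_nat)
    have "a * ?f m + b * ?g m =
        p ^ m * \<Delta> (m + r) * (a * (1 - p ^ (m + 2 * r + 2)) + b * (1 - p ^ m)) * (X * Y)"
      unfolding 1 X_def[symmetric] Y_def[symmetric] by algebra
    also have "\<dots> = U (Suc m) - U m"
      unfolding 2 step unfolding U_def 1 X_def[symmetric] Y_def[symmetric] by algebra
    finally show ?thesis .
  qed
  moreover have "(\<lambda>m. U (Suc m) - U m) sums (L * (1 / qpoch_inf p p * (1 / qpoch_inf p p)) - U 0)"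
  proof (rule telescope_sums)
    have i1: "(\<lambda>m. ?i (int m - 1)) \<longlonglongrightarrow> 1 / qpoch_inf p p"
      using inv_qfact_tendsto[OF p, of "- 1"] by simp
    have i2: "(\<lambda>m. ?i (int (m + 2 * r + 1))) \<longlonglongrightarrow> 1 / qpoch_inf p p"
      using inv_qfact_tendsto[OF p, of "int (2 * r + 1)"] by (simp add: add_ac del: inv_qfact_nat)
    show "U \<longlonglongrightarrow> L * (1 / qpoch_inf p p * (1 / qpoch_inf p p))"
      unfolding U_def by (intro tendsto_mult i1 i2 LIMSEQ_ignore_initial_segment[OF V])
  qed
  moreover have "U 0 = 0" by (simp add: U_def)
  ultimately show ?thesis
    using sums_unique2 by (fastforce simp: power2_eq_square mult_ac)
qed


section \<open>The three recurrences and their partial theta solutions\<close>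

lemmas qpower_simps = eval_nat_numeral power_add power_mult_distrib mult_2 mult_2_right mult_ac

lemma norm_power_le_self:
  fixes q :: complex
  assumes "norm q < 1" "n > 0"
  shows "norm (q ^ n) \<le> norm q"
  using power_decreasing[of 1 n "norm q"] assms by (simp add: norm_power)

lemma norm_one_minus_power_le_2:
  fixes q :: complex
  assumes "norm q < 1"
  shows "norm (1 - q ^ n) \<le> 2"
proof -
  have "norm (q ^ n) \<le> 1" using assms by (simp add: norm_power power_le_one)
  then show ?thesis using norm_triangle_ineq4[of 1 "q ^ n"] by simp
qed

text \<open>A positive exponent keeps the argument in the unit disc, where one bound holds for all
  \<open>r\<close>. The unit \<open>s\<close> covers the signs 1 and -1 that occur.\<close>

lemma scaled_partial_theta_bounded:
  assumes q: "norm q < 1" and p: "norm p < 1" and e: "\<And>r. e r > 0" and s: "norm s = 1"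
  obtains B where "\<And>r. norm (L * partial_theta p (s * q ^ e r)) \<le> B"
proof -
  obtain C where C: "\<And>y. norm y \<le> 1 \<Longrightarrow> norm (partial_theta p y) \<le> C"
    using partial_theta_bounded[OF p] by blast
  have "norm (L * partial_theta p (s * q ^ e r)) \<le> norm L * C" for r
    using norm_power_le_self[OF q e[of r]] q s
    by (auto simp: norm_mult intro!: mult_left_mono C)
  then show ?thesis by (rule that)
qed

text \<open>Telescoping with \<open>a = 1\<close>, \<open>b = q^(2r+2)\<close> and \<open>V\<close>
  equal to the weights gives \<open>f r = L - q^(2r+3) * f (Suc r)\<close>, which is the functional
  equation of the partial theta function to base \<open>q^2\<close> at
  \<open>y = -q^(2r+3)\<close>.\<close>

lemma conj_sum_L9:
  assumes q: "norm q < 1"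
  shows "conj_sum q (\<lambda>n. qpoch (q ^ 2) (q ^ 2) n) r =
    qpoch_inf (q ^ 2) (q ^ 2) / qpoch_inf q q ^ 2 * partial_theta (q ^ 2) ((-1) * q ^ (2 * r + 3))"
proof -
  let ?\<Delta> = "\<lambda>n. qpoch (q ^ 2) (q ^ 2) n"
  define L where "L = qpoch_inf (q ^ 2) (q ^ 2) / qpoch_inf q q ^ 2"
  note q2 = norm_square_less_1[OF q]
  obtain B where B: "\<And>n. norm (?\<Delta> n) \<le> B" using qpoch_bounded[OF q2] by blast
  obtain C where C: "\<And>r. norm (conj_sum q ?\<Delta> r) \<le> C"
    using conj_sum_bounded[OF q, of ?\<Delta> B] B by blast
  obtain C' where C': "\<And>r. norm (L * partial_theta (q ^ 2) ((-1) * q ^ (2 * r + 3))) \<le> C'"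
    using scaled_partial_theta_bounded[OF q q2, of "\<lambda>r. 2 * r + 3" "-1" L] by auto
  show ?thesis
    unfolding L_def[symmetric]
  proof (rule contraction_recurrence_unique[where t = "norm q" and c = "\<lambda>r. - (q ^ (2 * r + 3))" and A = "\<lambda>_. L"
        and f = "conj_sum q ?\<Delta>", OF _ q _ C _ C'])
    fix r
    show "norm (- (q ^ (2 * r + 3))) \<le> norm q" using norm_power_le_self[OF q, of "2 * r + 3"] by simp
    have A: "1 * conj_sum q ?\<Delta> r + q ^ (2 * r + 2) * q * conj_sum q ?\<Delta> (Suc r) = L"
      unfolding L_def
    proof (rule conj_sum_telescope[OF q B _ qpoch_tendsto[OF q2]])
      fix m
      define Q R where "Q = q ^ m" and "R = q ^ r"
      have e: "q ^ m = Q" "q ^ (m + 2 * r + 2) = Q * R ^ 2 * q ^ 2" "(q ^ 2) ^ (m + r) = (Q * R) ^ 2"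
        "q ^ (2 * r + 2) = R ^ 2 * q ^ 2"
        by (simp_all add: Q_def R_def qpower_simps)
      show "q ^ m * ?\<Delta> (m + r) * (1 * (1 - q ^ (m + 2 * r + 2)) + q ^ (2 * r + 2) * (1 - q ^ m)) =
          ?\<Delta> (Suc (m + r)) - ?\<Delta> (m + r) * (1 - q ^ m) * (1 - q ^ (m + 2 * r + 2))"
        unfolding qpoch_Suc e by algebra
    qed
    define R where "R = q ^ r"
    have eR: "q ^ (2 * r + 2) * q = R ^ 2 * q ^ 3" "q ^ (2 * r + 3) = R ^ 2 * q ^ 3"
      "q ^ (2 * Suc r + 3) = R ^ 2 * q ^ 5"
      by (simp_all add: R_def qpower_simps)
    show "conj_sum q ?\<Delta> r = L + - (q ^ (2 * r + 3)) * conj_sum q ?\<Delta> (Suc r)"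
      using A[unfolded eR(1), folded eq_diff_eq] unfolding eR by simp
    have "(-1) * (R ^ 2 * q ^ 3) * q ^ 2 = (-1) * (R ^ 2 * q ^ 5)" by algebra
    then have pt: "partial_theta (q ^ 2) ((-1) * (R ^ 2 * q ^ 3)) =
        1 + (-1) * (R ^ 2 * q ^ 3) * partial_theta (q ^ 2) ((-1) * (R ^ 2 * q ^ 5))"
      using partial_theta_rec[OF q2, of "(-1) * (R ^ 2 * q ^ 3)"] by metis
    show "L * partial_theta (q ^ 2) ((-1) * q ^ (2 * r + 3)) =
        L + - (q ^ (2 * r + 3)) * (L * partial_theta (q ^ 2) ((-1) * q ^ (2 * Suc r + 3)))"
      unfolding eR pt by algebra
  qed simp
qed

text \<open>The factor \<open>1 - q^(2r+1)\<close> is included because only then does the telescoped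
  relation become a recurrence with coefficient \<open>q^(4r+5)\<close>. This is two steps of the
  functional equation to base \<open>q\<close> at \<open>y = q^(2r+2)\<close>, since
  \<open>y * (y * q) = q^(4r+5)\<close>.\<close>

lemma conj_sum_L7:
  assumes q: "norm q < 1"
  shows "(1 - q ^ (2 * r + 1)) * conj_sum (q ^ 2) (\<lambda>n. qpoch q q (2 * n)) r =
    qpoch_inf q q / qpoch_inf (q ^ 2) (q ^ 2) ^ 2 * partial_theta q (1 * q ^ (2 * r + 2))"
proof -
  let ?\<Delta> = "\<lambda>n. qpoch q q (2 * n)"
  define L where "L = qpoch_inf q q / qpoch_inf (q ^ 2) (q ^ 2) ^ 2"
  note q2 = norm_square_less_1[OF q]
  obtain B where "\<And>n. norm (qpoch q q n) \<le> B" using qpoch_bounded[OF q] by blast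
  then have B: "norm (?\<Delta> n) \<le> B" for n by blast
  obtain C where C: "\<And>r. norm (conj_sum (q ^ 2) ?\<Delta> r) \<le> C"
    using conj_sum_bounded[OF q2, of ?\<Delta> B] B by blast
  have D: "norm ((1 - q ^ (2 * r + 1)) * conj_sum (q ^ 2) ?\<Delta> r) \<le> 2 * C" for r
    unfolding norm_mult by (intro mult_mono norm_one_minus_power_le_2 q C) auto
  obtain C' where C': "\<And>r. norm (L * partial_theta q (1 * q ^ (2 * r + 2))) \<le> C'"
    using scaled_partial_theta_bounded[OF q q, of "\<lambda>r. 2 * r + 2" 1 L] by auto
  have lim: "?\<Delta> \<longlonglongrightarrow> qpoch_inf q q"
    using LIMSEQ_subseq_LIMSEQ[OF qpoch_tendsto[OF q], of "\<lambda>n. 2 * n" q]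
    by (simp add: strict_mono_def o_def)
  show ?thesis
    unfolding L_def[symmetric]
  proof (rule contraction_recurrence_unique[where t = "norm q" and c = "\<lambda>r. q ^ (4 * r + 5)"
        and A = "\<lambda>r. L * (1 + q ^ (2 * r + 2))"
        and f = "\<lambda>r. (1 - q ^ (2 * r + 1)) * conj_sum (q ^ 2) ?\<Delta> r", OF _ q _ D _ C'])
    fix r
    show "norm (q ^ (4 * r + 5)) \<le> norm q" using norm_power_le_self[OF q, of "4 * r + 5"] by simp
    define R where "R = q ^ r"
    have eR: "q ^ (2 * r + 1) = R ^ 2 * q" "q ^ (2 * Suc r + 1) = R ^ 2 * q ^ 3" "q ^ (4 * r + 5) = R ^ 4 * q ^ 5"
      "q ^ (2 * r + 2) = R ^ 2 * q ^ 2" "q ^ (2 * Suc r + 2) = R ^ 2 * q ^ 4"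
      by (simp_all add: R_def qpower_simps)
    have "(1 - R ^ 2 * q) * conj_sum (q ^ 2) ?\<Delta> r +
        (- (R ^ 4 * q ^ 3 * (1 - R ^ 2 * q ^ 3))) * q ^ 2 * conj_sum (q ^ 2) ?\<Delta> (Suc r) =
        (1 + R ^ 2 * q ^ 2) * qpoch_inf q q / qpoch_inf (q ^ 2) (q ^ 2) ^ 2"
    \<comment> \<open>For fixed \<open>r\<close> the factor \<open>1 + q^(2r+2)\<close> is a
      constant; it supplies the inhomogeneous term \<open>1 + y\<close> of the doubled functional
      equation.\<close>
    proof (rule conj_sum_telescope[where V = "\<lambda>n. (1 + R ^ 2 * q ^ 2) * ?\<Delta> n", OF q2 B _ tendsto_mult_left[OF lim]])
      fix m
      define Q where "Q = q ^ m"
      have e: "(q ^ 2) ^ m = Q ^ 2" "(q ^ 2) ^ (m + 2 * r + 2) = Q ^ 2 * R ^ 4 * q ^ 4"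
        by (simp_all add: Q_def R_def qpower_simps)
      have s: "?\<Delta> (Suc (m + r)) = ?\<Delta> (m + r) * (1 - Q ^ 2 * R ^ 2 * q) * (1 - Q ^ 2 * R ^ 2 * q ^ 2)"
        by (simp add: qpoch_Suc Q_def R_def qpower_simps)
      show "(q ^ 2) ^ m * ?\<Delta> (m + r) * ((1 - R ^ 2 * q) * (1 - (q ^ 2) ^ (m + 2 * r + 2)) +
            (- (R ^ 4 * q ^ 3 * (1 - R ^ 2 * q ^ 3))) * (1 - (q ^ 2) ^ m)) =
          (1 + R ^ 2 * q ^ 2) * ?\<Delta> (Suc (m + r)) -
          (1 + R ^ 2 * q ^ 2) * ?\<Delta> (m + r) * (1 - (q ^ 2) ^ m) * (1 - (q ^ 2) ^ (m + 2 * r + 2))"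
        unfolding s e by algebra
    qed
    then have "(1 - R ^ 2 * q) * conj_sum (q ^ 2) ?\<Delta> r +
        (- (R ^ 4 * q ^ 3 * (1 - R ^ 2 * q ^ 3))) * q ^ 2 * conj_sum (q ^ 2) ?\<Delta> (Suc r) =
        L * (1 + R ^ 2 * q ^ 2)" unfolding L_def by (simp add: mult_ac)
    from this[folded eq_diff_eq]
    show "(1 - q ^ (2 * r + 1)) * conj_sum (q ^ 2) ?\<Delta> r = L * (1 + q ^ (2 * r + 2)) +
        q ^ (4 * r + 5) * ((1 - q ^ (2 * Suc r + 1)) * conj_sum (q ^ 2) ?\<Delta> (Suc r))"
      unfolding eR by (rule trans) algebra
    \<comment> \<open>The functional equation is applied twice because \<open>r -> r + 1\<close>
      multiplies the argument by \<open>q^2\<close> while the base is \<open>q\<close>.\<close>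
    have "partial_theta q (R ^ 2 * q ^ 2) =
        1 + R ^ 2 * q ^ 2 * (1 + R ^ 2 * q ^ 2 * q * partial_theta q (R ^ 2 * q ^ 2 * q * q))"
      using partial_theta_rec[OF q] by metis
    also have "R ^ 2 * q ^ 2 * q * q = R ^ 2 * q ^ 4" by algebra
    finally have pt: "partial_theta q (R ^ 2 * q ^ 2) =
        1 + R ^ 2 * q ^ 2 * (1 + R ^ 2 * q ^ 2 * q * partial_theta q (R ^ 2 * q ^ 4))" .
    show "L * partial_theta q (1 * q ^ (2 * r + 2)) = L * (1 + q ^ (2 * r + 2)) +
        q ^ (4 * r + 5) * (L * partial_theta q (1 * q ^ (2 * Suc r + 2)))"
      unfolding eR mult_1_left pt by algebra
  qed simp
qed

text \<open>The weights have unequal denominators \<open>(-q;q^2)_n (-q;q^2)_(n+1)\<close>;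
  telescoping succeeds with \<open>V\<close> having the symmetric denominator
  \<open>(-q;q^2)_n^2\<close>. The result is the functional equation to base \<open>q^2\<close> at
  \<open>y = q^(2r+3)\<close>.\<close>

lemma conj_sum_L12:
  assumes q: "norm q < 1"
  shows "(1 - q ^ (2 * r + 1)) * conj_sum (q ^ 2) (\<lambda>n. qpoch (q ^ 2) (q ^ 2) (2 * n) /
      (qpoch (- q) (q ^ 2) n * qpoch (- q) (q ^ 2) (n + 1))) r =
    qpoch_inf (q ^ 2) (q ^ 2) / qpoch_inf (- q) (q ^ 2) ^ 2 / qpoch_inf (q ^ 2) (q ^ 2) ^ 2 *
    partial_theta (q ^ 2) (1 * q ^ (2 * r + 3))"
proof -
  let ?\<Delta> = "\<lambda>n. qpoch (q ^ 2) (q ^ 2) (2 * n) / (qpoch (- q) (q ^ 2) n * qpoch (- q) (q ^ 2) (n + 1))"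
    and ?V = "\<lambda>n. qpoch (q ^ 2) (q ^ 2) (2 * n) / qpoch (- q) (q ^ 2) n ^ 2"
   
  define L where "L = qpoch_inf (q ^ 2) (q ^ 2) / qpoch_inf (- q) (q ^ 2) ^ 2 / qpoch_inf (q ^ 2) (q ^ 2) ^ 2"
  note q2 = norm_square_less_1[OF q]
  have nz: "qpoch (- q) (q ^ 2) n \<noteq> 0" for n using qpoch_nonzero[OF q2, of "- q"] q by simp
  have nzi: "qpoch_inf (- q) (q ^ 2) \<noteq> 0" using qpoch_inf_nonzero[OF q2, of "- q"] q by simp
  have lim0: "(\<lambda>n. qpoch (q ^ 2) (q ^ 2) (2 * n)) \<longlonglongrightarrow> qpoch_inf (q ^ 2) (q ^ 2)"
    using LIMSEQ_subseq_LIMSEQ[OF qpoch_tendsto[OF q2], of "\<lambda>n. 2 * n" "q ^ 2"]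
    by (simp add: strict_mono_def o_def)
  have lim: "?V \<longlonglongrightarrow> qpoch_inf (q ^ 2) (q ^ 2) / qpoch_inf (- q) (q ^ 2) ^ 2"
    by (intro tendsto_intros lim0 qpoch_tendsto q2) (use nzi in simp)
  have "?\<Delta> \<longlonglongrightarrow> qpoch_inf (q ^ 2) (q ^ 2) / (qpoch_inf (- q) (q ^ 2) * qpoch_inf (- q) (q ^ 2))"
    by (intro tendsto_intros lim0 qpoch_tendsto q2 LIMSEQ_ignore_initial_segment) (use nzi in simp)
  then have "Bseq ?\<Delta>" by (intro convergent_imp_Bseq convergentI)
  then obtain B where B: "\<And>n. norm (?\<Delta> n) \<le> B" unfolding Bseq_def by blast
  obtain C where C: "\<And>r. norm (conj_sum (q ^ 2) ?\<Delta> r) \<le> C"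
    using conj_sum_bounded[OF q2, of ?\<Delta> B] B by blast
  have D: "norm ((1 - q ^ (2 * r + 1)) * conj_sum (q ^ 2) ?\<Delta> r) \<le> 2 * C" for r
    unfolding norm_mult[of "1 - q ^ (2 * r + 1)"] by (intro mult_mono norm_one_minus_power_le_2 q C) auto
  obtain C' where C': "\<And>r. norm (L * partial_theta (q ^ 2) (1 * q ^ (2 * r + 3))) \<le> C'"
    using scaled_partial_theta_bounded[OF q q2, of "\<lambda>r. 2 * r + 3" 1 L] by auto
  show ?thesis
    unfolding L_def[symmetric]
  proof (rule contraction_recurrence_unique[where t = "norm q" and c = "\<lambda>r. q ^ (2 * r + 3)"
        and A = "\<lambda>_. L"
        and f = "\<lambda>r. (1 - q ^ (2 * r + 1)) * conj_sum (q ^ 2) ?\<Delta> r", OF _ q _ D _ C'])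
    fix r
    show "norm (q ^ (2 * r + 3)) \<le> norm q" using norm_power_le_self[OF q, of "2 * r + 3"] by simp
    define R where "R = q ^ r"
    have eR: "q ^ (2 * r + 1) = R ^ 2 * q" "q ^ (2 * Suc r + 1) = R ^ 2 * q ^ 3" "q ^ (2 * r + 3) = R ^ 2 * q ^ 3"
      "q ^ (2 * Suc r + 3) = R ^ 2 * q ^ 5"
      by (simp_all add: R_def qpower_simps)
    have "(1 - R ^ 2 * q) * conj_sum (q ^ 2) ?\<Delta> r +
        (- (R ^ 2 * q * (1 - R ^ 2 * q ^ 3))) * q ^ 2 * conj_sum (q ^ 2) ?\<Delta> (Suc r) = L"
      unfolding L_def
    proof (rule conj_sum_telescope[where V = ?V, OF q2 B _ lim])
      fix m
      \<comment> \<open>\<open>E\<close> carries the largest denominator, so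
        \<open>?\<Delta> (m + r)\<close>, \<open>?V (m + r)\<close> and
        \<open>?V (Suc (m + r))\<close> are all polynomial multiples of it.\<close>
      define Q E where "Q = q ^ m" and "E = qpoch (q ^ 2) (q ^ 2) (2 * (m + r)) / qpoch (- q) (q ^ 2) (Suc (m + r)) ^ 2"
      have e: "(q ^ 2) ^ m = Q ^ 2" "(q ^ 2) ^ (m + 2 * r + 2) = Q ^ 2 * R ^ 4 * q ^ 4"
        by (simp_all add: Q_def R_def qpower_simps)
      have f: "qpoch (- q) (q ^ 2) (Suc (m + r)) = qpoch (- q) (q ^ 2) (m + r) * (1 + Q ^ 2 * R ^ 2 * q)"
        by (simp add: qpoch_Suc Q_def R_def qpower_simps)
      have nz1: "1 + Q ^ 2 * R ^ 2 * q \<noteq> 0" using nz[of "Suc (m + r)"] unfolding f by auto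
      have s: "?V (Suc (m + r)) = E * (1 - Q ^ 4 * R ^ 4 * q ^ 2) * (1 - Q ^ 4 * R ^ 4 * q ^ 4)"
      proof -
        have 1: "2 * Suc (m + r) = Suc (Suc (2 * (m + r)))" by simp
        have 2: "q ^ 2 * (q ^ 2) ^ (2 * (m + r)) = Q ^ 4 * R ^ 4 * q ^ 2"
          "q ^ 2 * (q ^ 2) ^ Suc (2 * (m + r)) = Q ^ 4 * R ^ 4 * q ^ 4"
          by (simp_all add: Q_def R_def qpower_simps)
        show ?thesis
          unfolding E_def 1 qpoch_Suc[of "q ^ 2"] 2 by simp
      qed
      have s2: "?V (m + r) = E * (1 + Q ^ 2 * R ^ 2 * q) ^ 2"
        unfolding E_def f using nz1 by (simp add: power_mult_distrib)
      have s3: "?\<Delta> (m + r) = E * (1 + Q ^ 2 * R ^ 2 * q)"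
        unfolding E_def Suc_eq_plus1[symmetric] f using nz1 by (simp add: power2_eq_square)
      show "(q ^ 2) ^ m * ?\<Delta> (m + r) * ((1 - R ^ 2 * q) * (1 - (q ^ 2) ^ (m + 2 * r + 2)) +
            (- (R ^ 2 * q * (1 - R ^ 2 * q ^ 3))) * (1 - (q ^ 2) ^ m)) =
          ?V (Suc (m + r)) - ?V (m + r) * (1 - (q ^ 2) ^ m) * (1 - (q ^ 2) ^ (m + 2 * r + 2))"
        unfolding s s2 s3 e by algebra
    qed
    from this[folded eq_diff_eq]
    show "(1 - q ^ (2 * r + 1)) * conj_sum (q ^ 2) ?\<Delta> r = L +
        q ^ (2 * r + 3) * ((1 - q ^ (2 * Suc r + 1)) * conj_sum (q ^ 2) ?\<Delta> (Suc r))"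
      unfolding eR by (rule trans) algebra
    have "R ^ 2 * q ^ 3 * q ^ 2 = R ^ 2 * q ^ 5" by algebra
    then have pt: "partial_theta (q ^ 2) (R ^ 2 * q ^ 3) = 1 + R ^ 2 * q ^ 3 * partial_theta (q ^ 2) (R ^ 2 * q ^ 5)"
      using partial_theta_rec[OF q2, of "R ^ 2 * q ^ 3"] by metis
    show "L * partial_theta (q ^ 2) (1 * q ^ (2 * r + 3)) = L +
        q ^ (2 * r + 3) * (L * partial_theta (q ^ 2) (1 * q ^ (2 * Suc r + 3)))"
      unfolding eR mult_1_left pt by algebra
  qed simp
qed

section \<open>The double series identities\<close>

lemma bailey_conj_sum:
  assumes p: "norm p < 1" "p \<noteq> 0" and z: "z \<noteq> 0" "1 + z \<noteq> 0" and \<Delta>: "\<And>n. norm (\<Delta> n) \<le> B"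
  shows "(\<Sum>\<^sub>\<infinity>n\<in>{1..}. qpoch z p n * qpoch (inverse z) p n / qpoch p p (2 * n) * (p ^ n * \<Delta> n)) =
    (\<Sum>\<^sub>\<infinity>r. bailey_alpha z p r * ((1 - p ^ (2 * r + 1)) * p ^ r * conj_sum p \<Delta> r))"
proof -
  have "norm (norm (p ^ n * \<Delta> n)) \<le> B * norm p ^ n" for n
    using mult_right_mono[OF \<Delta>[of n], of "norm p ^ n"] by (simp add: norm_mult norm_power mult.commute)
  then have "summable (\<lambda>n. norm (p ^ n * \<Delta> n))"
    using p by (intro summable_comparison_test'[OF summable_mult[OF summable_geometric], of "norm p" 0 _ B]) auto
  from bailey_transform[OF p z this] show ?thesis
    by (simp only: infsum_bailey_kernel_eq_conj_sum[of p \<Delta> B, OF p(1) \<Delta>])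
qed

lemma power_half_mult: "(q ^ 2) ^ (r * (r - 1) div 2) * (q ^ 2) ^ r = (q::complex) ^ (Suc r * r)"
proof -
  have "even (Suc r * r)" by simp
  then have "2 * (Suc r * r div 2) = Suc r * r" by (rule dvd_mult_div_cancel)
  then show ?thesis
    unfolding power_add[symmetric] half_mult_Suc[symmetric] unfolding power_mult[symmetric] by (simp only:)
qed

text \<open>To base \<open>q^2\<close> the kernel factor splits: \<open>1 + q^(2r+1)\<close> stays
  visible in the double series, and \<open>1 - q^(2r+1)\<close> is absorbed in the normalisation of
  \<open>conj_sum_L7\<close> and \<open>conj_sum_L12\<close>.\<close>

lemma one_minus_square_power:
  "1 - (q ^ 2) ^ (2 * r + 1) = (1 + q ^ (2 * r + 1)) * (1 - (q::complex) ^ (2 * r + 1))"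
  by (simp add: power_mult[symmetric] power_add[symmetric] mult_2 algebra_simps)

lemma infsum_partial_theta:
  assumes "norm p < 1"
  shows "(\<Sum>\<^sub>\<infinity>n. p ^ (n * (n - 1) div 2) * y ^ n) = partial_theta p y"
  unfolding partial_theta_def
  by (rule infsum_eq_suminf_if_norm_summable[OF summable_partial_theta[OF assms]])

text \<open>From \<open>n^2 + k n = 2 (n (n-1) / 2) + (k + 1) n\<close>: a square exponent is a
  triangular one to base \<open>q^2\<close> with a shifted argument.\<close>

lemma infsum_partial_theta_square:
  assumes "norm q < 1"
  shows "(\<Sum>\<^sub>\<infinity>n. s ^ n * q ^ (n ^ 2 + k * n)) = partial_theta (q ^ 2) (s * q ^ (k + 1))"
proof -
  have "s ^ n * q ^ (n ^ 2 + k * n) = (q ^ 2) ^ (n * (n - 1) div 2) * (s * q ^ (k + 1)) ^ n" for n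
  proof -
    have "even (n * (n - 1))" by (cases n) auto
    then have "2 * (n * (n - 1) div 2) = n * (n - 1)" by (rule dvd_mult_div_cancel)
    moreover have "n * (n - 1) + (k + 1) * n = n ^ 2 + k * n"
      by (cases n) (simp_all add: power2_eq_square algebra_simps)
    ultimately show ?thesis
      unfolding power_mult_distrib power_mult[symmetric]
      by (simp only: mult.left_commute[of _ "s ^ n"] power_add[symmetric])
  qed
  then show ?thesis
    using infsum_partial_theta[OF norm_square_less_1[OF assms], of "s * q ^ (k + 1)"] by simp
qed

text \<open>Bailey pair to base \<open>q^2\<close>; the weights are
  \<open>(q^2;q^2)_(2n) / (-q;q)_(2n) = (q;q)_(2n)\<close>. The inner sum over \<open>n\<close> is
  the expanded partial theta function.\<close>

lemma S_L7_eq: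
  assumes q: "norm q < 1" "q \<noteq> 0" and z: "z \<noteq> 0" "1 + z \<noteq> 0"
  shows "S_L7 z q =
    1 / ((1 + z) * qpochs_inf [q ^ 2, z, inverse z] (q ^ 2)) *
    (\<Sum>\<^sub>\<infinity>j\<in>{1::nat..}. \<Sum>\<^sub>\<infinity>n\<in>{0::nat..}.
       W (int j) z * (-1) ^ (j + 1) * (1 + q ^ (2 * j - 1)) * q ^ (j * (j - 1) + n * (n - 1) div 2 + 2 * j * n))"
proof -
  note q2 = norm_square_less_1[OF q(1)]
  have p0: "q ^ 2 \<noteq> 0" using q by simp
  let ?\<Delta> = "\<lambda>n. qpoch q q (2 * n)"
  obtain B where "\<And>n. norm (qpoch q q n) \<le> B" using qpoch_bounded[OF q(1)] by blast
  then have B: "norm (?\<Delta> n) \<le> B" for n by blast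
  have nz: "qpoch q q n \<noteq> 0" "qpoch (- q) q n \<noteq> 0" for n using qpoch_nonzero[OF q(1)] q by auto
  have nzi: "qpoch_inf q q \<noteq> 0" "qpoch_inf (- q) q \<noteq> 0" using qpoch_inf_nonzero[OF q(1)] q by auto
  define L where "L = qpoch_inf q q / qpoch_inf (q ^ 2) (q ^ 2) ^ 2"
  have "(\<Sum>\<^sub>\<infinity>n\<in>{1::nat..}. qpochs [z, inverse z] (q ^ 2) n * q ^ (2 * n) / qpoch (- q) q (2 * n)) =
    (\<Sum>\<^sub>\<infinity>n\<in>{1..}. qpoch z (q ^ 2) n * qpoch (inverse z) (q ^ 2) n / qpoch (q ^ 2) (q ^ 2) (2 * n) *
       ((q ^ 2) ^ n * ?\<Delta> n))"
  proof (rule infsum_cong)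
    fix n
    have "qpoch (q ^ 2) (q ^ 2) (2 * n) = qpoch q q (2 * n) * qpoch (- q) q (2 * n)"
      by (rule qpoch_pm[symmetric])
    then show "qpochs [z, inverse z] (q ^ 2) n * q ^ (2 * n) / qpoch (- q) q (2 * n) =
      qpoch z (q ^ 2) n * qpoch (inverse z) (q ^ 2) n / qpoch (q ^ 2) (q ^ 2) (2 * n) * ((q ^ 2) ^ n * ?\<Delta> n)"
      using nz[of "2 * n"] by (simp add: qpochs_def power_mult)
  qed
  also have "\<dots> = (\<Sum>\<^sub>\<infinity>r. bailey_alpha z (q ^ 2) r *
      ((1 - (q ^ 2) ^ (2 * r + 1)) * (q ^ 2) ^ r * conj_sum (q ^ 2) ?\<Delta> r))"
    by (rule bailey_conj_sum[OF q2 p0 z B])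
  also have "\<dots> = (\<Sum>\<^sub>\<infinity>r. L / (1 + z) * (W (int (Suc r)) z * (-1) ^ r * (1 + q ^ (2 * r + 1)) *
       q ^ (Suc r * r) * partial_theta q (q ^ (2 * r + 2))))"
  proof (rule infsum_cong)
    fix r
    have "bailey_alpha z (q ^ 2) r * ((1 - (q ^ 2) ^ (2 * r + 1)) * (q ^ 2) ^ r * conj_sum (q ^ 2) ?\<Delta> r) =
        W (int (Suc r)) z / (1 + z) * (-1) ^ r * (1 + q ^ (2 * r + 1)) *
        ((q ^ 2) ^ (r * (r - 1) div 2) * (q ^ 2) ^ r) * ((1 - q ^ (2 * r + 1)) * conj_sum (q ^ 2) ?\<Delta> r)"
      unfolding bailey_alpha_def one_minus_square_power by (simp only: mult_ac)
    then show "bailey_alpha z (q ^ 2) r * ((1 - (q ^ 2) ^ (2 * r + 1)) * (q ^ 2) ^ r * conj_sum (q ^ 2) ?\<Delta> r) =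
      L / (1 + z) * (W (int (Suc r)) z * (-1) ^ r * (1 + q ^ (2 * r + 1)) * q ^ (Suc r * r) *
        partial_theta q (q ^ (2 * r + 2)))"
      unfolding power_half_mult conj_sum_L7[OF q(1)] L_def[symmetric] mult_1_left by (simp add: mult_ac)
  qed
  also have "\<dots> = L / (1 + z) * (\<Sum>\<^sub>\<infinity>r. W (int (Suc r)) z * (-1) ^ r * (1 + q ^ (2 * r + 1)) *
       q ^ (Suc r * r) * partial_theta q (q ^ (2 * r + 2)))"
    by (rule infsum_cmult_right')
  also have "(\<Sum>\<^sub>\<infinity>r. W (int (Suc r)) z * (-1) ^ r * (1 + q ^ (2 * r + 1)) *
       q ^ (Suc r * r) * partial_theta q (q ^ (2 * r + 2))) =
    (\<Sum>\<^sub>\<infinity>j\<in>{1::nat..}. \<Sum>\<^sub>\<infinity>n\<in>{0::nat..}.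
       W (int j) z * (-1) ^ (j + 1) * (1 + q ^ (2 * j - 1)) * q ^ (j * (j - 1) + n * (n - 1) div 2 + 2 * j * n))"
    unfolding infsum_from_1
  proof (rule infsum_cong)
    fix r
    have e: "2 * Suc r + 1 = 2 * r + 3" by simp
    have "(\<Sum>\<^sub>\<infinity>n\<in>{0::nat..}. W (int (Suc r)) z * (-1) ^ (Suc r + 1) * (1 + q ^ (2 * Suc r - 1)) *
        q ^ (Suc r * (Suc r - 1) + n * (n - 1) div 2 + 2 * Suc r * n)) =
      (\<Sum>\<^sub>\<infinity>n. W (int (Suc r)) z * (-1) ^ r * (1 + q ^ (2 * r + 1)) * q ^ (Suc r * r) *
        (q ^ (n * (n - 1) div 2) * (q ^ (2 * r + 2)) ^ n))"
    proof (rule infsum_cong_neutral)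
      fix n
      have "(2 * r + 2) * n = 2 * Suc r * n" by simp
      then have e: "(q ^ (2 * r + 2)) ^ n = q ^ (2 * Suc r * n)" by (simp only: power_mult[symmetric])
      have e': "2 * Suc r - 1 = 2 * r + 1" "Suc r - 1 = r" "(-1) ^ (Suc r + 1) = ((-1) ^ r :: complex)" by simp_all
      show "W (int (Suc r)) z * (-1) ^ (Suc r + 1) * (1 + q ^ (2 * Suc r - 1)) *
          q ^ (Suc r * (Suc r - 1) + n * (n - 1) div 2 + 2 * Suc r * n) =
        W (int (Suc r)) z * (-1) ^ r * (1 + q ^ (2 * r + 1)) * q ^ (Suc r * r) *
          (q ^ (n * (n - 1) div 2) * (q ^ (2 * r + 2)) ^ n)"
        unfolding e e' power_add[of q "_ + _"] power_add[of q "Suc r * r"] by (simp only: mult.assoc)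
    qed auto
    then show "W (int (Suc r)) z * (-1) ^ r * (1 + q ^ (2 * r + 1)) * q ^ (Suc r * r) *
        partial_theta q (q ^ (2 * r + 2)) =
      (\<Sum>\<^sub>\<infinity>n\<in>{0::nat..}. W (int (Suc r)) z * (-1) ^ (Suc r + 1) * (1 + q ^ (2 * Suc r - 1)) *
        q ^ (Suc r * (Suc r - 1) + n * (n - 1) div 2 + 2 * Suc r * n))"
      unfolding infsum_cmult_right' infsum_partial_theta[OF q(1)] by (rule sym)
  qed
  finally have *: "S_L7 z q = qpoch_inf (- q) q / qpochs_inf [z, inverse z] (q ^ 2) * (L / (1 + z) * \<dots>)"
    unfolding S_L7_def by simp
  \<comment> \<open>By \<open>(q;q)_\<infinity> (-q;q)_\<infinity> = (q^2;q^2)_\<infinity>\<close>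
    one of the two factors in the denominator of \<open>L\<close> cancels.\<close>
  have "qpoch_inf (- q) q / qpochs_inf [z, inverse z] (q ^ 2) * (L / (1 + z)) =
      1 / ((1 + z) * qpochs_inf [q ^ 2, z, inverse z] (q ^ 2))"
  proof -
    have "qpoch_inf (q ^ 2) (q ^ 2) = qpoch_inf q q * qpoch_inf (- q) q"
      by (rule qpoch_inf_pm[OF q(1), symmetric])
    then show ?thesis
      using nzi unfolding L_def by (simp add: qpochs_inf_def power2_eq_square[of "_ * _"])
  qed
  then show ?thesis unfolding * mult.assoc[symmetric] by (simp only:)
qed

text \<open>Base \<open>q\<close>, with weights \<open>(q;q)_(2n) / (q;q^2)_n = (q^2;q^2)_n\<close>;
  the sign \<open>(-1)^n\<close> in the double series comes from the negative argument of the
  partial theta function.\<close>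

lemma S_L9_eq:
  assumes q: "norm q < 1" "q \<noteq> 0" and z: "z \<noteq> 0" "1 + z \<noteq> 0"
  shows "S_L9 z q =
    1 / ((1 + z) * qpochs_inf [q, z, inverse z] q) *
    (\<Sum>\<^sub>\<infinity>j\<in>{1::nat..}. \<Sum>\<^sub>\<infinity>n\<in>{0::nat..}.
       W (int j) z * (-1) ^ (j + n + 1) * (1 - q ^ (2 * j - 1)) * q ^ (j * (j - 1) div 2 + n ^ 2 + 2 * j * n))"
proof -
  note q2 = norm_square_less_1[OF q(1)]
  let ?\<Delta> = "\<lambda>n. qpoch (q ^ 2) (q ^ 2) n"
  obtain B where B: "\<And>n. norm (?\<Delta> n) \<le> B" using qpoch_bounded[OF q2] by blast
  have nz: "qpoch q (q ^ 2) n \<noteq> 0" "?\<Delta> n \<noteq> 0" for n using qpoch_nonzero[OF q2] q q2 by auto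
  have nzi: "qpoch_inf q (q ^ 2) \<noteq> 0" "qpoch_inf (q ^ 2) (q ^ 2) \<noteq> 0" using qpoch_inf_nonzero[OF q2] q q2 by auto
  define L where "L = qpoch_inf (q ^ 2) (q ^ 2) / qpoch_inf q q ^ 2"
  have "(\<Sum>\<^sub>\<infinity>n\<in>{1::nat..}. qpochs [z, inverse z] q n * q ^ n / qpoch q (q ^ 2) n) =
    (\<Sum>\<^sub>\<infinity>n\<in>{1..}. qpoch z q n * qpoch (inverse z) q n / qpoch q q (2 * n) * (q ^ n * ?\<Delta> n))"
  proof (rule infsum_cong)
    fix n
    have "qpoch q q (2 * n) = qpoch q (q ^ 2) n * ?\<Delta> n"
      unfolding qpoch_even_odd by (simp add: power2_eq_square)
    then show "qpochs [z, inverse z] q n * q ^ n / qpoch q (q ^ 2) n =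
        qpoch z q n * qpoch (inverse z) q n / qpoch q q (2 * n) * (q ^ n * ?\<Delta> n)"
      using nz[of n] by (simp add: qpochs_def)
  qed
  also have "\<dots> = (\<Sum>\<^sub>\<infinity>r. bailey_alpha z q r * ((1 - q ^ (2 * r + 1)) * q ^ r * conj_sum q ?\<Delta> r))"
    by (rule bailey_conj_sum[OF q z B])
  also have "\<dots> = (\<Sum>\<^sub>\<infinity>r. L / (1 + z) * (W (int (Suc r)) z * (-1) ^ r * (1 - q ^ (2 * r + 1)) *
       q ^ (Suc r * r div 2) * partial_theta (q ^ 2) ((-1) * q ^ (2 * r + 3))))"
  proof (rule infsum_cong)
    fix r
    show "bailey_alpha z q r * ((1 - q ^ (2 * r + 1)) * q ^ r * conj_sum q ?\<Delta> r) =
      L / (1 + z) * (W (int (Suc r)) z * (-1) ^ r * (1 - q ^ (2 * r + 1)) *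
       q ^ (Suc r * r div 2) * partial_theta (q ^ 2) ((-1) * q ^ (2 * r + 3)))"
      unfolding bailey_alpha_def conj_sum_L9[OF q(1)] L_def[symmetric] half_mult_Suc power_add
      by (simp add: mult_ac)
  qed
  also have "\<dots> = L / (1 + z) * (\<Sum>\<^sub>\<infinity>r. W (int (Suc r)) z * (-1) ^ r * (1 - q ^ (2 * r + 1)) *
       q ^ (Suc r * r div 2) * partial_theta (q ^ 2) ((-1) * q ^ (2 * r + 3)))"
    by (rule infsum_cmult_right')
  also have "(\<Sum>\<^sub>\<infinity>r. W (int (Suc r)) z * (-1) ^ r * (1 - q ^ (2 * r + 1)) *
       q ^ (Suc r * r div 2) * partial_theta (q ^ 2) ((-1) * q ^ (2 * r + 3))) =
    (\<Sum>\<^sub>\<infinity>j\<in>{1::nat..}. \<Sum>\<^sub>\<infinity>n\<in>{0::nat..}.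
       W (int j) z * (-1) ^ (j + n + 1) * (1 - q ^ (2 * j - 1)) * q ^ (j * (j - 1) div 2 + n ^ 2 + 2 * j * n))"
    unfolding infsum_from_1
  proof (rule infsum_cong)
    fix r
    have e: "2 * Suc r + 1 = 2 * r + 3" by simp
    have "(\<Sum>\<^sub>\<infinity>n\<in>{0::nat..}. W (int (Suc r)) z * (-1) ^ (Suc r + n + 1) * (1 - q ^ (2 * Suc r - 1)) *
        q ^ (Suc r * (Suc r - 1) div 2 + n ^ 2 + 2 * Suc r * n)) =
      (\<Sum>\<^sub>\<infinity>n. W (int (Suc r)) z * (-1) ^ r * (1 - q ^ (2 * r + 1)) * q ^ (Suc r * r div 2) *
        ((-1) ^ n * q ^ (n ^ 2 + 2 * Suc r * n)))"
      by (rule infsum_cong_neutral) (auto simp: power_add)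
    then show "W (int (Suc r)) z * (-1) ^ r * (1 - q ^ (2 * r + 1)) * q ^ (Suc r * r div 2) *
        partial_theta (q ^ 2) ((-1) * q ^ (2 * r + 3)) =
      (\<Sum>\<^sub>\<infinity>n\<in>{0::nat..}. W (int (Suc r)) z * (-1) ^ (Suc r + n + 1) * (1 - q ^ (2 * Suc r - 1)) *
        q ^ (Suc r * (Suc r - 1) div 2 + n ^ 2 + 2 * Suc r * n))"
      unfolding infsum_cmult_right' infsum_partial_theta_square[OF q(1)] e mult_1_left by (rule sym)
  qed
  finally have *: "S_L9 z q = qpoch_inf q (q ^ 2) / qpochs_inf [z, inverse z] q * (L / (1 + z) * \<dots>)"
    unfolding S_L9_def by simp
  have "qpoch_inf q (q ^ 2) / qpochs_inf [z, inverse z] q * (L / (1 + z)) =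
      1 / ((1 + z) * qpochs_inf [q, z, inverse z] q)"
  proof -
    have "qpoch_inf q q = qpoch_inf q (q ^ 2) * qpoch_inf (q ^ 2) (q ^ 2)"
      using qpoch_inf_even_odd[OF q(1), of q] by (simp add: power2_eq_square)
    then show ?thesis
      using nzi unfolding L_def by (simp add: qpochs_inf_def power2_eq_square[of "_ * _"])
  qed
  then show ?thesis unfolding * mult.assoc[symmetric] by (simp only:)
qed

lemma S_L12_eq:
  assumes q: "norm q < 1" "q \<noteq> 0" and z: "z \<noteq> 0" "1 + z \<noteq> 0"
  shows "S_L12 z q =
    1 / ((1 + z) * qpochs_inf [q ^ 2, z, inverse z] (q ^ 2)) *
    (\<Sum>\<^sub>\<infinity>j\<in>{1::nat..}. \<Sum>\<^sub>\<infinity>n\<in>{0::nat..}.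
       W (int j) z * (-1) ^ (j + 1) * (1 + q ^ (2 * j - 1)) * q ^ (j * (j - 1) + n ^ 2 + 2 * j * n))"
proof -
  note q2 = norm_square_less_1[OF q(1)]
  have p0: "q ^ 2 \<noteq> 0" using q by simp
  let ?\<Delta> = "\<lambda>n. qpoch (q ^ 2) (q ^ 2) (2 * n) / (qpoch (- q) (q ^ 2) n * qpoch (- q) (q ^ 2) (n + 1))"
  obtain B1 where B1: "B1 > 0" "\<And>n. norm (qpoch (q ^ 2) (q ^ 2) n) \<le> B1" using qpoch_bounded[OF q2] by blast
  obtain B2 where B2: "B2 > 0" "\<And>n. norm (1 / qpoch (- q) (q ^ 2) n) \<le> B2"
    using inverse_qpoch_bounded[OF q2 qpoch_inf_nonzero[OF q2, of "- q"]] q by auto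
  have B: "norm (?\<Delta> n) \<le> B1 * (B2 * B2)" for n
  proof -
    have "norm (?\<Delta> n) = norm (qpoch (q ^ 2) (q ^ 2) (2 * n)) *
        (norm (1 / qpoch (- q) (q ^ 2) n) * norm (1 / qpoch (- q) (q ^ 2) (n + 1)))"
      by (simp add: norm_divide norm_mult)
    also have "\<dots> \<le> B1 * (B2 * B2)"
      using B1 B2 by (intro mult_mono) auto
    finally show ?thesis .
  qed
  have nz: "qpoch (q ^ 2) (q ^ 2) n \<noteq> 0" for n using qpoch_nonzero[OF q2 q2] by auto
  have nzi: "qpoch_inf (q ^ 2) (q ^ 2) \<noteq> 0" "qpoch_inf (- q) (q ^ 2) \<noteq> 0"
    using qpoch_inf_nonzero[OF q2] q q2 by auto
  define L where "L = qpoch_inf (q ^ 2) (q ^ 2) / qpoch_inf (- q) (q ^ 2) ^ 2 / qpoch_inf (q ^ 2) (q ^ 2) ^ 2"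
  have "(\<Sum>\<^sub>\<infinity>n\<in>{1::nat..}. qpochs [z, inverse z] (q ^ 2) n * q ^ (2 * n) /
      (qpoch (- q) (q ^ 2) n * qpoch (- q) (q ^ 2) (n + 1))) =
    (\<Sum>\<^sub>\<infinity>n\<in>{1..}. qpoch z (q ^ 2) n * qpoch (inverse z) (q ^ 2) n / qpoch (q ^ 2) (q ^ 2) (2 * n) *
       ((q ^ 2) ^ n * ?\<Delta> n))"
  proof (rule infsum_cong)
    fix n
    show "qpochs [z, inverse z] (q ^ 2) n * q ^ (2 * n) /
      (qpoch (- q) (q ^ 2) n * qpoch (- q) (q ^ 2) (n + 1)) =
      qpoch z (q ^ 2) n * qpoch (inverse z) (q ^ 2) n / qpoch (q ^ 2) (q ^ 2) (2 * n) * ((q ^ 2) ^ n * ?\<Delta> n)"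
      using nz[of "2 * n"] by (simp add: qpochs_def power_mult)
  qed
  also have "\<dots> = (\<Sum>\<^sub>\<infinity>r. bailey_alpha z (q ^ 2) r *
      ((1 - (q ^ 2) ^ (2 * r + 1)) * (q ^ 2) ^ r * conj_sum (q ^ 2) ?\<Delta> r))"
    by (rule bailey_conj_sum[OF q2 p0 z B])
  also have "\<dots> = (\<Sum>\<^sub>\<infinity>r. L / (1 + z) * (W (int (Suc r)) z * (-1) ^ r * (1 + q ^ (2 * r + 1)) *
       q ^ (Suc r * r) * partial_theta (q ^ 2) (q ^ (2 * r + 3))))"
  proof (rule infsum_cong)
    fix r
    have "bailey_alpha z (q ^ 2) r * ((1 - (q ^ 2) ^ (2 * r + 1)) * (q ^ 2) ^ r * conj_sum (q ^ 2) ?\<Delta> r) =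
        W (int (Suc r)) z / (1 + z) * (-1) ^ r * (1 + q ^ (2 * r + 1)) *
        ((q ^ 2) ^ (r * (r - 1) div 2) * (q ^ 2) ^ r) * ((1 - q ^ (2 * r + 1)) * conj_sum (q ^ 2) ?\<Delta> r)"
      unfolding bailey_alpha_def one_minus_square_power by (simp only: mult_ac)
    then show "bailey_alpha z (q ^ 2) r * ((1 - (q ^ 2) ^ (2 * r + 1)) * (q ^ 2) ^ r * conj_sum (q ^ 2) ?\<Delta> r) =
      L / (1 + z) * (W (int (Suc r)) z * (-1) ^ r * (1 + q ^ (2 * r + 1)) * q ^ (Suc r * r) *
        partial_theta (q ^ 2) (q ^ (2 * r + 3)))"
      unfolding power_half_mult conj_sum_L12[OF q(1)] L_def[symmetric] mult_1_left by (simp add: mult_ac)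
  qed
  also have "\<dots> = L / (1 + z) * (\<Sum>\<^sub>\<infinity>r. W (int (Suc r)) z * (-1) ^ r * (1 + q ^ (2 * r + 1)) *
       q ^ (Suc r * r) * partial_theta (q ^ 2) (q ^ (2 * r + 3)))"
    by (rule infsum_cmult_right')
  also have "(\<Sum>\<^sub>\<infinity>r. W (int (Suc r)) z * (-1) ^ r * (1 + q ^ (2 * r + 1)) *
       q ^ (Suc r * r) * partial_theta (q ^ 2) (q ^ (2 * r + 3))) =
    (\<Sum>\<^sub>\<infinity>j\<in>{1::nat..}. \<Sum>\<^sub>\<infinity>n\<in>{0::nat..}.
       W (int j) z * (-1) ^ (j + 1) * (1 + q ^ (2 * j - 1)) * q ^ (j * (j - 1) + n ^ 2 + 2 * j * n))"
    unfolding infsum_from_1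
  proof (rule infsum_cong)
    fix r
    have e: "2 * Suc r + 1 = 2 * r + 3" by simp
    have "(\<Sum>\<^sub>\<infinity>n\<in>{0::nat..}. W (int (Suc r)) z * (-1) ^ (Suc r + 1) * (1 + q ^ (2 * Suc r - 1)) *
        q ^ (Suc r * (Suc r - 1) + n ^ 2 + 2 * Suc r * n)) =
      (\<Sum>\<^sub>\<infinity>n. W (int (Suc r)) z * (-1) ^ r * (1 + q ^ (2 * r + 1)) * q ^ (Suc r * r) *
        (1 ^ n * q ^ (n ^ 2 + 2 * Suc r * n)))"
      by (rule infsum_cong_neutral) (auto simp: power_add)
    then show "W (int (Suc r)) z * (-1) ^ r * (1 + q ^ (2 * r + 1)) * q ^ (Suc r * r) *
        partial_theta (q ^ 2) (q ^ (2 * r + 3)) =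
      (\<Sum>\<^sub>\<infinity>n\<in>{0::nat..}. W (int (Suc r)) z * (-1) ^ (Suc r + 1) * (1 + q ^ (2 * Suc r - 1)) *
        q ^ (Suc r * (Suc r - 1) + n ^ 2 + 2 * Suc r * n))"
      unfolding infsum_cmult_right' infsum_partial_theta_square[OF q(1)] e mult_1_left by (rule sym)
  qed
  finally have *: "S_L12 z q = qpoch_inf (- q) (q ^ 2) ^ 2 / qpochs_inf [z, inverse z] (q ^ 2) * (L / (1 + z) * \<dots>)"
    unfolding S_L12_def by simp
  have "qpoch_inf (- q) (q ^ 2) ^ 2 / qpochs_inf [z, inverse z] (q ^ 2) * (L / (1 + z)) =
      1 / ((1 + z) * qpochs_inf [q ^ 2, z, inverse z] (q ^ 2))"
    using nzi unfolding L_def by (simp add: qpochs_inf_def power2_eq_square[of "qpoch_inf (q ^ 2) (q ^ 2)"])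
  then show ?thesis unfolding * mult.assoc[symmetric] by (simp only:)
qed

section \<open>The series F and G\<close>

text \<open>Summable terms tend to 0; dividing by coefficients with a nonzero limit gives
  \<open>x ^ n\<close> tending to 0. This extracts the ratio bound that the q-Gauss sum demands from
  the assumed convergence.\<close>

lemma norm_less_1_if_summable:
  fixes x :: complex
  assumes C: "C \<longlonglongrightarrow> c" "c \<noteq> 0" and s: "(\<lambda>n. norm (C n * x ^ n)) summable_on {1..}"
  shows "norm x < 1"
proof -
  have "(\<lambda>n. norm (C (Suc n) * x ^ Suc n)) summable_on UNIV"
    using s by (subst summable_on_reindex_bij_witness[of UNIV "\<lambda>n. n - 1" Suc "{1..}"]) auto
  then have "(\<lambda>n. norm (C (Suc n) * x ^ Suc n)) \<longlonglongrightarrow> 0"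
    by (intro summable_LIMSEQ_zero summable_on_imp_summable)
  then have "(\<lambda>n. C (Suc n) * x ^ Suc n) \<longlonglongrightarrow> 0"
    by (rule tendsto_norm_zero_cancel)
  then have "(\<lambda>n. C n * x ^ n) \<longlonglongrightarrow> 0"
    by (rule LIMSEQ_imp_Suc)
  then have 1: "(\<lambda>n. C n * x ^ n / C n) \<longlonglongrightarrow> 0 / c"
    using C by (intro tendsto_divide)
  have "\<forall>\<^sub>F n in sequentially. C n \<noteq> 0"
    using C tendsto_imp_eventually_ne by blast
  then have "\<forall>\<^sub>F n in sequentially. C n * x ^ n / C n = x ^ n"
    by eventually_elim simp
  with 1 have "(\<lambda>n. x ^ n) \<longlonglongrightarrow> 0"
    using Lim_transform_eventually by fastforce
  then have lim: "(\<lambda>n. norm (x ^ n)) \<longlonglongrightarrow> 0"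
    by (rule tendsto_norm_zero)
  show ?thesis
  proof (rule ccontr)
    assume "\<not> norm x < 1"
    then have "\<forall>n. 1 \<le> norm (x ^ n)" by (simp add: norm_power one_le_power)
    then have "1 \<le> (0::real)" using lim by (intro LIMSEQ_le_const) auto
    then show False by simp
  qed
qed

lemma qpoch_quotient_tendsto:
  assumes q: "norm q < 1"
  shows "(\<lambda>n. qpochs as q n / qpoch q q (2 * n)) \<longlonglongrightarrow> qpochs_inf as q / qpoch_inf q q"
proof -
  have "(\<lambda>n. qpochs as q n) \<longlonglongrightarrow> qpochs_inf as q"
    by (induction as) (auto simp: qpochs_def qpochs_inf_def intro!: tendsto_mult qpoch_tendsto q)
  moreover have "(\<lambda>n. qpoch q q (2 * n)) \<longlonglongrightarrow> qpoch_inf q q"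
    using LIMSEQ_subseq_LIMSEQ[OF qpoch_tendsto[OF q], of "\<lambda>n. 2 * n" q]
    by (simp add: strict_mono_def o_def)
  ultimately show ?thesis
    using qpoch_inf_nonzero[OF q q] by (intro tendsto_divide)
qed

lemma F2_series:
  assumes q: "norm q < 1" "q \<noteq> 0" and z: "z \<noteq> 0" "1 + z \<noteq> 0" and \<rho>: "\<rho>1 \<noteq> 0" "\<rho>2 \<noteq> 0"
    and ab: "norm (q / (\<rho>1 * \<rho>2)) < 1"
  shows "F2 \<rho>1 \<rho>2 z q =
    1 / ((1 + z) * qpochs_inf [z, inverse z, \<rho>1, \<rho>2, q / (\<rho>1 * \<rho>2)] q) *
    (\<Sum>\<^sub>\<infinity>r. W (int (Suc r)) z * (-1) ^ r * q ^ (Suc r * r div 2) *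
       (qpoch \<rho>1 q r * qpoch_inf (q ^ (r + 2) / \<rho>1) q / \<rho>1 ^ r) *
       (qpoch \<rho>2 q r * qpoch_inf (q ^ (r + 2) / \<rho>2) q / \<rho>2 ^ r) *
       (1 - q ^ (r + 1) / \<rho>1 - q ^ (r + 1) / \<rho>2 + q ^ (3 * r + 2) / \<rho>1 + q ^ (3 * r + 2) / \<rho>2 - q ^ (4 * r + 2)))"
proof -
  have Q: "qpoch_inf q q \<noteq> 0" using qpoch_inf_nonzero q by blast
  have ab': "norm (q * (1 / \<rho>1) * (1 / \<rho>2)) < 1" using ab by simp
  have "F2 \<rho>1 \<rho>2 z q = qpoch_inf q q / qpochs_inf [z, inverse z, \<rho>1, \<rho>2] q *
    (\<Sum>\<^sub>\<infinity>n\<in>{1..}. qpoch z q n * qpoch (inverse z) q n / qpoch q q (2 * n) *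
       (qrev (1 / \<rho>1) q n * qrev (1 / \<rho>2) q n * q ^ n))"
    unfolding F2_def
    by (intro arg_cong2[of _ _ _ _ "(*)"] refl infsum_cong)
       (use \<rho> in \<open>simp add: F2_term_def qpochs_def qrev_inverse power_divide power_mult_distrib mult_ac\<close>)
  then show ?thesis
    unfolding bailey_F[OF q z ab'] infsum_cmult_right'[symmetric]
    apply (elim ssubst)
    apply (rule infsum_cong)
    unfolding bailey_alpha_def half_mult_Suc power_add[of q "_ * _ div 2"]
        qrev_inverse[OF \<rho>(1)] qrev_inverse[OF \<rho>(2)] qpochs_inf_def
    using Q by (simp add: mult_ac)
qed

lemma G2_series:
  assumes q: "norm q < 1" "q \<noteq> 0" and z: "z \<noteq> 0" "1 + z \<noteq> 0" and \<rho>: "\<rho>1 \<noteq> 0" "\<rho>2 \<noteq> 0"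
    and ab: "norm (q ^ 2 / (\<rho>1 * \<rho>2)) < 1"
  shows "G2 \<rho>1 \<rho>2 z q =
    1 / ((1 + z) * qpochs_inf [z, inverse z, \<rho>1, \<rho>2, q ^ 2 / (\<rho>1 * \<rho>2)] q) *
    (\<Sum>\<^sub>\<infinity>r. W (int (Suc r)) z * (-1) ^ r * (1 - q ^ (2 * r + 1)) * q ^ (Suc r * r div 2 + r) *
       (qpoch \<rho>1 q r * qpoch_inf (q ^ (r + 2) / \<rho>1) q / \<rho>1 ^ r) *
       (qpoch \<rho>2 q r * qpoch_inf (q ^ (r + 2) / \<rho>2) q / \<rho>2 ^ r))"
proof -
  have Q: "qpoch_inf q q \<noteq> 0" using qpoch_inf_nonzero q by blast
  have ab': "norm (q ^ 2 * (1 / \<rho>1) * (1 / \<rho>2)) < 1" using ab by simp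
  have e: "(q ^ 2) ^ n = q ^ n * q ^ n" for n by (simp add: power2_eq_square power_mult_distrib)
  have "G2 \<rho>1 \<rho>2 z q = qpoch_inf q q / qpochs_inf [z, inverse z, \<rho>1, \<rho>2] q *
    (\<Sum>\<^sub>\<infinity>n\<in>{1..}. qpoch z q n * qpoch (inverse z) q n / qpoch q q (2 * n) *
       (qrev (1 / \<rho>1) q n * qrev (1 / \<rho>2) q n * (q ^ 2) ^ n))"
    unfolding G2_def
    by (intro arg_cong2[of _ _ _ _ "(*)"] refl infsum_cong)
       (use \<rho> in \<open>simp add: G2_term_def qpochs_def qrev_inverse power_divide power_mult_distrib mult_ac\<close>)
  then show ?thesis
    unfolding bailey_G[OF q z ab'] infsum_cmult_right'[symmetric]
    apply (elim ssubst)
    apply (rule infsum_cong)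
    unfolding bailey_alpha_def half_mult_Suc power_add[of q "_ + _"] power_add[of q "_ * _ div 2"] e
        qrev_inverse[OF \<rho>(1)] qrev_inverse[OF \<rho>(2)] qpochs_inf_def
    using Q by (simp add: mult_ac)
qed

lemma power_half_mult_square: "q ^ (r * (r - 1) div 2) * (q ^ (r * (r - 1) div 2) * q ^ r) = (q::complex) ^ (r ^ 2)"
proof -
  have "even (r * (r - 1))" by (cases r) auto
  then have "2 * (r * (r - 1) div 2) = r * (r - 1)" by (rule dvd_mult_div_cancel)
  moreover have "r * (r - 1) + r = r ^ 2" by (cases r) (simp_all add: power2_eq_square)
  ultimately have "r * (r - 1) div 2 + (r * (r - 1) div 2 + r) = r ^ 2" by linarith
  then show ?thesis unfolding power_add[symmetric] by simp
qed

lemma F1_series: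
  assumes q: "norm q < 1" "q \<noteq> 0" and z: "z \<noteq> 0" "1 + z \<noteq> 0" and \<rho>: "\<rho> \<noteq> 0"
  shows "F1 \<rho> z q =
    1 / ((1 + z) * qpochs_inf [z, inverse z, \<rho>] q) *
    (\<Sum>\<^sub>\<infinity>r. W (int (Suc r)) z * q ^ (r ^ 2) *
       (qpoch \<rho> q r * qpoch_inf (q ^ (r + 2) / \<rho>) q / \<rho> ^ r) *
       (1 - q ^ (r + 1) / \<rho> + q ^ (3 * r + 2) / \<rho> - q ^ (4 * r + 2)))"
proof -
  have Q: "qpoch_inf q q \<noteq> 0" using qpoch_inf_nonzero q by blast
  \<comment> \<open>The second parameter 0 stands for an infinite second numerator parameter, and
    the convergence condition becomes trivial.\<close>
  have ab': "norm (q * (1 / \<rho>) * 0) < 1" by simp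
  have "F1 \<rho> z q = qpoch_inf q q / qpochs_inf [\<rho>, z, inverse z] q *
    (\<Sum>\<^sub>\<infinity>n\<in>{1..}. qpoch z q n * qpoch (inverse z) q n / qpoch q q (2 * n) *
       (qrev (1 / \<rho>) q n * qrev 0 q n * q ^ n))"
    unfolding F1_def
  proof (intro arg_cong2[of _ _ _ _ "(*)"] refl infsum_cong)
    fix n :: nat
    have "n * (n + 1) div 2 = n * (n - 1) div 2 + n"
      using half_mult_Suc[of n] by (simp add: mult.commute)
    then show "qpochs [z, inverse z, \<rho>] q n * (-1) ^ n * q ^ (n * (n + 1) div 2) * inverse \<rho> ^ n / qpoch q q (2 * n) =
      qpoch z q n * qpoch (inverse z) q n / qpoch q q (2 * n) * (qrev (1 / \<rho>) q n * qrev 0 q n * q ^ n)"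
      unfolding qrev_inverse[OF \<rho>] by (simp add: qpochs_def qrev_zero power_add power_inverse divide_inverse mult_ac)
  qed
  then show ?thesis
    unfolding bailey_F[OF q z ab'] infsum_cmult_right'[symmetric]
    apply (elim ssubst)
    apply (rule infsum_cong)
    unfolding bailey_alpha_def qrev_inverse[OF \<rho>(1)] qrev_zero qpochs_inf_def power_half_mult_square[symmetric]
    using Q by (simp add: mult_ac)
qed

lemma G1_series:
  assumes q: "norm q < 1" "q \<noteq> 0" and z: "z \<noteq> 0" "1 + z \<noteq> 0" and \<rho>: "\<rho> \<noteq> 0"
  shows "G1 \<rho> z q =
    1 / ((1 + z) * qpochs_inf [z, inverse z, \<rho>] q) *
    (\<Sum>\<^sub>\<infinity>r. W (int (Suc r)) z * (1 - q ^ (2 * r + 1)) * (q ^ (r ^ 2) * q ^ r) *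
       (qpoch \<rho> q r * qpoch_inf (q ^ (r + 2) / \<rho>) q / \<rho> ^ r))"
proof -
  have Q: "qpoch_inf q q \<noteq> 0" using qpoch_inf_nonzero q by blast
  have ab': "norm (q ^ 2 * (1 / \<rho>) * 0) < 1" by simp
  have e: "(q ^ 2) ^ n = q ^ n * q ^ n" for n by (simp add: power2_eq_square power_mult_distrib)
  have "G1 \<rho> z q = qpoch_inf q q / qpochs_inf [\<rho>, z, inverse z] q *
    (\<Sum>\<^sub>\<infinity>n\<in>{1..}. qpoch z q n * qpoch (inverse z) q n / qpoch q q (2 * n) *
       (qrev (1 / \<rho>) q n * qrev 0 q n * (q ^ 2) ^ n))"
    unfolding G1_def
  proof (intro arg_cong2[of _ _ _ _ "(*)"] refl infsum_cong)
    fix n :: nat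
    have "n * (n + 3) = Suc n * n + n * 2" by (simp add: algebra_simps)
    then have "n * (n + 3) div 2 = Suc n * n div 2 + n" by (metis div_mult_self1 add.commute zero_neq_numeral)
    then have "n * (n + 3) div 2 = n * (n - 1) div 2 + n + n"
      unfolding half_mult_Suc .
    then show "qpochs [z, inverse z, \<rho>] q n * (-1) ^ n * q ^ (n * (n + 3) div 2) * inverse \<rho> ^ n / qpoch q q (2 * n) =
      qpoch z q n * qpoch (inverse z) q n / qpoch q q (2 * n) * (qrev (1 / \<rho>) q n * qrev 0 q n * (q ^ 2) ^ n)"
      unfolding qrev_inverse[OF \<rho>] by (simp add: e qpochs_def qrev_zero power_add power_inverse divide_inverse mult_ac)
  qed
  then show ?thesis
    unfolding bailey_G[OF q z ab'] infsum_cmult_right'[symmetric]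
    apply (elim ssubst)
    apply (rule infsum_cong)
    unfolding bailey_alpha_def qrev_inverse[OF \<rho>(1)] qrev_zero qpochs_inf_def power_half_mult_square[symmetric] e
    using Q by (simp add: mult_ac)
qed

text \<open>\<open>F2_series\<close> reindexed by \<open>j = r + 1\<close>. Its ratio condition is
  obtained from \<open>s\<close>: by \<open>nz\<close> the coefficients of the power series have a
  nonzero limit.\<close>

lemma F2_eq:
  assumes q: "norm q < 1" "q \<noteq> 0" and z: "z \<noteq> 0" "1 + z \<noteq> 0" and \<rho>: "\<rho>1 \<noteq> 0" "\<rho>2 \<noteq> 0"
    and nz: "qpochs_inf [z, inverse z, \<rho>1, \<rho>2, q / (\<rho>1 * \<rho>2)] q \<noteq> 0"
    and s: "(\<lambda>n. norm (F2_term \<rho>1 \<rho>2 z q n)) summable_on {1..}"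
  shows "F2 \<rho>1 \<rho>2 z q =
          (\<Sum>\<^sub>\<infinity>j\<in>{1::nat..}.
             W (int j) z * (-1) ^ (j + 1) * q ^ (j * (j - 1) div 2) *
             qpochs [\<rho>1, \<rho>2] q (j - 1) * qpochs_inf [q ^ (j + 1) / \<rho>1, q ^ (j + 1) / \<rho>2] q /
             ((1 + z) * \<rho>1 ^ (j - 1) * \<rho>2 ^ (j - 1) *
              qpochs_inf [z, inverse z, \<rho>1, \<rho>2, q / (\<rho>1 * \<rho>2)] q) *
             (1 - q ^ j / \<rho>1 - q ^ j / \<rho>2 + q ^ (3 * j - 1) / \<rho>1 + q ^ (3 * j - 1) / \<rho>2
              - q ^ (4 * j - 2)))"
proof -
  have nz': "qpochs_inf [z, inverse z, \<rho>1, \<rho>2] q \<noteq> 0" using nz by (simp add: qpochs_inf_def)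
  have Q: "qpoch_inf q q \<noteq> 0" using qpoch_inf_nonzero q by blast
  have ab: "norm (q / (\<rho>1 * \<rho>2)) < 1"
  proof (rule norm_less_1_if_summable[OF qpoch_quotient_tendsto[OF q(1)]])
    show "qpochs_inf [z, inverse z, \<rho>1, \<rho>2] q / qpoch_inf q q \<noteq> 0" using nz' Q by simp
    show "(\<lambda>n. norm (qpochs [z, inverse z, \<rho>1, \<rho>2] q n / qpoch q q (2 * n) * (q / (\<rho>1 * \<rho>2)) ^ n)) summable_on {1..}"
      using s by (simp add: F2_term_def)
  qed
  have e: "3 * Suc r - 1 = 3 * r + 2" "4 * Suc r - 2 = 4 * r + 2" "Suc r - 1 = r"
    "(-1) ^ (Suc r + 1) = ((-1) ^ r :: complex)" "Suc r + 1 = r + 2" "q ^ Suc r = q ^ (r + 1)" for r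
    by simp_all
  show ?thesis
    unfolding F2_series[OF q z \<rho> ab] infsum_from_1 infsum_cmult_right'[symmetric]
    unfolding e(1-4) unfolding e(5,6)
    by (rule infsum_cong) (simp add: qpochs_def qpochs_inf_def mult_ac)
qed

lemma G2_eq:
  assumes q: "norm q < 1" "q \<noteq> 0" and z: "z \<noteq> 0" "1 + z \<noteq> 0" and \<rho>: "\<rho>1 \<noteq> 0" "\<rho>2 \<noteq> 0"
    and nz: "qpochs_inf [z, inverse z, \<rho>1, \<rho>2, q ^ 2 / (\<rho>1 * \<rho>2)] q \<noteq> 0"
    and s: "(\<lambda>n. norm (G2_term \<rho>1 \<rho>2 z q n)) summable_on {1..}"
  shows "G2 \<rho>1 \<rho>2 z q =
          (\<Sum>\<^sub>\<infinity>j\<in>{1::nat..}.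
             W (int j) z * (-1) ^ (j + 1) * (1 - q ^ (2 * j - 1)) * q ^ (j * (j + 1) div 2 - 1) *
             qpochs [\<rho>1, \<rho>2] q (j - 1) * qpochs_inf [q ^ (j + 1) / \<rho>1, q ^ (j + 1) / \<rho>2] q /
             ((1 + z) * \<rho>1 ^ (j - 1) * \<rho>2 ^ (j - 1) *
              qpochs_inf [z, inverse z, \<rho>1, \<rho>2, q ^ 2 / (\<rho>1 * \<rho>2)] q))"
proof -
  have nz': "qpochs_inf [z, inverse z, \<rho>1, \<rho>2] q \<noteq> 0" using nz by (simp add: qpochs_inf_def)
  have Q: "qpoch_inf q q \<noteq> 0" using qpoch_inf_nonzero q by blast
  have ab: "norm (q ^ 2 / (\<rho>1 * \<rho>2)) < 1"
  proof (rule norm_less_1_if_summable[OF qpoch_quotient_tendsto[OF q(1)]])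
    show "qpochs_inf [z, inverse z, \<rho>1, \<rho>2] q / qpoch_inf q q \<noteq> 0" using nz' Q by simp
    show "(\<lambda>n. norm (qpochs [z, inverse z, \<rho>1, \<rho>2] q n / qpoch q q (2 * n) * (q ^ 2 / (\<rho>1 * \<rho>2)) ^ n)) summable_on {1..}"
      using s by (simp add: G2_term_def)
  qed
  have e: "2 * Suc r - 1 = 2 * r + 1" "Suc r - 1 = r"
    "(-1) ^ (Suc r + 1) = ((-1) ^ r :: complex)" "Suc r + 1 = r + 2" for r
    by simp_all
  have h: "Suc r * (Suc r + 1) div 2 - 1 = Suc r * r div 2 + r" for r
    using half_mult_Suc[of "Suc r"] by (simp only: mult.commute[of "Suc r" "Suc r + 1"] Suc_eq_plus1[symmetric] diff_Suc_1) simp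
  show ?thesis
    unfolding G2_series[OF q z \<rho> ab] infsum_from_1 infsum_cmult_right'[symmetric]
    unfolding h unfolding e(1-3) unfolding e(4)
    by (rule infsum_cong) (simp add: qpochs_def qpochs_inf_def mult_ac)
qed

lemma F1_eq:
  assumes q: "norm q < 1" "q \<noteq> 0" and z: "z \<noteq> 0" "1 + z \<noteq> 0" and \<rho>: "\<rho> \<noteq> 0"
  shows "F1 \<rho> z q =
          (\<Sum>\<^sub>\<infinity>j\<in>{1::nat..}.
             W (int j) z * q ^ ((j - 1) ^ 2) *
             qpoch \<rho> q (j - 1) * qpoch_inf (q ^ (j + 1) / \<rho>) q /
             ((1 + z) * \<rho> ^ (j - 1) * qpochs_inf [z, inverse z, \<rho>] q) *
             (1 - q ^ j / \<rho> + q ^ (3 * j - 1) / \<rho> - q ^ (4 * j - 2)))"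
proof -
  have e: "3 * Suc r - 1 = 3 * r + 2" "4 * Suc r - 2 = 4 * r + 2" "Suc r - 1 = r"
    "Suc r + 1 = r + 2" "q ^ Suc r = q ^ (r + 1)" for r
    by simp_all
  show ?thesis
    unfolding F1_series[OF q z \<rho>] infsum_from_1 infsum_cmult_right'[symmetric]
    unfolding e(1-3) unfolding e(4,5)
    by (rule infsum_cong) (simp add: qpochs_inf_def mult_ac)
qed

lemma G1_eq:
  assumes q: "norm q < 1" "q \<noteq> 0" and z: "z \<noteq> 0" "1 + z \<noteq> 0" and \<rho>: "\<rho> \<noteq> 0"
  shows "G1 \<rho> z q =
          (\<Sum>\<^sub>\<infinity>j\<in>{1::nat..}.
             W (int j) z * (1 - q ^ (2 * j - 1)) * q ^ (j * (j - 1)) *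
             qpoch \<rho> q (j - 1) * qpoch_inf (q ^ (j + 1) / \<rho>) q /
             ((1 + z) * \<rho> ^ (j - 1) * qpochs_inf [z, inverse z, \<rho>] q))"
proof -
  have e: "2 * Suc r - 1 = 2 * r + 1" "Suc r - 1 = r" "Suc r + 1 = r + 2"
    "q ^ (Suc r * r) = q ^ (r ^ 2) * q ^ r" for r
    by (simp_all add: power_add[symmetric] power2_eq_square add.commute)
  show ?thesis
    unfolding G1_series[OF q z \<rho>] infsum_from_1 infsum_cmult_right'[symmetric]
    unfolding e(1,2) unfolding e(3,4)
    by (rule infsum_cong) (simp add: qpochs_inf_def mult_ac)
qed

section \<open>Special parameter values and bilateral series\<close>

lemma qpoch_mult_tail:
  assumes "norm q < 1" "1 - a * q ^ r \<noteq> 0"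
  shows "qpoch a q r * qpoch_inf (a * q ^ Suc r) q = qpoch_inf a q / (1 - a * q ^ r)"
  using qpoch_inf_split[OF assms(1), of a "Suc r"] assms(2) by (simp add: qpoch_Suc)

lemma one_minus_power_nonzero:
  fixes q :: complex
  assumes "norm q < 1" "n > 0"
  shows "1 - q ^ n \<noteq> 0" "1 + q ^ n \<noteq> 0"
proof -
  have "norm (q ^ n) < 1" using assms by (simp add: norm_power power_less_one_iff)
  then show "1 - q ^ n \<noteq> 0" "1 + q ^ n \<noteq> 0"
    by (auto simp: add_eq_0_iff)
qed

text \<open>Base \<open>q^2\<close> with parameters \<open>q\<close> and \<open>q^2\<close>. For
  \<open>q\<close> the finite and the infinite product together miss exactly the factor
  \<open>1 - q^(2r+1)\<close>, which cancels against \<open>1 - q^(4r+2)\<close> and leaves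
  \<open>1 + q^(2r+1)\<close>; for \<open>q^2\<close> nothing is missing.\<close>

lemma S_G1_eq:
  assumes q: "norm q < 1" "q \<noteq> 0" and z: "z \<noteq> 0" "1 + z \<noteq> 0"
  shows "S_G1 z q =
          1 / ((1 + z) * qpochs_inf [z, inverse z, q] (q ^ 2)) *
          (\<Sum>\<^sub>\<infinity>j\<in>{1::nat..}.
             W (int j) z * (-1) ^ (j + 1) * (1 + q ^ (2 * j - 1)) * q ^ ((j - 1) ^ 2))"
proof -
  note q2 = norm_square_less_1[OF q(1)]
  have p0: "q ^ 2 \<noteq> 0" using q by simp
  have nz: "qpoch_inf q (q ^ 2) \<noteq> 0" "qpoch_inf (q ^ 2) (q ^ 2) \<noteq> 0"
    using qpoch_inf_nonzero[OF q2] q(1) q2 by auto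
  have r: "(q ^ 2) ^ 2 / (q * q ^ 2) = q" using q by (simp add: power2_eq_square)
  have ab: "norm ((q ^ 2) ^ 2 / (q * q ^ 2)) < 1" unfolding r by (rule q)
  have t: "W (int (Suc r)) z * (-1) ^ r * (1 - (q ^ 2) ^ (2 * r + 1)) * (q ^ 2) ^ (Suc r * r div 2 + r) *
       (qpoch q (q ^ 2) r * qpoch_inf ((q ^ 2) ^ (r + 2) / q) (q ^ 2) / q ^ r) *
       (qpoch (q ^ 2) (q ^ 2) r * qpoch_inf ((q ^ 2) ^ (r + 2) / q ^ 2) (q ^ 2) / (q ^ 2) ^ r) =
     qpoch_inf q (q ^ 2) * qpoch_inf (q ^ 2) (q ^ 2) *
     (W (int (Suc r)) z * (-1) ^ r * (1 + q ^ (2 * r + 1)) * q ^ (r ^ 2))" for r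
  proof -
    have 1: "(q ^ 2) ^ (r + 2) / q = q * (q ^ 2) ^ Suc r" "q * (q ^ 2) ^ r = q ^ (2 * r + 1)"
      "(q ^ 2) ^ (r + 2) / q ^ 2 = q ^ 2 * (q ^ 2) ^ r"
      using q by (simp_all add: power2_eq_square power_mult)
    have nz1: "1 - q ^ (2 * r + 1) \<noteq> 0" using one_minus_power_nonzero(1)[OF q(1), of "2 * r + 1"] by simp
    have 2: "qpoch q (q ^ 2) r * qpoch_inf ((q ^ 2) ^ (r + 2) / q) (q ^ 2) = qpoch_inf q (q ^ 2) / (1 - q ^ (2 * r + 1))"
      unfolding 1(1) using qpoch_mult_tail[OF q2, of q r] nz1 unfolding 1(2) by blast
    have 3: "qpoch (q ^ 2) (q ^ 2) r * qpoch_inf ((q ^ 2) ^ (r + 2) / q ^ 2) (q ^ 2) = qpoch_inf (q ^ 2) (q ^ 2)"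
      unfolding 1(3) by (rule qpoch_inf_split[OF q2, symmetric])
    have 4: "(q ^ 2) ^ (Suc r * r div 2 + r) = q ^ (r ^ 2) * q ^ r * (q ^ 2) ^ r"
      unfolding power_add half_mult_Suc power_half_mult by (simp add: power_add power2_eq_square)
    show ?thesis
      unfolding 2 3 4 one_minus_square_power using q nz1 by simp
  qed
  have "S_G1 z q = 1 / ((1 + z) * qpochs_inf [z, inverse z, q, q ^ 2, q] (q ^ 2)) *
     (qpoch_inf q (q ^ 2) * qpoch_inf (q ^ 2) (q ^ 2) *
      (\<Sum>\<^sub>\<infinity>r. W (int (Suc r)) z * (-1) ^ r * (1 + q ^ (2 * r + 1)) * q ^ (r ^ 2)))"
    unfolding S_G1_def G2_series[OF q2 p0 z q(2) p0 ab] t infsum_cmult_right' r ..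
  moreover have "2 * Suc r - 1 = 2 * r + 1" "Suc r - 1 = r" "(-1) ^ (Suc r + 1) = ((-1) ^ r :: complex)" for r
    by simp_all
  ultimately show ?thesis
    unfolding infsum_from_1 using nz by (simp add: qpochs_inf_def)
qed

lemma S_G3_eq:
  assumes q: "norm q < 1" "q \<noteq> 0" and z: "z \<noteq> 0" "1 + z \<noteq> 0"
  shows "S_G3 z q =
          1 / ((1 + z) * qpochs_inf [z, inverse z] q) *
          (\<Sum>\<^sub>\<infinity>j\<in>{1::nat..}.
             W (int j) z * (1 - q ^ (2 * j - 1)) * q ^ ((j - 1) ^ 2))"
proof -
  have nz: "qpoch_inf q q \<noteq> 0" using qpoch_inf_nonzero q by blast
  have t: "W (int (Suc r)) z * (1 - q ^ (2 * r + 1)) * (q ^ (r ^ 2) * q ^ r) *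
       (qpoch q q r * qpoch_inf (q ^ (r + 2) / q) q / q ^ r) =
     qpoch_inf q q * (W (int (Suc r)) z * (1 - q ^ (2 * r + 1)) * q ^ (r ^ 2))" for r
  proof -
    have "q ^ (r + 2) / q = q * q ^ r" using q by simp
    then have "qpoch q q r * qpoch_inf (q ^ (r + 2) / q) q = qpoch_inf q q"
      using qpoch_inf_split[OF q(1), of q r] by simp
    then show ?thesis using q by simp
  qed
  have "S_G3 z q = 1 / ((1 + z) * qpochs_inf [z, inverse z, q] q) *
     (qpoch_inf q q * (\<Sum>\<^sub>\<infinity>r. W (int (Suc r)) z * (1 - q ^ (2 * r + 1)) * q ^ (r ^ 2)))"
    unfolding S_G3_def G1_series[OF q z q(2)] t infsum_cmult_right' ..
  moreover have "2 * Suc r - 1 = 2 * r + 1" "Suc r - 1 = r" for r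
    by simp_all
  ultimately show ?thesis
    unfolding infsum_from_1 using nz by (simp add: qpochs_inf_def)
qed

text \<open>Pairs \<open>j = r + 1\<close> with \<open>j = -r\<close>, the two points exchanged by
  \<open>j -> 1 - j\<close>, under which \<open>W\<close> is invariant.\<close>

lemma infsum_int_fold:
  fixes f :: "int \<Rightarrow> complex"
  assumes "summable (\<lambda>r. norm (f (int (Suc r))))" "summable (\<lambda>r. norm (f (- int r)))"
  shows "infsum f UNIV = (\<Sum>\<^sub>\<infinity>r. f (int (Suc r)) + f (- int r))"
proof -
  have s: "(\<lambda>r. f (int (Suc r))) summable_on UNIV" "(\<lambda>r. f (- int r)) summable_on UNIV"
    using assms norm_summable_imp_summable_on by auto
  have "range (\<lambda>r. int (Suc r)) = {1..}"
  proof (intro equalityI subsetI)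
    fix j :: int assume "j \<in> {1..}"
    then have "j = int (Suc (nat (j - 1)))" by simp
    then show "j \<in> range (\<lambda>r. int (Suc r))" by blast
  qed auto
  then have 1: "(f has_sum (\<Sum>\<^sub>\<infinity>r. f (int (Suc r)))) {1..}"
    using has_sum_reindex[of "\<lambda>r. int (Suc r)" UNIV f] has_sum_infsum[OF s(1)]
    by (simp add: inj_on_def o_def)
  have "range (\<lambda>r. - int r) = {..0}"
  proof (intro equalityI subsetI)
    fix j :: int assume "j \<in> {..0}"
    then have "j = - int (nat (- j))" by simp
    then show "j \<in> range (\<lambda>r. - int r)" by blast
  qed auto
  then have 2: "(f has_sum (\<Sum>\<^sub>\<infinity>r. f (- int r))) {..0}"
    using has_sum_reindex[of "\<lambda>r. - int r" UNIV f] has_sum_infsum[OF s(2)]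
    by (simp add: inj_on_def o_def)
  have "(f has_sum ((\<Sum>\<^sub>\<infinity>r. f (int (Suc r))) + (\<Sum>\<^sub>\<infinity>r. f (- int r)))) ({1..} \<union> {..0})"
    by (rule has_sum_Un_disjoint[OF 1 2]) auto
  moreover have "{1..} \<union> {..0} = (UNIV :: int set)" by auto
  ultimately show ?thesis
    using s by (simp add: infsum_add infsumI)
qed

lemma W_reflect:
  assumes "z \<noteq> 0"
  shows "W (- int r) z = W (int (Suc r)) z"
proof -
  have "- int r - 1 = - int (Suc r)" "1 - - int r = int (Suc r)" "int (Suc r) - 1 = int r" "1 - int (Suc r) = - int r"
    by simp_all
  then show ?thesis
    using assms by (simp only: W_def power_int_minus power_int_of_nat) (simp add: field_simps)
qed

text \<open>Any bounded multiple of \<open>W\<close> times one triangular power is dominated by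
  \<open>bailey_alpha\<close>; both bilateral series are brought into this shape.\<close>

lemma summable_alpha_mult:
  assumes "norm q < 1" "z \<noteq> 0" "1 + z \<noteq> 0" and c: "\<And>r. norm (c r) \<le> K"
    and f: "\<And>r. f r = W (int (Suc r)) z * q ^ (r * (r - 1) div 2) * c r"
  shows "summable (\<lambda>r. norm (f r))"
proof (rule summable_comparison_test'[OF summable_mult2[OF summable_norm_bailey_alpha[OF assms(1,2)]]])
  fix r :: nat
  have "norm (f r) = norm (bailey_alpha z q r) * (norm (1 + z) * norm (c r))"
    using assms(3) by (simp add: f bailey_alpha_def norm_mult norm_divide norm_power)
  also have "\<dots> \<le> norm (bailey_alpha z q r) * (norm (1 + z) * K)"
    by (intro mult_left_mono c) auto
  finally show "norm (norm (f r)) \<le> norm (bailey_alpha z q r) * (norm (1 + z) * K)" by simp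
qed

text \<open>Only \<open>s^2 = -q\<close> is used about the square root: the products for
  \<open>s\<close> and \<open>-s\<close> combine to base \<open>q^2\<close> and miss the factor
  \<open>1 + x\<close>, where \<open>x = q^(2r+1)\<close>. The bilateral form then arises from
  \<open>(1 - x) / (1 + x) = 1 / (1 + x) - x / (1 + x)\<close>, whose two parts are the terms at
  \<open>j = r + 1\<close> and \<open>j = -r\<close>.\<close>

lemma S_G2_eq:
  assumes q: "norm q < 1" "q \<noteq> 0" and z: "z \<noteq> 0" "1 + z \<noteq> 0"
  shows "S_G2 z q =
          1 / ((1 + z) * qpochs_inf [z, inverse z, q] q) *
          (\<Sum>\<^sub>\<infinity>j\<in>(UNIV :: int set).
             W j z * (-1) powi (j + 1) * q powi (j * (j - 1) div 2) / (1 + q powi (2 * j - 1)))"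
proof -
  note q2 = norm_square_less_1[OF q(1)]
  define s where "s = \<i> * csqrt q"
  have s2: "s ^ 2 = - q" by (simp add: s_def power_mult_distrib)
  have s0: "s \<noteq> 0" "- s \<noteq> 0" using s2 q by auto
  have ss: "s * - s = q" using s2 by (simp add: power2_eq_square)
  have qs: "q ^ 2 / (s * - s) = q" unfolding ss using q by (simp add: power2_eq_square)
  have ab: "norm (q ^ 2 / (s * - s)) < 1" unfolding qs by (rule q)
  have nz: "qpoch_inf (- q) (q ^ 2) \<noteq> 0" using qpoch_inf_nonzero[OF q2, of "- q"] q by simp
  have t: "W (int (Suc r)) z * (-1) ^ r * (1 - q ^ (2 * r + 1)) * q ^ (Suc r * r div 2 + r) *
       (qpoch s q r * qpoch_inf (q ^ (r + 2) / s) q / s ^ r) *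
       (qpoch (- s) q r * qpoch_inf (q ^ (r + 2) / - s) q / (- s) ^ r) =
     qpoch_inf (- q) (q ^ 2) *
     (W (int (Suc r)) z * (-1) ^ r * (1 - q ^ (2 * r + 1)) * q ^ (Suc r * r div 2) / (1 + q ^ (2 * r + 1)))" for r
  proof -
    have 1: "qpoch s q r * qpoch (- s) q r = qpoch (- q) (q ^ 2) r" unfolding qpoch_pm s2 ..
    have "(q ^ (r + 2) / s) ^ 2 = - q * (q ^ 2) ^ Suc r"
      unfolding power_divide s2 using q by (simp add: power_mult_distrib power2_eq_square)
    then have 2: "qpoch_inf (q ^ (r + 2) / s) q * qpoch_inf (q ^ (r + 2) / - s) q = qpoch_inf (- q * (q ^ 2) ^ Suc r) (q ^ 2)"
      using qpoch_inf_pm[OF q(1), of "q ^ (r + 2) / s"] by simp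
    have e: "1 - - q * (q ^ 2) ^ r = 1 + q ^ (2 * r + 1)" by (simp add: power_mult)
    have 3: "qpoch (- q) (q ^ 2) r * qpoch_inf (- q * (q ^ 2) ^ Suc r) (q ^ 2) = qpoch_inf (- q) (q ^ 2) / (1 + q ^ (2 * r + 1))"
      using qpoch_mult_tail[OF q2, of "- q" r] one_minus_power_nonzero(2)[OF q(1), of "2 * r + 1"] unfolding e by simp
    have 4: "s ^ r * (- s) ^ r = q ^ r" unfolding power_mult_distrib[symmetric] ss ..
    have "W (int (Suc r)) z * (-1) ^ r * (1 - q ^ (2 * r + 1)) * q ^ (Suc r * r div 2 + r) *
       (qpoch s q r * qpoch_inf (q ^ (r + 2) / s) q / s ^ r) *
       (qpoch (- s) q r * qpoch_inf (q ^ (r + 2) / - s) q / (- s) ^ r) =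
      W (int (Suc r)) z * (-1) ^ r * (1 - q ^ (2 * r + 1)) * q ^ (Suc r * r div 2 + r) *
       ((qpoch s q r * qpoch (- s) q r) * (qpoch_inf (q ^ (r + 2) / s) q * qpoch_inf (q ^ (r + 2) / - s) q)) /
       (s ^ r * (- s) ^ r)"
      by (simp only: times_divide_eq_left times_divide_eq_right divide_divide_eq_left mult_ac)
    also have "\<dots> = qpoch_inf (- q) (q ^ 2) *
     (W (int (Suc r)) z * (-1) ^ r * (1 - q ^ (2 * r + 1)) * q ^ (Suc r * r div 2) / (1 + q ^ (2 * r + 1)))"
      unfolding 1 2 3 4 power_add[of q "_ * _ div 2"] using q by simp
    finally show ?thesis .
  qed
  have R: "qpoch_inf s q * qpoch_inf (- s) q = qpoch_inf (- q) (q ^ 2)"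
    using qpoch_inf_pm[OF q(1), of s] unfolding s2 .
  let ?g = "\<lambda>r. W (int (Suc r)) z * (-1) ^ r * (1 - q ^ (2 * r + 1)) * q ^ (Suc r * r div 2) / (1 + q ^ (2 * r + 1))"
  let ?f = "\<lambda>j. W j z * (-1) powi (j + 1) * q powi (j * (j - 1) div 2) / (1 + q powi (2 * j - 1))"
  have "S_G2 z q = 1 / ((1 + z) * qpochs_inf [z, inverse z, s, - s, q] q) * (qpoch_inf (- q) (q ^ 2) * (\<Sum>\<^sub>\<infinity>r. ?g r))"
    using G2_series[OF q z s0 ab] unfolding S_G2_def mult_minus_left s_def[symmetric] t infsum_cmult_right' qs .
  also have "qpochs_inf [z, inverse z, s, - s, q] q = qpochs_inf [z, inverse z, q] q * qpoch_inf (- q) (q ^ 2)"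
    unfolding R[symmetric] by (simp add: qpochs_inf_def)
  finally have 1: "S_G2 z q = 1 / ((1 + z) * qpochs_inf [z, inverse z, q] q) * (\<Sum>\<^sub>\<infinity>r. ?g r)"
    using nz by simp
  \<comment> \<open>Uniform in \<open>r\<close>: the denominators stay at distance at least
    \<open>1 - norm q\<close> from 0.\<close>
  have bd: "norm (1 / (1 + q ^ (2 * r + 1))) \<le> 1 / (1 - norm q)" for r
  proof -
    have "norm (q ^ (2 * r + 1)) \<le> norm q" by (rule norm_power_le_self[OF q(1)]) simp
    then have "1 - norm q \<le> norm (1 + q ^ (2 * r + 1))"
      using norm_triangle_ineq4[of "1 + q ^ (2 * r + 1)" "q ^ (2 * r + 1)"] by simp
    then show ?thesis using q by (simp add: norm_divide frac_le)
  qed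
  have pos: "?f (int (Suc r)) = W (int (Suc r)) z * (-1) ^ r * q ^ (Suc r * r div 2) * (1 / (1 + q ^ (2 * r + 1)))" for r
  proof -
    have "int (Suc r) * (int (Suc r) - 1) = int (Suc r * r)" by (simp add: algebra_simps)
    then have "int (Suc r) * (int (Suc r) - 1) div 2 = int (Suc r * r div 2)" by (simp only: zdiv_int of_nat_numeral)
    moreover have "2 * int (Suc r) - 1 = int (2 * r + 1)" "int (Suc r) + 1 = int (Suc (Suc r))" by simp_all
    ultimately show ?thesis by (simp only: power_int_of_nat) simp
  qed
  have neg: "?f (- int r) = W (int (Suc r)) z * (-1) ^ r * q ^ (Suc r * r div 2) * (- (q ^ (2 * r + 1)) * (1 / (1 + q ^ (2 * r + 1))))" for r
  proof -
    have "- int r * (- int r - 1) = int (Suc r * r)" by (simp add: algebra_simps)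
    then have 1: "- int r * (- int r - 1) div 2 = int (Suc r * r div 2)" by (simp only: zdiv_int of_nat_numeral)
    have 2: "2 * - int r - 1 = - int (2 * r + 1)" by simp
    have 3: "(-1) powi (- int r + 1) = (- ((-1) ^ r) :: complex)"
      by (subst power_int_add) (auto simp: power_int_minus minus_one_power_iff)
    have "1 + q ^ (2 * r + 1) \<noteq> 0" using one_minus_power_nonzero(2)[OF q(1), of "2 * r + 1"] by simp
    moreover have "q ^ (2 * r + 1) \<noteq> 0" using q by simp
    ultimately have 4: "1 / (1 + inverse (q ^ (2 * r + 1))) = q ^ (2 * r + 1) * (1 / (1 + q ^ (2 * r + 1)))"
      by (simp add: field_simps del: power_Suc)
    have "?f (- int r) = W (int (Suc r)) z * (- ((-1) ^ r)) * q ^ (Suc r * r div 2) * (1 / (1 + inverse (q ^ (2 * r + 1))))"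
      unfolding 1 2 3 W_reflect[OF z(1)] power_int_minus power_int_of_nat by simp
    then show ?thesis unfolding 4 by simp
  qed
  have qr: "norm (q ^ k) \<le> 1" for k using q by (simp add: norm_power power_le_one)
  have "(\<Sum>\<^sub>\<infinity>j. ?f j) = (\<Sum>\<^sub>\<infinity>r. ?f (int (Suc r)) + ?f (- int r))"
  proof (rule infsum_int_fold)
    show "summable (\<lambda>r. norm (?f (int (Suc r))))"
      unfolding pos
    proof (rule summable_alpha_mult[OF q(1) z])
      fix r
      show "W (int (Suc r)) z * (-1) ^ r * q ^ (Suc r * r div 2) * (1 / (1 + q ^ (2 * r + 1))) =
        W (int (Suc r)) z * q ^ (r * (r - 1) div 2) * ((-1) ^ r * q ^ r * (1 / (1 + q ^ (2 * r + 1))))"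
        unfolding half_mult_Suc power_add[of q "_ * _ div 2"] by (simp only: mult_ac)
      show "norm ((-1) ^ r * q ^ r * (1 / (1 + q ^ (2 * r + 1)))) \<le> 1 * 1 * (1 / (1 - norm q))"
        unfolding norm_mult[of _ "1 / _"] norm_mult[of "(-1) ^ r"]
        by (intro mult_mono bd qr) (use q in \<open>auto simp: norm_power\<close>)
    qed
    show "summable (\<lambda>r. norm (?f (- int r)))"
      unfolding neg
    proof (rule summable_alpha_mult[OF q(1) z])
      fix r
      show "W (int (Suc r)) z * (-1) ^ r * q ^ (Suc r * r div 2) * (- (q ^ (2 * r + 1)) * (1 / (1 + q ^ (2 * r + 1)))) =
        W (int (Suc r)) z * q ^ (r * (r - 1) div 2) * ((-1) ^ r * (q ^ r * - (q ^ (2 * r + 1))) * (1 / (1 + q ^ (2 * r + 1))))"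
        unfolding half_mult_Suc power_add[of q "_ * _ div 2"] by (simp only: mult_ac)
      show "norm ((-1) ^ r * (q ^ r * - (q ^ (2 * r + 1))) * (1 / (1 + q ^ (2 * r + 1)))) \<le> 1 * (1 * 1) * (1 / (1 - norm q))"
        unfolding norm_mult[of _ "1 / _"] norm_mult[of "(-1) ^ r"] norm_mult[of "q ^ r"] norm_minus_cancel
        by (intro mult_mono bd qr) (use q in \<open>auto simp: norm_power\<close>)
    qed
  qed
  also have "\<dots> = (\<Sum>\<^sub>\<infinity>r. ?g r)"
    unfolding pos neg by (rule infsum_cong) (simp add: diff_divide_distrib ring_distribs del: power_Suc)
  finally show ?thesis unfolding 1 by simp
qed

text \<open>For the parameter \<open>-q\<close> the finite and the infinite product join to
  \<open>(-q;q)_\<infinity>\<close>, which cancels the prefactor. Of the remaining bracket,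
  \<open>1 + q^r\<close> is the term at \<open>j = r + 1\<close> and
  \<open>- q^(3r+1) - q^(4r+2)\<close> the one at \<open>j = -r\<close>.\<close>

lemma S_F1_eq:
  assumes q: "norm q < 1" "q \<noteq> 0" and z: "z \<noteq> 0" "1 + z \<noteq> 0"
  shows "S_F1 z q =
          1 / ((1 + z) * qpochs_inf [z, inverse z] q) *
          (\<Sum>\<^sub>\<infinity>j\<in>(UNIV :: int set).
             W j z * (-1) powi (j + 1) * q powi (j ^ 2 - 3 * j + 2) * (1 + q powi (j - 1)))"
proof -
  have q0: "- q \<noteq> 0" using q by simp
  have nz: "qpoch_inf (- q) q \<noteq> 0" using qpoch_inf_nonzero[OF q(1), of "- q"] q by simp
  define T where "T = (\<lambda>r::nat. q ^ (r * (r - 1) div 2))"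
  have sq: "q ^ (r ^ 2) = T r * T r * q ^ r" for r
    unfolding T_def power_half_mult_square[symmetric] by (simp only: mult_ac)
  let ?g = "\<lambda>r. W (int (Suc r)) z * (-1) ^ r * (T r * T r) * (1 + q ^ r - q ^ (3 * r + 1) - q ^ (4 * r + 2))"
  let ?f = "\<lambda>j. W j z * (-1) powi (j + 1) * q powi (j ^ 2 - 3 * j + 2) * (1 + q powi (j - 1))"
  have t: "W (int (Suc r)) z * q ^ (r ^ 2) *
       (qpoch (- q) q r * qpoch_inf (q ^ (r + 2) / - q) q / (- q) ^ r) *
       (1 - q ^ (r + 1) / - q + q ^ (3 * r + 2) / - q - q ^ (4 * r + 2)) = qpoch_inf (- q) q * ?g r" for r
  proof -
    have 1: "q ^ (r + 2) / - q = - q * q ^ r" using q by simp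
    have 2: "q ^ (r + 1) / - q = - (q ^ r)" "q ^ (3 * r + 2) / - q = - (q ^ (3 * r + 1))" using q by simp_all
    have 3: "T r * T r * q ^ r / (- q) ^ r = (-1) ^ r * (T r * T r)"
      using q by (cases "even r") simp_all
    have 4: "W (int (Suc r)) z * (T r * T r * q ^ r) * (X / (- q) ^ r) * Y =
        X * (W (int (Suc r)) z * (T r * T r * q ^ r / (- q) ^ r) * Y)" for X Y by simp
    show ?thesis
      unfolding 1 2 sq qpoch_inf_split[OF q(1), of "- q" r, symmetric] 4 3 by simp
  qed
  have "S_F1 z q = 1 / ((1 + z) * qpochs_inf [z, inverse z, - q] q) * (qpoch_inf (- q) q * (\<Sum>\<^sub>\<infinity>r. ?g r))"
    unfolding S_F1_def F1_series[OF q z q0] t infsum_cmult_right' ..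
  then have 1: "S_F1 z q = 1 / ((1 + z) * qpochs_inf [z, inverse z] q) * (\<Sum>\<^sub>\<infinity>r. ?g r)"
    using nz by (simp add: qpochs_inf_def)
  have sq': "q powi (int r ^ 2 - int r) = T r * T r" for r
  proof -
    have "even (r * (r - 1))" by (cases r) auto
    then have "2 * (r * (r - 1) div 2) = r * (r - 1)" by (rule dvd_mult_div_cancel)
    moreover have "int r ^ 2 - int r = int (r * (r - 1))"
      by (cases r) (simp_all add: power2_eq_square algebra_simps)
    ultimately have "int r ^ 2 - int r = int (r * (r - 1) div 2 + r * (r - 1) div 2)"
      by (simp only: mult_2[symmetric])
    then show ?thesis unfolding T_def by (simp only: power_int_of_nat power_add)
  qed
  have pos: "?f (int (Suc r)) = W (int (Suc r)) z * (-1) ^ r * (T r * T r) * (1 + q ^ r)" for r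
  proof -
    have 1: "int (Suc r) ^ 2 - 3 * int (Suc r) + 2 = int r ^ 2 - int r" by (simp add: power2_eq_square algebra_simps)
    have 2: "int (Suc r) - 1 = int r" "int (Suc r) + 1 = int (Suc (Suc r))" by simp_all
    show ?thesis unfolding 1 2 sq' power_int_of_nat by simp
  qed
  have neg: "?f (- int r) = W (int (Suc r)) z * (-1) ^ r * (T r * T r) * (- (q ^ (3 * r + 1)) - q ^ (4 * r + 2))" for r
  proof -
    \<comment> \<open>The exponent is \<open>(j - 1)(j - 2)\<close>; at \<open>j = -r\<close> it
      exceeds its value \<open>r (r - 1)\<close> at \<open>j = r + 1\<close> by
      \<open>4r + 2\<close>.\<close>
    have 1: "(- int r) ^ 2 - 3 * - int r + 2 = (int r ^ 2 - int r) + int (4 * r + 2)" by simp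
    have 2: "- int r - 1 = - int (r + 1)" by simp
    have 3: "(-1) powi (- int r + 1) = (- ((-1) ^ r) :: complex)"
      by (subst power_int_add) (auto simp: power_int_minus minus_one_power_iff)
    have "q ^ (4 * r + 2) = q ^ (3 * r + 1) * q ^ (r + 1)" by (simp add: power_add[symmetric])
    then have 4: "q ^ (4 * r + 2) * (1 + inverse (q ^ (r + 1))) = q ^ (4 * r + 2) + q ^ (3 * r + 1)"
      using q by (simp add: field_simps)
    have 5: "q powi (int r ^ 2 - int r + int (4 * r + 2)) = T r * T r * q ^ (4 * r + 2)"
      unfolding sq'[symmetric] power_int_of_nat[symmetric] by (rule power_int_add) (use q in simp)
    have "?f (- int r) = W (int (Suc r)) z * (- ((-1) ^ r)) * (T r * T r) * (q ^ (4 * r + 2) * (1 + inverse (q ^ (r + 1))))"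
      unfolding 1 2 3 5 W_reflect[OF z(1)] power_int_minus power_int_of_nat by (simp only: mult_ac)
    then show ?thesis unfolding 4 by (simp add: algebra_simps del: power_Suc)
  qed
  have qr: "norm (q ^ k) \<le> 1" for k using q by (simp add: norm_power power_le_one)
  have "(\<Sum>\<^sub>\<infinity>j. ?f j) = (\<Sum>\<^sub>\<infinity>r. ?f (int (Suc r)) + ?f (- int r))"
  proof (rule infsum_int_fold)
    show "summable (\<lambda>r. norm (?f (int (Suc r))))"
      unfolding pos
    proof (rule summable_alpha_mult[OF q(1) z])
      fix r
      show "W (int (Suc r)) z * (-1) ^ r * (T r * T r) * (1 + q ^ r) =
        W (int (Suc r)) z * q ^ (r * (r - 1) div 2) * ((-1) ^ r * T r * (1 + q ^ r))"
        unfolding T_def by (simp only: mult_ac)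
      have "norm (1 + q ^ r) \<le> 2" using norm_triangle_ineq[of 1 "q ^ r"] qr[of r] by simp
      then show "norm ((-1) ^ r * T r * (1 + q ^ r)) \<le> 1 * 1 * 2"
        unfolding norm_mult T_def by (intro mult_mono qr) (auto simp: norm_power)
    qed
    show "summable (\<lambda>r. norm (?f (- int r)))"
      unfolding neg
    proof (rule summable_alpha_mult[OF q(1) z])
      fix r
      show "W (int (Suc r)) z * (-1) ^ r * (T r * T r) * (- (q ^ (3 * r + 1)) - q ^ (4 * r + 2)) =
        W (int (Suc r)) z * q ^ (r * (r - 1) div 2) * ((-1) ^ r * T r * (- (q ^ (3 * r + 1)) - q ^ (4 * r + 2)))"
        unfolding T_def by (simp only: mult_ac)
      have "norm (- (q ^ (3 * r + 1)) - q ^ (4 * r + 2)) \<le> 2"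
        using norm_triangle_ineq4[of "- (q ^ (3 * r + 1))" "q ^ (4 * r + 2)"] qr[of "3 * r + 1"] qr[of "4 * r + 2"]
        by (simp del: power_Suc)
      then show "norm ((-1) ^ r * T r * (- (q ^ (3 * r + 1)) - q ^ (4 * r + 2))) \<le> 1 * 1 * 2"
        unfolding norm_mult T_def by (intro mult_mono qr) (auto simp: norm_power)
    qed
  qed
  also have "\<dots> = (\<Sum>\<^sub>\<infinity>r. ?g r)"
    unfolding pos neg by (rule infsum_cong) (simp add: algebra_simps del: power_Suc)
  finally show ?thesis unfolding 1 by simp
qed

section \<open>The Jacobi triple product\<close>

definition jtp_term :: "complex \<Rightarrow> complex \<Rightarrow> int \<Rightarrow> complex" where
  "jtp_term z q j = (-1) powi j * z powi j * q powi (j * (j - 1) div 2)"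

lemma jtp_term_Suc:
  assumes "z \<noteq> 0" "q \<noteq> 0"
  shows "jtp_term z q (j + 1) = - z * q powi j * jtp_term z q j"
proof -
  have "(j + 1) * (j + 1 - 1) = j * (j - 1) + j * 2" by (simp add: algebra_simps)
  then have "(j + 1) * (j + 1 - 1) div 2 = j * (j - 1) div 2 + j" by (simp only: div_mult_self1 zero_neq_numeral not_False_eq_True add.commute)
  then show ?thesis
    using assms by (simp only: jtp_term_def power_int_add) (simp add: power_int_add mult_ac)
qed

text \<open>All terms are multiples of \<open>E * X * Y\<close>. The right-hand coefficients are
  those of \<open>(1 - z q^n)(1 - q^(n+1)/z)\<close> expanded in powers of \<open>z\<close>, so that
  summation over \<open>j\<close> yields the next factor of the product.\<close>

lemma finite_jtp_rec:
  assumes q: "norm q < 1" "q \<noteq> 0" and z: "z \<noteq> 0"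
  defines "t \<equiv> \<lambda>n j. jtp_term z q j * (inv_qfact q (int n - j) * inv_qfact q (int n + j))"
  shows "(1 - q ^ (2 * n + 1)) * (1 - q ^ (2 * n + 2)) * t (Suc n) j =
    (1 + q ^ (2 * n + 1)) * t n j + (- (z * q ^ n)) * t n (j - 1) + (- (q ^ (n + 1) / z)) * t n (j + 1)"
proof -
  define X Y N J E where "X = inv_qfact q (int (Suc n) - j)" and "Y = inv_qfact q (int (Suc n) + j)"
    and "N = q ^ n" and "J = q powi j" and "E = jtp_term z q j"
  have J0: "J \<noteq> 0" using q by (simp add: J_def)
  have e: "inv_qfact q (int n - j) = (1 - N * q / J) * X" "inv_qfact q (int n + j) = (1 - N * q * J) * Y"
    "inv_qfact q (int n - (j - 1)) = X" "inv_qfact q (int n + (j - 1)) = (1 - N * J) * ((1 - N * q * J) * Y)"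
    "inv_qfact q (int n - (j + 1)) = (1 - N / J) * ((1 - N * q / J) * X)" "inv_qfact q (int n + (j + 1)) = Y"
  proof -
    have pw: "q powi (int (Suc n) - j) = N * q / J" "q powi (int (Suc n) + j) = N * q * J"
      "q powi (int n - j) = N / J" "q powi (int n + j) = N * J"
      using q(2) by (simp_all add: power_int_diff power_int_add N_def J_def)
    show 1: "inv_qfact q (int n - j) = (1 - N * q / J) * X"
      unfolding X_def pw(1)[symmetric] by (rule inv_qfact_eq[OF q(1)]) simp
    show 2: "inv_qfact q (int n + j) = (1 - N * q * J) * Y"
      unfolding Y_def pw(2)[symmetric] by (rule inv_qfact_eq[OF q(1)]) simp
    show "inv_qfact q (int n - (j + 1)) = (1 - N / J) * ((1 - N * q / J) * X)"
      unfolding 1[symmetric] pw(3)[symmetric] by (rule inv_qfact_eq[OF q(1)]) simp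
    show "inv_qfact q (int n + (j - 1)) = (1 - N * J) * ((1 - N * q * J) * Y)"
      unfolding 2[symmetric] pw(4)[symmetric] by (rule inv_qfact_eq[OF q(1)]) simp
    show "inv_qfact q (int n - (j - 1)) = X" "inv_qfact q (int n + (j + 1)) = Y"
      unfolding X_def Y_def by (rule arg_cong[of _ _ "inv_qfact q"], simp)+
  qed
  have E1: "jtp_term z q (j + 1) = - z * J * E"
    unfolding J_def E_def by (rule jtp_term_Suc[OF z q(2)])
  have "E = - z * q powi (j - 1) * jtp_term z q (j - 1)"
    unfolding E_def using jtp_term_Suc[OF z q(2), of "j - 1"] by simp
  then have E2: "jtp_term z q (j - 1) = - (q / J) * E / z"
    using z q by (simp add: J_def power_int_diff field_simps)
  have N': "q ^ (2 * n + 1) = N ^ 2 * q" "q ^ (2 * n + 2) = N ^ 2 * q ^ 2" "q ^ n = N" "q ^ (n + 1) = N * q"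
    by (simp_all add: N_def power_add power_even_eq power2_eq_square)
  define M where "M = N / J"
  have NM: "N = M * J" "N * q / J = M * q" using J0 by (simp_all add: M_def)
  have c: "- (z * N) * (- (q / J) * E / z * A) = M * q * E * A" "- (N * q / z) * (- z * J * E * A) = N * q * J * E * A" for A
    using z J0 by (simp_all add: M_def)
  show ?thesis
    unfolding t_def e E1 E2 N' X_def[symmetric] Y_def[symmetric] E_def[symmetric] c NM(2) M_def[symmetric]
    unfolding NM(1) by algebra
qed

text \<open>Summing the recurrence over all integers \<open>j\<close> is shift invariant, so the
  three neighbours contribute the same sum. The support is \<open>|j| \<le> n\<close> automatically,
  because \<open>inv_qfact\<close> vanishes at negative arguments.\<close>

lemma finite_jtp:
  assumes q: "norm q < 1" "q \<noteq> 0" and z: "z \<noteq> 0"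
  shows "((\<lambda>j. jtp_term z q j * (inv_qfact q (int n - j) * inv_qfact q (int n + j))) has_sum
    (qpoch z q n * qpoch (q / z) q n / qpoch q q (2 * n))) UNIV"
proof (induction n)
  case 0
  have "((\<lambda>j. jtp_term z q j * (inv_qfact q (int 0 - j) * inv_qfact q (int 0 + j))) has_sum 1) {0}"
    using inv_qfact_nat[of q 0] by (intro has_sum_finiteI) (auto simp: jtp_term_def)
  also have "?this \<longleftrightarrow> ?case"
    by (rule has_sum_cong_neutral[THEN trans]) (auto simp: neq_iff)
  finally show ?case .
next
  case (Suc n)
  define t where "t = (\<lambda>n j. jtp_term z q j * (inv_qfact q (int n - j) * inv_qfact q (int n + j)))"
  define S where "S = qpoch z q n * qpoch (q / z) q n / qpoch q q (2 * n)"
  define D where "D = (1 - q ^ (2 * n + 1)) * (1 - q ^ (2 * n + 2))"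
  have pD: "qpoch q q (2 * Suc n) = qpoch q q (2 * n) * D"
    by (simp add: qpoch_Suc D_def)
  have D0: "D \<noteq> 0"
    using qpoch_nonzero[OF q(1) q(1), of "2 * Suc n"] pD by auto
  have 0: "(t n has_sum S) UNIV" using Suc by (simp add: t_def S_def)
  have 1: "((\<lambda>j. t n (j - 1)) has_sum S) UNIV"
    using 0 by (subst has_sum_reindex_bij_witness[of _ "\<lambda>j. j + 1" "\<lambda>j. j - 1" UNIV "t n" _ S]) auto
  have 2: "((\<lambda>j. t n (j + 1)) has_sum S) UNIV"
    using 0 by (subst has_sum_reindex_bij_witness[of _ "\<lambda>j. j - 1" "\<lambda>j. j + 1" UNIV "t n" _ S]) auto
  have "((\<lambda>j. (1 + q ^ (2 * n + 1)) * t n j + (- (z * q ^ n)) * t n (j - 1) + (- (q ^ (n + 1) / z)) * t n (j + 1))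
      has_sum ((1 + q ^ (2 * n + 1)) * S + (- (z * q ^ n)) * S + (- (q ^ (n + 1) / z)) * S)) UNIV"
    by (intro has_sum_add has_sum_cmult_right 0 1 2)
  then have "((\<lambda>j. D * t (Suc n) j) has_sum
      ((1 + q ^ (2 * n + 1)) * S + (- (z * q ^ n)) * S + (- (q ^ (n + 1) / z)) * S)) UNIV"
    using finite_jtp_rec[OF q z, of n] unfolding t_def D_def by simp
  then have "((\<lambda>j. 1 / D * (D * t (Suc n) j)) has_sum
      (1 / D * ((1 + q ^ (2 * n + 1)) * S + (- (z * q ^ n)) * S + (- (q ^ (n + 1) / z)) * S))) UNIV"
    by (rule has_sum_cmult_right)
  moreover have "(1 + q ^ (2 * n + 1)) * S + (- (z * q ^ n)) * S + (- (q ^ (n + 1) / z)) * S =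
      (1 - z * q ^ n) * (1 - q / z * q ^ n) * S"
  proof -
    define w N where "w = q / z" and "N = q ^ n"
    have e: "q ^ (2 * n + 1) = w * z * (N * N)" "q ^ (n + 1) / z = w * N" "q ^ n = N" "q / z = w"
      using z by (simp_all add: w_def N_def mult_2 power_add)
    show ?thesis unfolding e by algebra
  qed
  moreover have "1 / D * ((1 - z * q ^ n) * (1 - q / z * q ^ n) * S) =
      qpoch z q (Suc n) * qpoch (q / z) q (Suc n) / qpoch q q (2 * Suc n)"
    unfolding pD S_def qpoch_Suc by (simp add: mult_ac)
  moreover have "1 / D * (D * t (Suc n) j) = t (Suc n) j" for j using D0 by simp
  ultimately show ?case unfolding t_def by simp
qed

lemma jtp_term_pos:
  "jtp_term z q (int (Suc r)) = - z * (- (z * q)) ^ r * q ^ (r * (r - 1) div 2)"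
proof -
  have "int (Suc r) * (int (Suc r) - 1) = int (Suc r * r)" by (simp add: algebra_simps)
  then have "int (Suc r) * (int (Suc r) - 1) div 2 = int (Suc r * r div 2)" by (simp only: zdiv_int of_nat_numeral)
  then have "jtp_term z q (int (Suc r)) = (-1) ^ Suc r * z ^ Suc r * q ^ (r * (r - 1) div 2 + r)"
    unfolding jtp_term_def half_mult_Suc[symmetric] by (simp only: power_int_of_nat)
  then show ?thesis
    unfolding power_minus[of "z * q"] by (simp add: power_add power_mult_distrib mult_ac)
qed

lemma jtp_term_neg:
  assumes "z \<noteq> 0"
  shows "jtp_term z q (- int r) = (- (q / z)) ^ r * q ^ (r * (r - 1) div 2)"
proof -
  have "- int r * (- int r - 1) = int (Suc r * r)" by (simp add: algebra_simps)
  then have "- int r * (- int r - 1) div 2 = int (Suc r * r div 2)" by (simp only: zdiv_int of_nat_numeral)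
  then have "jtp_term z q (- int r) = inverse ((-1) ^ r) * inverse (z ^ r) * q ^ (r * (r - 1) div 2 + r)"
    unfolding jtp_term_def half_mult_Suc[symmetric] by (simp only: power_int_minus power_int_of_nat)
  then show ?thesis
    unfolding power_minus[of "q / z"] power_divide by (simp add: power_add minus_one_power_iff divide_inverse)
qed

lemma summable_jtp_term:
  assumes "norm q < 1" "z \<noteq> 0"
  shows "summable (\<lambda>r. norm (jtp_term z q (int (Suc r))))" "summable (\<lambda>r. norm (jtp_term z q (- int r)))"
proof -
  show "summable (\<lambda>r. norm (jtp_term z q (int (Suc r))))"
    using summable_mult[OF summable_power_triangle[OF assms(1), of "norm (z * q)"], of "norm z"]
    unfolding jtp_term_pos by (simp add: norm_mult norm_power mult_ac)
  show "summable (\<lambda>r. norm (jtp_term z q (- int r)))"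
    using summable_power_triangle[OF assms(1), of "norm (q / z)"]
    unfolding jtp_term_neg[OF assms(2)] by (simp add: norm_mult norm_power norm_divide)
qed

lemma summable_on_int:
  fixes f :: "int \<Rightarrow> complex"
  assumes "summable (\<lambda>r. norm (f (int (Suc r))))" "summable (\<lambda>r. norm (f (- int r)))"
  shows "f summable_on UNIV"
proof -
  have r: "range (\<lambda>r. int (Suc r)) \<union> range (\<lambda>r. - int r) = UNIV"
  proof (intro equalityI subsetI UNIV_I)
    fix j :: int
    show "j \<in> range (\<lambda>r. int (Suc r)) \<union> range (\<lambda>r. - int r)"
    proof (cases "j > 0")
      case True
      then have "j = int (Suc (nat (j - 1)))" by simp
      then show ?thesis by blast
    next
      case False
      then have "j = - int (nat (- j))" by simp
      then show ?thesis by blast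
    qed
  qed
  have "f summable_on range (\<lambda>r. int (Suc r))" "f summable_on range (\<lambda>r. - int r)"
    using assms norm_summable_imp_summable_on
    by (auto simp: summable_on_reindex inj_on_def o_def)
  then show ?thesis
    unfolding r[symmetric] by (rule summable_on_union)
qed

text \<open>Limit of the finite form by dominated convergence: each term tends to the theta term
  over \<open>(q;q)_\<infinity>^2\<close>, whereas the product side tends to the two products over
  \<open>(q;q)_\<infinity>\<close>; clearing denominators leaves one factor
  \<open>(q;q)_\<infinity>\<close>.\<close>

lemma jacobi_triple_product:
  assumes q: "norm q < 1" "q \<noteq> 0" and z: "z \<noteq> 0"
  shows "(jtp_term z q has_sum (qpoch_inf z q * qpoch_inf (q / z) q * qpoch_inf q q)) UNIV"
proof -
  let ?e = "jtp_term z q"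
  define t where "t = (\<lambda>n j. ?e j * (inv_qfact q (int n - j) * inv_qfact q (int n + j)))"
  define a where "a = (\<lambda>r n. t n (int (Suc r)) + t n (- int r))"
  define S where "S = (\<lambda>n. qpoch z q n * qpoch (q / z) q n / qpoch q q (2 * n))"
  obtain C where C: "C > 0" "\<And>m. norm (inv_qfact q m) \<le> C" using inv_qfact_bounded q by metis
  have tb: "norm (t n j) \<le> norm (?e j) * (C * C)" for n j
    unfolding t_def norm_mult using C by (intro mult_left_mono mult_mono) auto
  have M: "summable (\<lambda>r. norm (?e (int (Suc r))) * (C * C) + norm (?e (- int r)) * (C * C))"
    by (intro summable_add summable_mult2 summable_jtp_term q z)
  have ab: "norm (a r n) \<le> norm (?e (int (Suc r))) * (C * C) + norm (?e (- int r)) * (C * C)" for r n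
    unfolding a_def by (rule order_trans[OF norm_triangle_ineq add_mono[OF tb tb]])
  have lim_t: "(\<lambda>n. t n j) \<longlonglongrightarrow> ?e j * (1 / qpoch_inf q q * (1 / qpoch_inf q q))" for j
    unfolding t_def using inv_qfact_tendsto[OF q(1), of "- j"] inv_qfact_tendsto[OF q(1), of j]
    by (intro tendsto_intros) simp_all
  let ?K = "1 / qpoch_inf q q * (1 / qpoch_inf q q)"
  have "(\<lambda>n. \<Sum>r. a r n) \<longlonglongrightarrow> (\<Sum>r. ?e (int (Suc r)) * ?K + ?e (- int r) * ?K)"
  \<comment> \<open>The majorant is the theta term times the square of a common bound on reciprocal
    factorials, independent of \<open>n\<close>.\<close>
  proof (rule tannerys_theorem[THEN conjunct2, THEN conjunct2])
    show "(\<lambda>n. a r n) \<longlonglongrightarrow> ?e (int (Suc r)) * ?K + ?e (- int r) * ?K" for r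
      unfolding a_def by (intro tendsto_add lim_t)
    show "\<forall>\<^sub>F (r, n) in at_top \<times>\<^sub>F sequentially.
        norm (a r n) \<le> norm (?e (int (Suc r))) * (C * C) + norm (?e (- int r)) * (C * C)"
      by (rule always_eventually) (use ab in auto)
  qed (use M in auto)
  moreover have "(\<Sum>r. a r n) = S n" for n
  proof -
    have 1: "summable (\<lambda>r. norm (t n (int (Suc r))))" "summable (\<lambda>r. norm (t n (- int r)))"
      by (rule summable_comparison_test'[OF summable_mult2[OF summable_jtp_term(1)[OF q(1) z], of "C * C"]], use tb in simp)
         (rule summable_comparison_test'[OF summable_mult2[OF summable_jtp_term(2)[OF q(1) z], of "C * C"]], use tb in simp)
    have 2: "summable (\<lambda>r. norm (a r n))"
      by (rule summable_comparison_test'[OF M]) (use ab in simp)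
    have "S n = infsum (t n) UNIV"
      using infsumI[OF finite_jtp[OF q z, of n]] by (simp add: S_def t_def)
    also have "\<dots> = (\<Sum>\<^sub>\<infinity>r. a r n)"
      unfolding a_def by (rule infsum_int_fold[OF 1])
    finally show ?thesis
      using infsum_eq_suminf_if_norm_summable[OF 2] by simp
  qed
  moreover have "S \<longlonglongrightarrow> qpoch_inf z q * qpoch_inf (q / z) q / qpoch_inf q q"
  proof -
    have "(\<lambda>n. qpoch q q (2 * n)) \<longlonglongrightarrow> qpoch_inf q q"
      using LIMSEQ_subseq_LIMSEQ[OF qpoch_tendsto[OF q(1)], of "\<lambda>n. 2 * n" q]
      by (simp add: strict_mono_def o_def)
    then show ?thesis
      unfolding S_def by (intro tendsto_intros qpoch_tendsto qpoch_inf_nonzero q)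
  qed
  ultimately have 1: "(\<Sum>r. ?e (int (Suc r)) * ?K + ?e (- int r) * ?K) =
      qpoch_inf z q * qpoch_inf (q / z) q / qpoch_inf q q"
    using LIMSEQ_unique by auto
  have s: "summable (\<lambda>r. ?e (int (Suc r)) + ?e (- int r))"
    by (intro summable_add summable_norm_cancel[OF summable_jtp_term(1)] summable_norm_cancel[OF summable_jtp_term(2)] q z)
  have "summable (\<lambda>r. norm (?e (int (Suc r)) + ?e (- int r)))"
    by (rule summable_comparison_test'[OF summable_add[OF summable_jtp_term[OF q(1) z]]]) (simp add: norm_triangle_ineq)
  then have "infsum ?e UNIV = (\<Sum>r. ?e (int (Suc r)) + ?e (- int r))"
    using infsum_int_fold[OF summable_jtp_term[OF q(1) z]] infsum_eq_suminf_if_norm_summable by simp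
  moreover have "(\<Sum>r. ?e (int (Suc r)) + ?e (- int r)) * ?K = qpoch_inf z q * qpoch_inf (q / z) q / qpoch_inf q q"
    unfolding 1[symmetric] suminf_mult2[OF s] by (simp add: ring_distribs add_divide_distrib)
  ultimately have "infsum ?e UNIV = qpoch_inf z q * qpoch_inf (q / z) q * qpoch_inf q q"
    using qpoch_inf_nonzero[OF q(1) q(1)] by (simp add: field_simps)
  moreover have "?e summable_on UNIV"
    by (rule summable_on_int[OF summable_jtp_term[OF q(1) z]])
  ultimately show ?thesis
    using has_sum_infsum by fastforce
qed

section \<open>The product form of \<open>S_F1\<close>\<close>

lemma W_shift:
  assumes "z \<noteq> 0"
  shows "W (m + 1) z = z * z powi m + inverse z powi m - (1 + z)"
  using assms unfolding W_def
  by (simp add: power_int_add power_int_minus power_int_inverse field_simps)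

text \<open>After \<open>j = m + 1\<close> the exponent becomes \<open>m (m - 1)\<close>, a
  triangular exponent to base \<open>q^2\<close>. The three summands of \<open>W\<close> and the two
  of \<open>1 + q^m\<close> give six theta series, each evaluated by the triple product.\<close>

lemma S_F1_product:
  assumes q: "norm q < 1" "q \<noteq> 0" and z: "z \<noteq> 0" "1 + z \<noteq> 0"
    and nz: "qpochs_inf [z, inverse z] q \<noteq> 0"
  shows "1 / ((1 + z) * qpochs_inf [z, inverse z] q) *
          (\<Sum>\<^sub>\<infinity>j\<in>(UNIV :: int set).
             W j z * (-1) powi (j + 1) * q powi (j ^ 2 - 3 * j + 2) * (1 + q powi (j - 1))) =
          qpochs_inf [inverse z * q ^ 2, z * q ^ 2, q ^ 2] (q ^ 2) /
            qpochs_inf [z * q, inverse z * q] q +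
          qpochs_inf [inverse z * q, z * q, q ^ 2] (q ^ 2) / qpochs_inf [z, inverse z] q -
          qpochs_inf [q, q, q ^ 2] (q ^ 2) / qpochs_inf [z, inverse z] q"
proof -
  note q2 = norm_square_less_1[OF q(1)]
  have p0: "q ^ 2 \<noteq> 0" using q by simp
  let ?f = "\<lambda>j. W j z * (-1) powi (j + 1) * q powi (j ^ 2 - 3 * j + 2) * (1 + q powi (j - 1))"
  let ?T = "\<lambda>x. jtp_term x (q ^ 2)" and ?I = "\<lambda>x. qpoch_inf x (q ^ 2)"
  have th: "(?T x has_sum (?I x * ?I (q ^ 2 / x) * ?I (q ^ 2))) UNIV" if "x \<noteq> 0" for x
    by (rule jacobi_triple_product[OF q2 p0 that])
  have T: "?T x m = (-1) powi m * x powi m * q powi (m * (m - 1))"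
    "?T (x * q) m = (-1) powi m * x powi m * q powi (m * (m - 1)) * q powi m" for x m
  proof -
    have "even (m * (m - 1))" by simp
    then have "2 * (m * (m - 1) div 2) = m * (m - 1)" by (rule dvd_mult_div_cancel)
    then have "(q ^ 2) powi (m * (m - 1) div 2) = q powi (m * (m - 1))"
      using power_int_mult[of q 2 "m * (m - 1) div 2"] by simp
    then show "?T x m = (-1) powi m * x powi m * q powi (m * (m - 1))"
      "?T (x * q) m = (-1) powi m * x powi m * q powi (m * (m - 1)) * q powi m"
      by (simp_all add: jtp_term_def power_int_mult_distrib)
  qed
  have f: "?f (m + 1) = z * ?T z m + ?T (inverse z) m + (- (1 + z)) * ?T 1 m
      + (z * ?T (z * q) m + ?T (inverse z * q) m + (- (1 + z)) * ?T (1 * q) m)" for m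
  proof -
    have 1: "(m + 1) ^ 2 - 3 * (m + 1) + 2 = m * (m - 1)" "m + 1 - 1 = m" by (simp_all add: power2_eq_square algebra_simps)
    have 2: "(-1) powi (m + 1 + 1) = ((-1) powi m :: complex)" by (simp add: power_int_add)
    show ?thesis unfolding 1 2 T(2) unfolding T(1) W_shift[OF z(1)] power_int_1_left by algebra
  qed
  let ?P = "?I (q ^ 2)"
  define s where "s = z * (?I z * ?I (q ^ 2 / z) * ?P) + ?I (inverse z) * ?I (q ^ 2 / inverse z) * ?P
      + (- (1 + z)) * (?I 1 * ?I (q ^ 2 / 1) * ?P)
      + (z * (?I (z * q) * ?I (q ^ 2 / (z * q)) * ?P) + ?I (inverse z * q) * ?I (q ^ 2 / (inverse z * q)) * ?P
      + (- (1 + z)) * (?I (1 * q) * ?I (q ^ 2 / (1 * q)) * ?P))"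
  have "((\<lambda>m. ?f (m + 1)) has_sum s) UNIV"
    unfolding f s_def by (intro has_sum_add has_sum_cmult_right th) (use z q in auto)
  moreover have "infsum ?f UNIV = (\<Sum>\<^sub>\<infinity>m. ?f (m + 1))"
    by (rule infsum_reindex_bij_witness[of _ "\<lambda>m. m + 1" "\<lambda>j. j - 1"]) auto
  ultimately have inf: "infsum ?f UNIV = s" using infsumI by fastforce
  define A B D where "A = ?I (z * q ^ 2)" and "B = ?I (inverse z * q ^ 2)" and "D = ?I (z * q) * ?I (inverse z * q)"
  have r1: "?I z = (1 - z) * A" "?I (inverse z) = (1 - inverse z) * B"
    unfolding A_def B_def by (rule qpoch_inf_rec[OF q2])+
  \<comment> \<open>The theta series at argument 1 vanishes, which leaves five of the six.\<close>
  have r2: "?I 1 = 0" using qpoch_inf_rec[OF q2, of 1] by simp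
  have r3: "q ^ 2 / z = inverse z * q ^ 2" "q ^ 2 / inverse z = z * q ^ 2" "q ^ 2 / (z * q) = inverse z * q"
    "q ^ 2 / (inverse z * q) = z * q" "q ^ 2 / (1 * q) = q"
    using q z by (simp_all add: field_simps power2_eq_square)
  have s: "s = (1 + z) * ((1 - z) * (1 - inverse z) * (A * B * ?P) + D * ?P - ?I q * ?I q * ?P)"
  proof -
    have zi: "z * inverse z = 1" using z by simp
    have "s = z * ((1 - z) * A * B * ?P) + (1 - inverse z) * B * A * ?P + (z * (D * ?P) + D * ?P + (- (1 + z)) * (?I q * ?I q * ?P))"
      unfolding s_def r2 r3 r1 D_def A_def[symmetric] B_def[symmetric] by simp
    \<comment> \<open>The series at \<open>z\<close> and \<open>1/z\<close> have proportional
      products; their coefficients add up to a multiple of \<open>1 + z\<close>, which cancels the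
      prefactor.\<close>
    moreover have "z * (1 - z) + (1 - inverse z) = (1 + z) * ((1 - z) * (1 - inverse z))"
      using zi by algebra
    then have "z * ((1 - z) * A * B * ?P) + (1 - inverse z) * B * A * ?P = (1 + z) * ((1 - z) * (1 - inverse z)) * (A * B * ?P)"
      by algebra
    ultimately show ?thesis by (simp add: algebra_simps)
  qed
  define X Y where "X = qpoch_inf (z * q) q" and "Y = qpoch_inf (inverse z * q) q"
  have XY: "qpoch_inf z q = (1 - z) * X" "qpoch_inf (inverse z) q = (1 - inverse z) * Y"
    unfolding X_def Y_def by (rule qpoch_inf_rec[OF q(1)])+
  have nz': "1 - z \<noteq> 0" "1 - inverse z \<noteq> 0" "X \<noteq> 0" "Y \<noteq> 0"
    using nz unfolding qpochs_inf_def by (auto simp: XY)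
  have c: "1 / ((1 + z) * U) * ((1 + z) * (V1 + V2 - V3)) = V1 / U + V2 / U - V3 / U" for U V1 V2 V3
    using z by (simp add: add_divide_distrib diff_divide_distrib)
  have "(1 - z) * (1 - inverse z) * (A * B * ?P) / ((1 - z) * X * ((1 - inverse z) * Y)) = A * B * ?P / (X * Y)"
    using nz' by simp
  then show ?thesis
    unfolding inf s c unfolding qpochs_inf_def list.map prod_list.Cons prod_list.Nil mult_1_right XY D_def
      A_def[symmetric] B_def[symmetric] X_def[symmetric] Y_def[symmetric]
    by (simp add: mult_ac)
qed

section \<open>The case q = 0\<close>

lemma W_1 [simp]: "W 1 z = 0"
  by (simp add: W_def)

text \<open>Both sides are 0. On the left every term has \<open>n \<ge> 1\<close> and hence a
  positive power of 0; on the right \<open>W 1 z = 0\<close>, and for \<open>j \<ge> 2\<close> the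
  exponent is positive.\<close>

lemma identities_at_zero:
  shows "S_L7 z 0 = 1 / ((1 + z) * qpochs_inf [0 ^ 2, z, inverse z] (0 ^ 2)) *
          (\<Sum>\<^sub>\<infinity>j\<in>{1::nat..}. \<Sum>\<^sub>\<infinity>n\<in>{0::nat..}.
             W (int j) z * (-1) ^ (j + 1) * (1 + 0 ^ (2 * j - 1)) *
             0 ^ (j * (j - 1) + n * (n - 1) div 2 + 2 * j * n))" (is "_ = ?cL7 * ?L7")
    and "S_L9 z 0 = 1 / ((1 + z) * qpochs_inf [0, z, inverse z] 0) *
          (\<Sum>\<^sub>\<infinity>j\<in>{1::nat..}. \<Sum>\<^sub>\<infinity>n\<in>{0::nat..}.
             W (int j) z * (-1) ^ (j + n + 1) * (1 - 0 ^ (2 * j - 1)) *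
             0 ^ (j * (j - 1) div 2 + n ^ 2 + 2 * j * n))" (is "_ = ?cL9 * ?L9")
    and "S_L12 z 0 = 1 / ((1 + z) * qpochs_inf [0 ^ 2, z, inverse z] (0 ^ 2)) *
          (\<Sum>\<^sub>\<infinity>j\<in>{1::nat..}. \<Sum>\<^sub>\<infinity>n\<in>{0::nat..}.
             W (int j) z * (-1) ^ (j + 1) * (1 + 0 ^ (2 * j - 1)) *
             0 ^ (j * (j - 1) + n ^ 2 + 2 * j * n))" (is "_ = ?cL12 * ?L12")
    and "F2 \<rho>1 \<rho>2 z 0 =
          (\<Sum>\<^sub>\<infinity>j\<in>{1::nat..}.
             W (int j) z * (-1) ^ (j + 1) * 0 ^ (j * (j - 1) div 2) *
             qpochs [\<rho>1, \<rho>2] 0 (j - 1) * qpochs_inf [0 ^ (j + 1) / \<rho>1, 0 ^ (j + 1) / \<rho>2] 0 /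
             ((1 + z) * \<rho>1 ^ (j - 1) * \<rho>2 ^ (j - 1) *
              qpochs_inf [z, inverse z, \<rho>1, \<rho>2, 0 / (\<rho>1 * \<rho>2)] 0) *
             (1 - 0 ^ j / \<rho>1 - 0 ^ j / \<rho>2 + 0 ^ (3 * j - 1) / \<rho>1 + 0 ^ (3 * j - 1) / \<rho>2
              - 0 ^ (4 * j - 2)))" (is "_ = ?F2")
    and "G2 \<rho>1 \<rho>2 z 0 =
          (\<Sum>\<^sub>\<infinity>j\<in>{1::nat..}.
             W (int j) z * (-1) ^ (j + 1) * (1 - 0 ^ (2 * j - 1)) * 0 ^ (j * (j + 1) div 2 - 1) *
             qpochs [\<rho>1, \<rho>2] 0 (j - 1) * qpochs_inf [0 ^ (j + 1) / \<rho>1, 0 ^ (j + 1) / \<rho>2] 0 /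
             ((1 + z) * \<rho>1 ^ (j - 1) * \<rho>2 ^ (j - 1) *
              qpochs_inf [z, inverse z, \<rho>1, \<rho>2, 0 ^ 2 / (\<rho>1 * \<rho>2)] 0))" (is "_ = ?G2")
    and "F1 \<rho> z 0 =
          (\<Sum>\<^sub>\<infinity>j\<in>{1::nat..}.
             W (int j) z * 0 ^ ((j - 1) ^ 2) *
             qpoch \<rho> 0 (j - 1) * qpoch_inf (0 ^ (j + 1) / \<rho>) 0 /
             ((1 + z) * \<rho> ^ (j - 1) * qpochs_inf [z, inverse z, \<rho>] 0) *
             (1 - 0 ^ j / \<rho> + 0 ^ (3 * j - 1) / \<rho> - 0 ^ (4 * j - 2)))" (is "_ = ?F1")
    and "G1 \<rho> z 0 =
          (\<Sum>\<^sub>\<infinity>j\<in>{1::nat..}.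
             W (int j) z * (1 - 0 ^ (2 * j - 1)) * 0 ^ (j * (j - 1)) *
             qpoch \<rho> 0 (j - 1) * qpoch_inf (0 ^ (j + 1) / \<rho>) 0 /
             ((1 + z) * \<rho> ^ (j - 1) * qpochs_inf [z, inverse z, \<rho>] 0))" (is "_ = ?G1")
proof -
  have half: "Suc (Suc k) * Suc k div 2 > 0" for k
    using half_mult_Suc[of "Suc k"] by simp
  have W: "W (int j) z = 0 \<or> (0::complex) ^ e = 0" if "j \<in> {1..}" "\<And>k. j = Suc (Suc k) \<Longrightarrow> e > 0" for j e
  proof (cases "j = 1")
    case False
    then have "j = Suc (Suc (j - 2))" using that(1) by simp
    with that(2) show ?thesis by (auto simp: power_0_left)
  qed simp
  have e: "W (int j) z = 0 \<or> (\<forall>a. (0::complex) ^ (j * (j - 1) + a) = 0)"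
    "W (int j) z = 0 \<or> (0::complex) ^ (j * (j - 1)) = 0"
    "W (int j) z = 0 \<or> (\<forall>a. (0::complex) ^ (j * (j - 1) div 2 + a) = 0)"
    "W (int j) z = 0 \<or> (0::complex) ^ (j * (j - 1) div 2) = 0"
    "W (int j) z = 0 \<or> (0::complex) ^ (j * (j + 1) div 2 - 1) = 0"
    "W (int j) z = 0 \<or> (0::complex) ^ ((j - 1) ^ 2) = 0" if "j \<in> {1..}" for j
  proof -
    have g: "Suc (Suc k) * (Suc (Suc k) + 1) div 2 - 1 > 0" for k
      using half_mult_Suc[of "Suc (Suc k)"] half[of k] by (simp add: mult.commute)
    show 1: "W (int j) z = 0 \<or> (0::complex) ^ (j * (j - 1)) = 0"
      "W (int j) z = 0 \<or> (0::complex) ^ ((j - 1) ^ 2) = 0"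
      by (rule W[OF that], simp)+
    show 2: "W (int j) z = 0 \<or> (0::complex) ^ (j * (j - 1) div 2) = 0"
      by (rule W[OF that], use half in simp)
    show "W (int j) z = 0 \<or> (\<forall>a. (0::complex) ^ (j * (j - 1) + a) = 0)"
      "W (int j) z = 0 \<or> (\<forall>a. (0::complex) ^ (j * (j - 1) div 2 + a) = 0)"
      unfolding power_add using 1(1) 2 by (simp_all only: mult_eq_0_iff) blast+
    show "W (int j) z = 0 \<or> (0::complex) ^ (j * (j + 1) div 2 - 1) = 0"
      by (rule W[OF that], use g in blast)
  qed
  have zero: "infsum f A = (0::complex)" if "\<And>x. x \<in> A \<Longrightarrow> f x = 0" for f and A :: "nat set"
    using that by (rule infsum_0)
  have pos: "(0::complex) ^ (n * (n + k) div 2) = 0" if "n \<in> {1..}" "k \<ge> 1" for n k :: nat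
  proof -
    have "1 * 2 \<le> n * (n + k)" using that by (intro mult_mono) auto
    then have "n * (n + k) div 2 > 0" by (simp add: div_greater_zero_iff)
    then show ?thesis by (simp add: power_0_left)
  qed
  have "?L7 = 0"
    by (intro zero, drule e(1), elim disjE) (simp_all only: add.assoc mult_zero_left mult_zero_right)
  moreover have "S_L7 z 0 = 0"
    unfolding S_L7_def by (subst zero) auto
  ultimately show "S_L7 z 0 = ?cL7 * ?L7"
    by (simp only: mult_zero_right)
  have "?L9 = 0"
    by (intro zero, drule e(3), elim disjE) (simp_all only: add.assoc mult_zero_left mult_zero_right)
  moreover have "S_L9 z 0 = 0"
    unfolding S_L9_def by (subst zero) auto
  ultimately show "S_L9 z 0 = ?cL9 * ?L9"
    by (simp only: mult_zero_right)
  have "?L12 = 0"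
    by (intro zero, drule e(1), elim disjE) (simp_all only: add.assoc mult_zero_left mult_zero_right)
  moreover have "S_L12 z 0 = 0"
    unfolding S_L12_def by (subst zero) auto
  ultimately show "S_L12 z 0 = ?cL12 * ?L12"
    by (simp only: mult_zero_right)
  have "?F2 = 0"
    by (intro zero, drule e(4), elim disjE) (simp_all only: mult_zero_left mult_zero_right div_0)
  moreover have "F2 \<rho>1 \<rho>2 z 0 = 0"
    unfolding F2_def by (subst zero) (auto simp: F2_term_def)
  ultimately show "F2 \<rho>1 \<rho>2 z 0 = ?F2"
    by (simp only:)
  have "?G2 = 0"
    by (intro zero, drule e(5), elim disjE) (simp_all only: mult_zero_left mult_zero_right div_0)
  moreover have "G2 \<rho>1 \<rho>2 z 0 = 0"
    unfolding G2_def by (subst zero) (auto simp: G2_term_def)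
  ultimately show "G2 \<rho>1 \<rho>2 z 0 = ?G2"
    by (simp only:)
  have "?F1 = 0"
    by (intro zero, drule e(6), elim disjE) (simp_all only: mult_zero_left mult_zero_right div_0)
  moreover have "F1 \<rho> z 0 = 0"
    unfolding F1_def by (subst zero) (simp_all only: pos order_refl mult_zero_left mult_zero_right div_0)
  ultimately show "F1 \<rho> z 0 = ?F1"
    by (simp only:)
  have "?G1 = 0"
    by (intro zero, drule e(2), elim disjE) (simp_all only: mult_zero_left mult_zero_right div_0)
  moreover have "G1 \<rho> z 0 = 0"
    unfolding G1_def by (subst zero) (simp_all only: pos one_le_numeral mult_zero_left mult_zero_right div_0)
  ultimately show "G1 \<rho> z 0 = ?G1"
    by (simp only:)
qed

theorem theorem2p3:
  fixes q z \<rho> \<rho>1 \<rho>2 :: complex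
  assumes "norm q < 1" and "z \<noteq> 0" and "1 + z \<noteq> 0"
  shows
    "(qpochs_inf [z, inverse z] (q ^ 2) \<noteq> 0 \<longrightarrow>
        S_L7 z q =
          1 / ((1 + z) * qpochs_inf [q ^ 2, z, inverse z] (q ^ 2)) *
          (\<Sum>\<^sub>\<infinity>j\<in>{1::nat..}. \<Sum>\<^sub>\<infinity>n\<in>{0::nat..}.
             W (int j) z * (-1) ^ (j + 1) * (1 + q ^ (2 * j - 1)) *
             q ^ (j * (j - 1) + n * (n - 1) div 2 + 2 * j * n))) \<and>
     (qpochs_inf [z, inverse z] q \<noteq> 0 \<longrightarrow>
        S_L9 z q =
          1 / ((1 + z) * qpochs_inf [q, z, inverse z] q) *
          (\<Sum>\<^sub>\<infinity>j\<in>{1::nat..}. \<Sum>\<^sub>\<infinity>n\<in>{0::nat..}.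
             W (int j) z * (-1) ^ (j + n + 1) * (1 - q ^ (2 * j - 1)) *
             q ^ (j * (j - 1) div 2 + n ^ 2 + 2 * j * n))) \<and>
     (qpochs_inf [z, inverse z] (q ^ 2) \<noteq> 0 \<longrightarrow>
        S_L12 z q =
          1 / ((1 + z) * qpochs_inf [q ^ 2, z, inverse z] (q ^ 2)) *
          (\<Sum>\<^sub>\<infinity>j\<in>{1::nat..}. \<Sum>\<^sub>\<infinity>n\<in>{0::nat..}.
             W (int j) z * (-1) ^ (j + 1) * (1 + q ^ (2 * j - 1)) *
             q ^ (j * (j - 1) + n ^ 2 + 2 * j * n))) \<and>
     (\<rho>1 \<noteq> 0 \<and> \<rho>2 \<noteq> 0 \<and>
      qpochs_inf [z, inverse z, \<rho>1, \<rho>2, q / (\<rho>1 * \<rho>2)] q \<noteq> 0 \<and>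
      (\<lambda>n. norm (F2_term \<rho>1 \<rho>2 z q n)) summable_on {1..} \<longrightarrow>
        F2 \<rho>1 \<rho>2 z q =
          (\<Sum>\<^sub>\<infinity>j\<in>{1::nat..}.
             W (int j) z * (-1) ^ (j + 1) * q ^ (j * (j - 1) div 2) *
             qpochs [\<rho>1, \<rho>2] q (j - 1) * qpochs_inf [q ^ (j + 1) / \<rho>1, q ^ (j + 1) / \<rho>2] q /
             ((1 + z) * \<rho>1 ^ (j - 1) * \<rho>2 ^ (j - 1) *
              qpochs_inf [z, inverse z, \<rho>1, \<rho>2, q / (\<rho>1 * \<rho>2)] q) *
             (1 - q ^ j / \<rho>1 - q ^ j / \<rho>2 + q ^ (3 * j - 1) / \<rho>1 + q ^ (3 * j - 1) / \<rho>2
              - q ^ (4 * j - 2)))) \<and>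
     (\<rho>1 \<noteq> 0 \<and> \<rho>2 \<noteq> 0 \<and>
      qpochs_inf [z, inverse z, \<rho>1, \<rho>2, q ^ 2 / (\<rho>1 * \<rho>2)] q \<noteq> 0 \<and>
      (\<lambda>n. norm (G2_term \<rho>1 \<rho>2 z q n)) summable_on {1..} \<longrightarrow>
        G2 \<rho>1 \<rho>2 z q =
          (\<Sum>\<^sub>\<infinity>j\<in>{1::nat..}.
             W (int j) z * (-1) ^ (j + 1) * (1 - q ^ (2 * j - 1)) * q ^ (j * (j + 1) div 2 - 1) *
             qpochs [\<rho>1, \<rho>2] q (j - 1) * qpochs_inf [q ^ (j + 1) / \<rho>1, q ^ (j + 1) / \<rho>2] q /
             ((1 + z) * \<rho>1 ^ (j - 1) * \<rho>2 ^ (j - 1) *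
              qpochs_inf [z, inverse z, \<rho>1, \<rho>2, q ^ 2 / (\<rho>1 * \<rho>2)] q))) \<and>
     (\<rho> \<noteq> 0 \<and> qpochs_inf [z, inverse z, \<rho>] q \<noteq> 0 \<longrightarrow>
        F1 \<rho> z q =
          (\<Sum>\<^sub>\<infinity>j\<in>{1::nat..}.
             W (int j) z * q ^ ((j - 1) ^ 2) *
             qpoch \<rho> q (j - 1) * qpoch_inf (q ^ (j + 1) / \<rho>) q /
             ((1 + z) * \<rho> ^ (j - 1) * qpochs_inf [z, inverse z, \<rho>] q) *
             (1 - q ^ j / \<rho> + q ^ (3 * j - 1) / \<rho> - q ^ (4 * j - 2)))) \<and>
     (\<rho> \<noteq> 0 \<and> qpochs_inf [z, inverse z, \<rho>] q \<noteq> 0 \<longrightarrow>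
        G1 \<rho> z q =
          (\<Sum>\<^sub>\<infinity>j\<in>{1::nat..}.
             W (int j) z * (1 - q ^ (2 * j - 1)) * q ^ (j * (j - 1)) *
             qpoch \<rho> q (j - 1) * qpoch_inf (q ^ (j + 1) / \<rho>) q /
             ((1 + z) * \<rho> ^ (j - 1) * qpochs_inf [z, inverse z, \<rho>] q))) \<and>
     (q \<noteq> 0 \<and> qpochs_inf [z, inverse z] (q ^ 2) \<noteq> 0 \<longrightarrow>
        S_G1 z q =
          1 / ((1 + z) * qpochs_inf [z, inverse z, q] (q ^ 2)) *
          (\<Sum>\<^sub>\<infinity>j\<in>{1::nat..}.
             W (int j) z * (-1) ^ (j + 1) * (1 + q ^ (2 * j - 1)) * q ^ ((j - 1) ^ 2))) \<and>
     (q \<noteq> 0 \<and> qpochs_inf [z, inverse z] q \<noteq> 0 \<longrightarrow>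
        S_G2 z q =
          1 / ((1 + z) * qpochs_inf [z, inverse z, q] q) *
          (\<Sum>\<^sub>\<infinity>j\<in>(UNIV :: int set).
             W j z * (-1) powi (j + 1) * q powi (j * (j - 1) div 2) / (1 + q powi (2 * j - 1)))) \<and>
     (q \<noteq> 0 \<and> qpochs_inf [z, inverse z] q \<noteq> 0 \<longrightarrow>
        S_F1 z q =
          1 / ((1 + z) * qpochs_inf [z, inverse z] q) *
          (\<Sum>\<^sub>\<infinity>j\<in>(UNIV :: int set).
             W j z * (-1) powi (j + 1) * q powi (j ^ 2 - 3 * j + 2) * (1 + q powi (j - 1))) \<and>
        1 / ((1 + z) * qpochs_inf [z, inverse z] q) *
          (\<Sum>\<^sub>\<infinity>j\<in>(UNIV :: int set).
             W j z * (-1) powi (j + 1) * q powi (j ^ 2 - 3 * j + 2) * (1 + q powi (j - 1))) =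
          qpochs_inf [inverse z * q ^ 2, z * q ^ 2, q ^ 2] (q ^ 2) /
            qpochs_inf [z * q, inverse z * q] q +
          qpochs_inf [inverse z * q, z * q, q ^ 2] (q ^ 2) / qpochs_inf [z, inverse z] q -
          qpochs_inf [q, q, q ^ 2] (q ^ 2) / qpochs_inf [z, inverse z] q) \<and>
     (q \<noteq> 0 \<and> qpochs_inf [z, inverse z] q \<noteq> 0 \<longrightarrow>
        S_G3 z q =
          1 / ((1 + z) * qpochs_inf [z, inverse z] q) *
          (\<Sum>\<^sub>\<infinity>j\<in>{1::nat..}.
             W (int j) z * (1 - q ^ (2 * j - 1)) * q ^ ((j - 1) ^ 2)))"
proof (cases "q = 0")
  case True
  \<comment> \<open>The conjuncts not covered by \<open>identities_at_zero\<close> carry the premise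
    \<open>q \<noteq> 0\<close>, so they hold vacuously.\<close>
  show ?thesis
    unfolding True by (intro conjI impI identities_at_zero) auto
next
  case False
  note q = assms(1) False and z = assms(2,3)
  show ?thesis
    by (intro conjI impI; (elim conjE)?;
        (rule S_L7_eq[OF q z] S_L9_eq[OF q z] S_L12_eq[OF q z] F2_eq[OF q z] G2_eq[OF q z] F1_eq[OF q z]
          G1_eq[OF q z] S_G1_eq[OF q z] S_G2_eq[OF q z] S_F1_eq[OF q z] S_F1_product[OF q z] S_G3_eq[OF q z]);
        assumption)
qed

end
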